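(* Let $n\ge2$ and $\lambda>0$. For every $f\in C^{0,1}_c(\overline\Sigma)$, $$\underline{\partial_s}\mathcal A[f](0^+)=\frac12\left(\int_\Sigma|\nabla f(x)|^2\,dx-\lambda\int_{\mathbb R^{n-1}}\frac{f(x',\lambda|x'|)^2}{|x'|}\,dx'\right).$$
   Context: Let $n\ge2$ be an integer and $\lambda>0$. Write points of $\mathbb R^{n+1}$ as $(x',x_n,x_{n+1})$ with $x'\in\mathbb R^{n-1}$. Let $\omega_\lambda(x',x_{n+1})=\lambda\sqrt{|x'|^2+x_{n+1}^2}$, let $$\Omega_\lambda=\{(x',x_n,x_{n+1})\in\mathbb R^{n+1}: x_n>\omega_\lambda(x',x_{n+1})\}$$ (a convex circular cone), and let $\Sigma=\Omega_\lambda\cap\{x_{n+1}=0\}$. A point $x=(x',x_n)\in\mathbb R^n$ is identified with $(x,0)\in\mathbb R^{n+1}$, so that $\Sigma=\{(x',x_n)\in\mathbb R^n: x_n>\lambda|x'|\}$ and $\overline\Sigma=\{x_n\ge\lambda|x'|\}$. $C^{0,1}_c(\overline\Sigma)$ is the set of Lipschitz functions $f:\overline\Sigma\to\mathbb R$ whose support $\operatorname{spt}(f)$ is a compact subset of $\overline\Sigma$ (so $f$ need not vanish on $\partial\Sigma$); $\nabla f$ denotes the a.e. defined gradient in $\mathbb R^n$. For $f\in C^{0,1}_c(\overline\Sigma)$, $x\in\overline\Sigma$, $t\in\mathbb R$, define the flow $$\Phi[f](x,t)=\Big(x',\ x_n+\lambda\sqrt{|x'|^2+t^2f(x)^2}-\lambda|x'|,\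 t f(x)\Big)\in\mathbb R^{n+1},$$ the area $A[f](t)=\mathcal H^n\big(\Phi[f](\Sigma\cap\operatorname{spt}(f),t)\big)$ (with $\mathcal H^n$ the $n$-dimensional Hausdorff measure), and, for $s\ge0$, $\mathcal A[f](s)=A[f](\sqrt s)$. The lower right derivative at $0$ is $$\underline{\partial_s}\mathcal A[f](0^+)=\liminf_{s\to0^+}\frac{\mathcal A[f](s)-\mathcal A[f](0)}{s}\in[-\infty,+\infty].$$ The identity is understood in the extended reals: the first integral is finite, while the second has nonnegative integrand and may equal $+\infty$ (when $n=2$), in which case both sides equal $-\infty$. *)

theory Defs
  imports "HOL-Analysis.Analysis"
begin

text \<open>
  Throughout, \<^typ>\<open>real ^ 'm\<close> is the space of the variable \<open>x'\<close>, so that the dimension \<open>n\<close> is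
  \<open>CARD('m) + 1\<close>; every \<open>n \<ge> 2\<close> arises. A point \<open>(x', x\<^sub>n)\<close> of \<open>n\<close>-space has type
  \<^typ>\<open>(real ^ 'm) \<times> real\<close> and a point \<open>(x', x\<^sub>n, x\<^sub>n\<^sub>+\<^sub>1)\<close> of \<open>(n+1)\<close>-space has type
  \<^typ>\<open>(real ^ 'm) \<times> real \<times> real\<close>. The norm on these product types is the Euclidean one.
\<close>

text \<open>
  The \<open>k\<close>-dimensional Hausdorff outer measure, normalised so that it agrees with Lebesgue measure
  on \<open>k\<close>-dimensional Euclidean space. Boundedness of the covering sets is required because
  \<^const>\<open>diameter\<close> is unspecified on unbounded sets. The empty set is treated separately
  because \<open>0 ^ 0 = 1\<close>.
\<close>

definition hausdorff_weight :: "nat \<Rightarrow> 'a::metric_space set \<Rightarrow> ennreal" where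
  "hausdorff_weight k C =
     (if C = {} then 0 else ennreal (unit_ball_vol (real k) * (diameter C / 2) ^ k))"

definition hausdorff_pre :: "nat \<Rightarrow> real \<Rightarrow> 'a::metric_space set \<Rightarrow> ennreal" where
  "hausdorff_pre k \<delta> E =
     (INF C \<in> {C :: nat \<Rightarrow> 'a set. E \<subseteq> (\<Union>j. C j) \<and> (\<forall>j. bounded (C j) \<and> diameter (C j) \<le> \<delta>)}.
        \<Sum>j. hausdorff_weight k (C j))"

definition hausdorff_measure :: "nat \<Rightarrow> 'a::metric_space set \<Rightarrow> ennreal" where
  "hausdorff_measure k E = (SUP \<delta> \<in> {0<..}. hausdorff_pre k \<delta> E)"

text \<open>The value 0 at points of non-differentiability is a convention; for locally Lipschitz \<open>f\<close> on an
  open set these points form a null set by Rademacher's theorem.\<close>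

definition grad :: "('a::real_inner \<Rightarrow> real) \<Rightarrow> 'a \<Rightarrow> 'a" where
  "grad f x = (if \<exists>D. GDERIV f x :> D then THE D. GDERIV f x :> D else 0)"

lemma grad_eqI:
  assumes "GDERIV f x :> D"
  shows "grad f x = D"
proof -
  have "D' = D" if "GDERIV f x :> D'" for D'
  proof -
    have "(\<lambda>h. inner h D') = (\<lambda>h. inner h D)"
      using that assms unfolding gderiv_def by (rule has_derivative_unique)
    from fun_cong[OF this, of "D' - D"] have "inner (D' - D) (D' - D) = 0"
      by (simp only: inner_diff_right diff_self)
    then show ?thesis by simp
  qed
  with assms have "(THE D. GDERIV f x :> D) = D"
    by (rule the_equality)
  with assms show ?thesis
    unfolding grad_def by metis
qed

definition cone_height :: "real \<Rightarrow> real ^ 'm \<Rightarrow> real \<Rightarrow> real" where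
  "cone_height lam x' z = lam * sqrt ((norm x')\<^sup>2 + z\<^sup>2)"

definition cone_dom :: "real \<Rightarrow> ((real ^ 'm) \<times> real \<times> real) set" where
  "cone_dom lam = {(x', y, z). y > cone_height lam x' z}"

text \<open>The open set \<open>\<Sigma>\<close>, under the identification of \<open>(x', x\<^sub>n)\<close> with \<open>(x', x\<^sub>n, 0)\<close>.\<close>

definition slice :: "real \<Rightarrow> ((real ^ 'm) \<times> real) set" where
  "slice lam = {(x', y). (x', y, 0) \<in> cone_dom lam}"

lemma slice_eq: "slice lam = {(x', y). y > lam * norm x'}"
  by (simp add: slice_def cone_dom_def cone_height_def)

lemma open_slice: "open (slice lam :: ((real ^ 'm) \<times> real) set)"
proof -
  have "slice lam = {p :: (real ^ 'm) \<times> real. lam * norm (fst p) < snd p}"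
    by (auto simp: slice_eq)
  also have "open \<dots>"
    by (intro open_Collect_less continuous_intros)
  finally show ?thesis .
qed

lemma closure_slice:
  "closure (slice lam) = {(x', y). y \<ge> lam * norm (x' :: real ^ 'm)}"
proof (rule antisym)
  have "closed {p :: (real ^ 'm) \<times> real. lam * norm (fst p) \<le> snd p}"
    by (intro closed_Collect_le continuous_intros)
  then show "closure (slice lam) \<subseteq> {(x', y). y \<ge> lam * norm (x' :: real ^ 'm)}"
    by (intro closure_minimal) (auto simp: slice_eq case_prod_unfold)
  show "{(x', y). y \<ge> lam * norm (x' :: real ^ 'm)} \<subseteq> closure (slice lam)"
  proof clarify
    fix x' :: "real ^ 'm" and y :: real
    assume "lam * norm x' \<le> y"
    moreover have "inverse (real (Suc k)) > 0" for k
      by simp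
    ultimately have "lam * norm x' < y + inverse (real (Suc k))" for k
      by (smt (verit))
    then have "(x', y + inverse (real (Suc k))) \<in> slice lam" for k
      by (simp only: slice_eq mem_Collect_eq case_prod_conv)
    moreover have "(\<lambda>k. (x', y + inverse (real (Suc k)))) \<longlonglongrightarrow> (x', y + 0)"
      by (intro tendsto_intros LIMSEQ_inverse_real_of_nat)
    ultimately show "(x', y) \<in> closure (slice lam)"
      unfolding closure_sequential
      by (intro exI[of _ "\<lambda>k. (x', y + inverse (real (Suc k)))"]) auto
  qed
qed

text \<open>
  Functions on the closure of \<open>\<Sigma>\<close> are represented by total functions; all definitions below use
  only the values on that closure.
\<close>

definition spt :: "real \<Rightarrow> ((real ^ 'm) \<times> real \<Rightarrow> real) \<Rightarrow> ((real ^ 'm) \<times> real) set" where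
  "spt lam f = closure {x \<in> closure (slice lam). f x \<noteq> 0}"

definition lipschitz_compact_spt :: "real \<Rightarrow> ((real ^ 'm) \<times> real \<Rightarrow> real) set" where
  "lipschitz_compact_spt lam =
     {f. (\<exists>L. L-lipschitz_on (closure (slice lam)) f) \<and> compact (spt lam f)}"

definition flow :: "real \<Rightarrow> ((real ^ 'm) \<times> real \<Rightarrow> real) \<Rightarrow> (real ^ 'm) \<times> real \<Rightarrow> real \<Rightarrow>
    (real ^ 'm) \<times> real \<times> real" where
  "flow lam f x t =
     (fst x,
      snd x + lam * sqrt ((norm (fst x))\<^sup>2 + t\<^sup>2 * (f x)\<^sup>2) - lam * norm (fst x),
      t * f x)"

definition area :: "real \<Rightarrow> ((real ^ 'm) \<times> real \<Rightarrow> real) \<Rightarrow> real \<Rightarrow> ennreal" where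
  "area lam f t = hausdorff_measure (CARD('m) + 1) ((\<lambda>x. flow lam f x t) ` (slice lam \<inter> spt lam f))"

definition area_sqrt :: "real \<Rightarrow> ((real ^ 'm) \<times> real \<Rightarrow> real) \<Rightarrow> real \<Rightarrow> ennreal" where
  "area_sqrt lam f s = area lam f (sqrt s)"

definition lower_right_deriv_0 :: "(real \<Rightarrow> ereal) \<Rightarrow> ereal" where
  "lower_right_deriv_0 F = Liminf (at_right 0) (\<lambda>s. (F s - F 0) / ereal s)"

end

theory Submission
  imports Defs
begin

text \<open>
  The surface at time \<open>t\<close> is parametrised by \<open>\<Phi> = (x', W, t f)\<close> with
  \<open>W = x\<^sub>n + \<lambda> (q - |x'|)\<close> and \<open>q = sqrt (|x'|\<^sup>2 + t\<^sup>2 f\<^sup>2)\<close>. Its Jacobian satisfies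
  \<open>J\<^sup>2 = (1 + u)\<^sup>2 + t\<^sup>2 K\<close> with \<open>u = \<lambda> \<partial>\<^sub>n q\<close>, so \<open>J = 1 + u + t\<^sup>2 K / (J + 1 + u)\<close>. The last term is
  \<open>t\<^sup>2\<close> times a bounded function that converges almost everywhere to \<open>|\<nabla> f|\<^sup>2 / 2\<close>. The integral
  of \<open>u\<close> is computed exactly on vertical lines and equals \<open>- \<lambda>\<close> times the integral of
  \<open>q - |x'|\<close> over the boundary of the cone, where \<open>(q - |x'|) / t\<^sup>2 = f\<^sup>2 / (q + |x'|)\<close> increases to
  \<open>f\<^sup>2 / (2 |x'|)\<close> as \<open>t\<close> decreases to \<open>0\<close>. Dominated and monotone convergence then show that the
  difference quotient even converges.

  The area formula for \<open>\<Phi>\<close> follows from Rademacher's theorem by cutting the domain into countably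
  many pieces on which \<open>\<Phi>\<close> is bi-Lipschitz, with constants close to \<open>1\<close>, to a linear map of \<open>n\<close>-space
  into itself. There Hausdorff and Lebesgue measure agree by Vitali's covering theorem and the
  isodiametric inequality, the latter by Steiner symmetrization.
\<close>

section \<open>Hausdorff measure\<close>

text \<open>The term \<open>u\<close> has to be split off and integrated exactly. Pointwise,
  \<open>u / t\<^sup>2\<close> tends to \<open>\<lambda> f \<partial>\<^sub>n f / |x'|\<close>,
  which has no sign and may fail to be integrable when \<open>n = 2\<close>, so neither monotone nor
  dominated convergence applies to it; the uniform bound \<open>|u| \<le> \<lambda> t L\<close> is
  one power of \<open>t\<close> short. Integration along vertical lines moves the term to the
  boundary of the cone, where the integrand is nonnegative and monotone in \<open>t\<close>. For
  every fixed \<open>t > 0\<close> the boundary integral is finite, so all difference quotients are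
  real and the value \<open>-\<infinity>\<close> can arise only in the limit.

  The restriction \<open>\<lambda> t L \<le> 1 / 2\<close> keeps \<open>1 + u \<ge> 1 / 2\<close>.
  This makes the linear approximations of \<Phi> uniformly injective, as the area formula requires,
  and it keeps the denominator \<open>J + 1 + u\<close> at least \<open>1\<close>.

  Since \<open>f\<close> lives on the closed cone only, it is first extended to a Lipschitz function
  on the whole space.\<close>

lemma hausdorff_pre_le:
  assumes "E \<subseteq> (\<Union>j. C j)" "\<And>j. bounded (C j)" "\<And>j. diameter (C j) \<le> \<delta>"
  shows "hausdorff_pre k \<delta> E \<le> (\<Sum>j. hausdorff_weight k (C j))"
  unfolding hausdorff_pre_def by (rule INF_lower) (use assms in auto)

lemma hausdorff_pre_lessE:
  assumes "hausdorff_pre k \<delta> E < x"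
  obtains C :: "nat \<Rightarrow> 'a::metric_space set"
  where "E \<subseteq> (\<Union>j. C j)" "\<And>j. bounded (C j)" "\<And>j. diameter (C j) \<le> \<delta>"
    "(\<Sum>j. hausdorff_weight k (C j)) < x"
  using assms unfolding hausdorff_pre_def INF_less_iff by auto

lemma hausdorff_pre_greatest:
  assumes "\<And>C :: nat \<Rightarrow> 'a::metric_space set. E \<subseteq> (\<Union>j. C j) \<Longrightarrow> (\<And>j. bounded (C j)) \<Longrightarrow>
     (\<And>j. diameter (C j) \<le> \<delta>) \<Longrightarrow> x \<le> (\<Sum>j. hausdorff_weight k (C j))"
  shows "x \<le> hausdorff_pre k \<delta> E"
  unfolding hausdorff_pre_def by (rule INF_greatest) (use assms in auto)

lemma hausdorff_pre_mono: "E \<subseteq> F \<Longrightarrow> hausdorff_pre k \<delta> E \<le> hausdorff_pre k \<delta> F"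
  unfolding hausdorff_pre_def by (rule INF_superset_mono) auto

lemma hausdorff_pre_antimono: "\<delta> \<le> \<delta>' \<Longrightarrow> hausdorff_pre k \<delta>' E \<le> hausdorff_pre k \<delta> E"
  unfolding hausdorff_pre_def by (rule INF_superset_mono) (auto intro: order_trans)

lemma hausdorff_pre_le_measure: "0 < \<delta> \<Longrightarrow> hausdorff_pre k \<delta> E \<le> hausdorff_measure k E"
  unfolding hausdorff_measure_def by (rule SUP_upper) auto

lemma hausdorff_measure_least:
  "(\<And>\<delta>. 0 < \<delta> \<Longrightarrow> hausdorff_pre k \<delta> E \<le> x) \<Longrightarrow> hausdorff_measure k E \<le> x"
  unfolding hausdorff_measure_def by (rule SUP_least) auto

lemma hausdorff_measure_mono: "E \<subseteq> F \<Longrightarrow> hausdorff_measure k E \<le> hausdorff_measure k F"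
  by (meson hausdorff_measure_least hausdorff_pre_le_measure hausdorff_pre_mono order_trans)

lemma hausdorff_weight_empty [simp]: "hausdorff_weight k {} = 0"
  by (simp add: hausdorff_weight_def)

lemma hausdorff_pre_empty [simp]: "0 < \<delta> \<Longrightarrow> hausdorff_pre k \<delta> {} = 0"
  using hausdorff_pre_le[of "{}" "\<lambda>_. {}" \<delta> k] by simp

lemma hausdorff_measure_empty [simp]: "hausdorff_measure k {} = 0"
  by (metis hausdorff_measure_least hausdorff_pre_empty le_zero_eq)

section \<open>Subadditivity, and additivity over separated or compact sets\<close>

lemma hausdorff_pre_UN_le:
  fixes A :: "nat \<Rightarrow> 'a::metric_space set"
  shows "hausdorff_pre k \<delta> (\<Union>i. A i) \<le> (\<Sum>i. hausdorff_pre k \<delta> (A i))"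
proof (rule ennreal_le_epsilon)
  fix e :: real
  assume fin: "(\<Sum>i. hausdorff_pre k \<delta> (A i)) < top" and e: "0 < e"
  have "hausdorff_pre k \<delta> (A i) < hausdorff_pre k \<delta> (A i) + ennreal (e * (1/2) ^ Suc i)" for i
  proof -
    have "hausdorff_pre k \<delta> (A i) \<noteq> top"
      using fin
      by (metis (no_types, lifting) ennreal_suminf_lessD order_less_irrefl)
    then show ?thesis using e by (simp add: ennreal_add_left_cancel_less less_top)
  qed
  then have "\<exists>C. A i \<subseteq> (\<Union>j. C j) \<and> (\<forall>j. bounded (C j)) \<and> (\<forall>j. diameter (C j) \<le> \<delta>) \<and>
    (\<Sum>j. hausdorff_weight k (C j)) \<le> hausdorff_pre k \<delta> (A i) + ennreal (e * (1/2) ^ Suc i)" for i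
    using hausdorff_pre_lessE[of k \<delta> "A i"] by (metis less_imp_le)
  then obtain C where C: "\<And>i. A i \<subseteq> (\<Union>j. C i j)" "\<And>i j. bounded (C i j)"
     "\<And>i j. diameter (C i j) \<le> \<delta>"
     "\<And>i. (\<Sum>j. hausdorff_weight k (C i j)) \<le> hausdorff_pre k \<delta> (A i) + ennreal (e * (1/2) ^ Suc i)"
    by metis
  let ?D = "\<lambda>(i,j). C i j"
  have "hausdorff_pre k \<delta> (\<Union>i. A i) \<le> (\<Sum>n. hausdorff_weight k (?D (prod_decode n)))"
  proof (rule hausdorff_pre_le)
    show "(\<Union>i. A i) \<subseteq> (\<Union>n. ?D (prod_decode n))"
    proof
      fix x assume "x \<in> (\<Union>i. A i)"
      then obtain i j where "x \<in> C i j" using C(1) by blast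
      then show "x \<in> (\<Union>n. ?D (prod_decode n))"
        by (intro UN_I[of "prod_encode (i,j)"]) auto
    qed
  qed (use C in \<open>auto split: prod.split\<close>)
  also have "\<dots> = (\<Sum>i. \<Sum>j. hausdorff_weight k (C i j))"
    by (rule suminf_ennreal_2dimen[where f="\<lambda>p. hausdorff_weight k (?D p)"]) simp
  also have "\<dots> \<le> (\<Sum>i. hausdorff_pre k \<delta> (A i) + ennreal (e * (1/2) ^ Suc i))"
    by (intro suminf_le C) auto
  also have "\<dots> = (\<Sum>i. hausdorff_pre k \<delta> (A i)) + (\<Sum>i. ennreal (e * (1/2) ^ Suc i))"
    by (rule suminf_add[symmetric]) auto
  also have "(\<Sum>i. ennreal (e * (1/2) ^ Suc i)) = ennreal e"
    using e sums_mult[OF power_half_series, of e]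
    by (intro suminf_ennreal_eq) auto
  finally show "hausdorff_pre k \<delta> (\<Union>i. A i) \<le> (\<Sum>i. hausdorff_pre k \<delta> (A i)) + ennreal e" .
qed

lemma hausdorff_measure_UN_le:
  fixes A :: "nat \<Rightarrow> 'a::metric_space set"
  shows "hausdorff_measure k (\<Union>i. A i) \<le> (\<Sum>i. hausdorff_measure k (A i))"
proof (rule hausdorff_measure_least)
  fix \<delta> :: real assume "0 < \<delta>"
  have "hausdorff_pre k \<delta> (\<Union>i. A i) \<le> (\<Sum>i. hausdorff_pre k \<delta> (A i))"
    by (rule hausdorff_pre_UN_le)
  also have "\<dots> \<le> (\<Sum>i. hausdorff_measure k (A i))"
    by (intro suminf_le hausdorff_pre_le_measure \<open>0 < \<delta>\<close>) auto
  finally show "hausdorff_pre k \<delta> (\<Union>i. A i) \<le> (\<Sum>i. hausdorff_measure k (A i))" .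
qed

lemma hausdorff_measure_Un_le:
  "hausdorff_measure k (A \<union> B) \<le> hausdorff_measure k A + hausdorff_measure k B"
  using hausdorff_measure_UN_le[of k "binaryset A B"]
  by (simp add: UN_binaryset_eq suminf_binaryset_eq)

lemma hausdorff_pre_Un_le:
  assumes "0 < \<delta>"
  shows "hausdorff_pre k \<delta> (A \<union> B) \<le> hausdorff_pre k \<delta> A + hausdorff_pre k \<delta> B"
  using hausdorff_pre_UN_le[of k \<delta> "binaryset A B"] assms
  by (simp add: UN_binaryset_eq suminf_binaryset_eq)

text \<open>A set of diameter below \<open>d\<close> cannot meet both \<open>A\<close> and
  \<open>B\<close>, so every sufficiently fine cover of the union contains two subfamilies without
  common nonempty members, one covering \<open>A\<close> and one covering \<open>B\<close>.\<close>

lemma hausdorff_measure_Un_separated: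
  assumes d: "0 < d" and sep: "\<And>a b. a \<in> A \<Longrightarrow> b \<in> B \<Longrightarrow> d \<le> dist a b"
  shows "hausdorff_measure k A + hausdorff_measure k B \<le> hausdorff_measure k (A \<union> B)"
proof -
  have *: "hausdorff_pre k \<delta> A + hausdorff_pre k \<delta> B \<le> hausdorff_pre k \<delta> (A \<union> B)"
    if \<delta>: "0 < \<delta>" "\<delta> < d" for \<delta>
  proof (rule hausdorff_pre_greatest)
    fix C :: "nat \<Rightarrow> 'a set"
    assume C: "A \<union> B \<subseteq> (\<Union>j. C j)" "\<And>j. bounded (C j)" "\<And>j. diameter (C j) \<le> \<delta>"
    define CA where "CA j = (if C j \<inter> A = {} then {} else C j)" for j
    define CB where "CB j = (if C j \<inter> B = {} then {} else C j)" for j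
    have "hausdorff_pre k \<delta> A \<le> (\<Sum>j. hausdorff_weight k (CA j))"
    proof (rule hausdorff_pre_le)
      show "A \<subseteq> (\<Union>j. CA j)" unfolding CA_def using C(1) by fastforce
    qed (use C \<delta> in \<open>auto simp: CA_def\<close>)
    moreover have "hausdorff_pre k \<delta> B \<le> (\<Sum>j. hausdorff_weight k (CB j))"
    proof (rule hausdorff_pre_le)
      show "B \<subseteq> (\<Union>j. CB j)" unfolding CB_def using C(1) by fastforce
    qed (use C \<delta> in \<open>auto simp: CB_def\<close>)
    ultimately have "hausdorff_pre k \<delta> A + hausdorff_pre k \<delta> B \<le>
        (\<Sum>j. hausdorff_weight k (CA j)) + (\<Sum>j. hausdorff_weight k (CB j))"
      by (rule add_mono)
    also have "\<dots> = (\<Sum>j. hausdorff_weight k (CA j) + hausdorff_weight k (CB j))"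
      by (rule suminf_add) auto
    also have "\<dots> \<le> (\<Sum>j. hausdorff_weight k (C j))"
    proof (intro suminf_le)
      fix j
      have False if "a \<in> C j \<inter> A" "b \<in> C j \<inter> B" for a b
        using sep[of a b] that diameter_bounded_bound[OF C(2), of a j b] C(3)[of j] \<delta> by auto
      then consider "C j \<inter> A = {}" | "C j \<inter> B = {}" by blast
      then show "hausdorff_weight k (CA j) + hausdorff_weight k (CB j) \<le> hausdorff_weight k (C j)"
        by cases (simp_all add: CA_def CB_def)
    qed auto
    finally show "hausdorff_pre k \<delta> A + hausdorff_pre k \<delta> B \<le> (\<Sum>j. hausdorff_weight k (C j))" .
  qed
  \<comment> \<open>The two suprema run over independent scales; both are refined to a common scale
    below \<open>d\<close>, which can only increase the premeasures.\<close>
  have "hausdorff_pre k \<delta>1 A + hausdorff_pre k \<delta>2 B \<le> hausdorff_measure k (A \<union> B)"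
    if "0 < \<delta>1" "0 < \<delta>2" for \<delta>1 \<delta>2
  proof -
    let ?\<delta> = "min (d/2) (min \<delta>1 \<delta>2)"
    have "hausdorff_pre k \<delta>1 A + hausdorff_pre k \<delta>2 B \<le> hausdorff_pre k ?\<delta> A + hausdorff_pre k ?\<delta> B"
      by (intro add_mono hausdorff_pre_antimono) auto
    also have "\<dots> \<le> hausdorff_pre k ?\<delta> (A \<union> B)" using that d by (intro *) auto
    also have "\<dots> \<le> hausdorff_measure k (A \<union> B)" using that d by (intro hausdorff_pre_le_measure) auto
    finally show ?thesis .
  qed
  then have "hausdorff_pre k \<delta>1 A + hausdorff_measure k B \<le> hausdorff_measure k (A \<union> B)"
    if "0 < \<delta>1" for \<delta>1
    unfolding hausdorff_measure_def[of k B] using that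
    by (subst ennreal_SUP_add_right) (auto intro!: SUP_least)
  then show ?thesis
    unfolding hausdorff_measure_def[of k A]
    by (subst ennreal_SUP_add_left[symmetric]) (auto intro!: SUP_least)
qed

text \<open>Disjoint compact sets lie at positive distance, so the separated case applies by
  induction. This provides additivity from below for the lower half of the area formula, where the
  pieces are images of compact sets.\<close>

lemma hausdorff_measure_UN_compact:
  fixes K :: "'i \<Rightarrow> 'a::heine_borel set"
  assumes "finite I" "disjoint_family_on K I" "\<And>i. i \<in> I \<Longrightarrow> compact (K i)"
  shows "(\<Sum>i\<in>I. hausdorff_measure k (K i)) \<le> hausdorff_measure k (\<Union>i\<in>I. K i)"
  using assms
proof (induction I rule: finite_induct)
  case (insert x F)
  have c: "compact (K x)" "compact (\<Union>i\<in>F. K i)" using insert by auto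
  have dj: "K x \<inter> (\<Union>i\<in>F. K i) = {}"
    using insert by (fastforce simp: disjoint_family_on_def)
  obtain d where d: "0 < d" "\<And>a b. a \<in> K x \<Longrightarrow> b \<in> (\<Union>i\<in>F. K i) \<Longrightarrow> d \<le> dist a b"
    using separate_compact_closed[OF c(1) compact_imp_closed[OF c(2)] dj] by metis
  have "(\<Sum>i\<in>insert x F. hausdorff_measure k (K i)) = hausdorff_measure k (K x) + (\<Sum>i\<in>F. hausdorff_measure k (K i))"
    using insert by simp
  also have "\<dots> \<le> hausdorff_measure k (K x) + hausdorff_measure k (\<Union>i\<in>F. K i)"
    using insert by (intro add_mono insert.IH) (auto simp: disjoint_family_on_def)
  also have "\<dots> \<le> hausdorff_measure k (K x \<union> (\<Union>i\<in>F. K i))"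
    by (rule hausdorff_measure_Un_separated[OF d])
  finally show ?case by simp
qed simp

lemma hausdorff_weight_lipschitz_image:
  assumes "L-lipschitz_on A g" "0 < L" "C \<subseteq> A" "bounded C"
  shows "diameter (g ` C) \<le> L * diameter C"
    "hausdorff_weight k (g ` C) \<le> ennreal (L ^ k) * hausdorff_weight k C" "bounded (g ` C)"
proof -
  have *: "dist (g x) (g y) \<le> L * diameter C" if "x \<in> C" "y \<in> C" for x y
  proof -
    have "dist (g x) (g y) \<le> L * dist x y" using assms that lipschitz_onD by blast
    also have "\<dots> \<le> L * diameter C" using assms that by (intro mult_left_mono diameter_bounded_bound) auto
    finally show ?thesis .
  qed
  show "bounded (g ` C)"
    unfolding bounded_two_points using * by (auto intro!: exI[of _ "L * diameter C"])
  show 1: "diameter (g ` C) \<le> L * diameter C"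
  proof (cases "C = {}")
    case False
    have "(SUP p\<in>C \<times> C. case p of (x, y) \<Rightarrow> dist (g x) (g y)) \<le> L * diameter C"
      using * False by (intro cSUP_least) auto
    moreover have "(\<lambda>(x, y). dist x y) ` (g ` C \<times> g ` C) = (\<lambda>(x, y). dist (g x) (g y)) ` (C \<times> C)"
      by force
    ultimately show ?thesis using False by (simp add: diameter_def)
  qed simp
  show "hausdorff_weight k (g ` C) \<le> ennreal (L ^ k) * hausdorff_weight k C"
  proof (cases "C = {}")
    case False
    have "(diameter (g ` C) / 2) ^ k \<le> (L * diameter C / 2) ^ k"
      using 1 diameter_ge_0[OF \<open>bounded (g ` C)\<close>] by (intro power_mono) auto
    also have "\<dots> = L ^ k * (diameter C / 2) ^ k" by (simp add: power_mult_distrib power_divide)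
    finally have "unit_ball_vol (real k) * (diameter (g ` C) / 2) ^ k \<le>
       L ^ k * (unit_ball_vol (real k) * (diameter C / 2) ^ k)"
      by (simp add: mult_left_mono mult.left_commute)
    then show ?thesis using False assms diameter_ge_0[OF \<open>bounded C\<close>]
      by (simp add: hausdorff_weight_def ennreal_mult'[symmetric] ennreal_leI)
  qed simp
qed

lemma hausdorff_measure_lipschitz_image:
  assumes L: "L-lipschitz_on A g" "0 < L"
  shows "hausdorff_measure k (g ` A) \<le> ennreal (L ^ k) * hausdorff_measure k A"
proof (rule hausdorff_measure_least)
  fix \<delta> :: real assume \<delta>: "0 < \<delta>"
  have *: "hausdorff_pre k \<delta> (g ` A) \<le> ennreal (L ^ k) * (\<Sum>j. hausdorff_weight k (C j))"
    if C: "A \<subseteq> (\<Union>j. C j)" "\<And>j. bounded (C j)" "\<And>j. diameter (C j) \<le> \<delta> / L" for C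
  proof -
    \<comment> \<open>\<open>g\<close> is Lipschitz on \<open>A\<close> only, so the cover is first
      cut down to \<open>A\<close>.\<close>
    have b: "bounded (C j \<inter> A)" for j using C(2) by (auto intro: bounded_subset)
    have "hausdorff_pre k \<delta> (g ` A) \<le> (\<Sum>j. hausdorff_weight k (g ` (C j \<inter> A)))"
    proof (rule hausdorff_pre_le)
      show "diameter (g ` (C j \<inter> A)) \<le> \<delta>" for j
      proof -
        have "diameter (g ` (C j \<inter> A)) \<le> L * diameter (C j \<inter> A)"
          by (rule hausdorff_weight_lipschitz_image[OF L _ b]) auto
        also have "\<dots> \<le> L * (\<delta> / L)"
          using L C(3)[of j] diameter_subset[of "C j \<inter> A" "C j"] C(2)[of j] by (intro mult_left_mono) auto
        finally show ?thesis using L by simp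
      qed
      show "bounded (g ` (C j \<inter> A))" for j
        by (rule hausdorff_weight_lipschitz_image[OF L _ b]) auto
      show "g ` A \<subseteq> (\<Union>j. g ` (C j \<inter> A))" using C(1) by blast
    qed
    also have "\<dots> \<le> (\<Sum>j. ennreal (L ^ k) * hausdorff_weight k (C j \<inter> A))"
      by (intro suminf_le hausdorff_weight_lipschitz_image[OF L _ b]) auto
    also have "\<dots> \<le> (\<Sum>j. ennreal (L ^ k) * hausdorff_weight k (C j))"
    proof (intro suminf_le mult_left_mono)
      show "hausdorff_weight k (C j \<inter> A) \<le> hausdorff_weight k (C j)" for j
        using hausdorff_weight_lipschitz_image(2)[of 1 UNIV "\<lambda>x. x" "C j"] 
          diameter_subset[of "C j \<inter> A" "C j"] C(2)[of j] diameter_ge_0[OF b]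
        by (auto simp: hausdorff_weight_def intro!: ennreal_leI mult_left_mono power_mono)
    qed auto
    also have "\<dots> = ennreal (L ^ k) * (\<Sum>j. hausdorff_weight k (C j))" by simp
    finally show ?thesis .
  qed
  have "hausdorff_pre k \<delta> (g ` A) \<le> ennreal (L ^ k) * hausdorff_pre k (\<delta> / L) A"
  proof -
    have "hausdorff_pre k \<delta> (g ` A) / ennreal (L ^ k) \<le> hausdorff_pre k (\<delta> / L) A"
    proof (rule hausdorff_pre_greatest)
      fix C :: "nat \<Rightarrow> _ set"
      assume "A \<subseteq> (\<Union>j. C j)" "\<And>j. bounded (C j)" "\<And>j. diameter (C j) \<le> \<delta> / L"
      from *[OF this] show "hausdorff_pre k \<delta> (g ` A) / ennreal (L ^ k) \<le> (\<Sum>j. hausdorff_weight k (C j))"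
        using L by (simp add: divide_le_posI_ennreal)
    qed
    then have "hausdorff_pre k \<delta> (g ` A) / ennreal (L ^ k) * ennreal (L ^ k)
       \<le> hausdorff_pre k (\<delta> / L) A * ennreal (L ^ k)"
      by (rule mult_right_mono) simp
    moreover have "hausdorff_pre k \<delta> (g ` A) / ennreal (L ^ k) * ennreal (L ^ k) = hausdorff_pre k \<delta> (g ` A)"
      using L by (subst ennreal_divide_times) simp
    ultimately show ?thesis by (simp only: mult.commute)
  qed
  also have "\<dots> \<le> ennreal (L ^ k) * hausdorff_measure k A"
    using L \<delta> by (intro mult_left_mono hausdorff_pre_le_measure) auto
  finally show "hausdorff_pre k \<delta> (g ` A) \<le> ennreal (L ^ k) * hausdorff_measure k A" .
qed

section \<open>Lebesgue measure along lines and the isodiametric inequality\<close>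

lemma nn_integral_lborel_translate:
  fixes G :: "'a::euclidean_space \<Rightarrow> ennreal"
  assumes [measurable]: "G \<in> borel_measurable borel"
  shows "(\<integral>\<^sup>+x. G (x + c) \<partial>lborel) = (\<integral>\<^sup>+x. G x \<partial>lborel)"
proof -
  have "(\<integral>\<^sup>+x. G x \<partial>lborel) = (\<integral>\<^sup>+x. G x \<partial>distr lborel borel ((+) c))"
    by (simp add: lborel_distr_plus)
  also have "\<dots> = (\<integral>\<^sup>+x. G (c + x) \<partial>lborel)"
    by (rule nn_integral_distr) auto
  finally show ?thesis by (simp add: add.commute)
qed

lemma nn_integral_lborel_real_affine:
  fixes g :: "real \<Rightarrow> ennreal"
  assumes "g \<in> borel_measurable borel" "c \<noteq> 0"
  shows "(\<integral>\<^sup>+s. g (t + c * s) \<partial>lborel) = ennreal (1 / \<bar>c\<bar>) * (\<integral>\<^sup>+s. g s \<partial>lborel)"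
proof -
  have "(\<integral>\<^sup>+s. g s \<partial>lborel) = ennreal \<bar>c\<bar> * (\<integral>\<^sup>+s. g (t + c * s) \<partial>lborel)"
    using nn_integral_real_affine[OF assms, of t] by simp
  then have "ennreal (1 / \<bar>c\<bar>) * (\<integral>\<^sup>+s. g s \<partial>lborel) =
      ennreal (1 / \<bar>c\<bar> * \<bar>c\<bar>) * (\<integral>\<^sup>+s. g (t + c * s) \<partial>lborel)"
    by (subst ennreal_mult) (auto simp: mult.assoc)
  then show ?thesis using assms by simp
qed

text \<open>Integrating along the lines in direction \<open>b\<close> that start in a slab of width \<open>1\<close> replaces
  a choice of coordinates adapted to \<open>b\<close>.\<close>

lemma nn_integral_lborel_slab:
  fixes G :: "'a::euclidean_space \<Rightarrow> ennreal"
  assumes [measurable]: "G \<in> borel_measurable borel" and ab: "a \<bullet> b = 1"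
  shows "(\<integral>\<^sup>+x. G x \<partial>lborel) =
    (\<integral>\<^sup>+x. indicator {0..1} (x \<bullet> a) * (\<integral>\<^sup>+s. G (x + s *\<^sub>R b) \<partial>lborel) \<partial>lborel)"
proof -
  have "(\<integral>\<^sup>+x. indicator {0..1} (x \<bullet> a) * (\<integral>\<^sup>+s. G (x + s *\<^sub>R b) \<partial>lborel) \<partial>lborel) =
    (\<integral>\<^sup>+x. (\<integral>\<^sup>+s. indicator {0..1} (x \<bullet> a) * G (x + s *\<^sub>R b) \<partial>lborel) \<partial>lborel)"
    by (intro nn_integral_cong nn_integral_cmult[symmetric]) auto
  also have "\<dots> = (\<integral>\<^sup>+s. (\<integral>\<^sup>+x. indicator {0..1} (x \<bullet> a) * G (x + s *\<^sub>R b) \<partial>lborel) \<partial>lborel)"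
    by (rule lborel_pair.Fubini') auto
  also have "\<dots> = (\<integral>\<^sup>+s. (\<integral>\<^sup>+x. indicator {0..1} (x \<bullet> a - s) * G x \<partial>lborel) \<partial>lborel)"
  proof (rule nn_integral_cong)
    fix s :: real
    have "(\<integral>\<^sup>+x. indicator {0..1} (x \<bullet> a - s) * G x \<partial>lborel) =
      (\<integral>\<^sup>+x. indicator {0..1} ((x + s *\<^sub>R b) \<bullet> a - s) * G (x + s *\<^sub>R b) \<partial>lborel)"
      by (rule nn_integral_lborel_translate[symmetric]) auto
    also have "\<dots> = (\<integral>\<^sup>+x. indicator {0..1} (x \<bullet> a) * G (x + s *\<^sub>R b) \<partial>lborel)"
      using ab by (simp add: inner_add_left inner_commute[of b a])
    finally show "(\<integral>\<^sup>+x. indicator {0..1} (x \<bullet> a) * G (x + s *\<^sub>R b) \<partial>lborel) =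
      (\<integral>\<^sup>+x. indicator {0..1} (x \<bullet> a - s) * G x \<partial>lborel)" ..
  qed
  also have "\<dots> = (\<integral>\<^sup>+x. (\<integral>\<^sup>+s. indicator {0..1} (x \<bullet> a - s) * G x \<partial>lborel) \<partial>lborel)"
    by (rule lborel_pair.Fubini') auto
  also have "\<dots> = (\<integral>\<^sup>+x. G x \<partial>lborel)"
  proof (rule nn_integral_cong)
    fix x
    have "(\<integral>\<^sup>+s. indicator {0..1} (x \<bullet> a - s) * G x \<partial>lborel) = (\<integral>\<^sup>+s. indicator {0..1} (x \<bullet> a - s) \<partial>lborel) * G x"
      by (rule nn_integral_multc) auto
    also have "(\<integral>\<^sup>+s. indicator {0..1} (x \<bullet> a - s) \<partial>lborel) = (\<integral>\<^sup>+s. indicator {x \<bullet> a - 1..x \<bullet> a} s \<partial>(lborel :: real measure))"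
      by (intro nn_integral_cong) (auto split: split_indicator)
    also have "\<dots> = 1" by simp
    finally show "(\<integral>\<^sup>+s. indicator {0..1} (x \<bullet> a - s) * G x \<partial>lborel) = G x" by simp
  qed
  finally show ?thesis ..
qed

text \<open>Every line in direction \<open>b\<close> is mapped into itself by an affine map of slope
  \<open>1 + a \<bullet> b\<close>, so the substitution is one-dimensional on each line. The slope
  is the determinant of this rank-one perturbation of the identity.\<close>

lemma nn_integral_rank_one:
  fixes G :: "'a::euclidean_space \<Rightarrow> ennreal"
  assumes [measurable]: "G \<in> borel_measurable borel" and ab: "1 + a \<bullet> b \<noteq> 0"
  shows "(\<integral>\<^sup>+x. G (x + (x \<bullet> a) *\<^sub>R b) \<partial>lborel) = ennreal (1 / \<bar>1 + a \<bullet> b\<bar>) * (\<integral>\<^sup>+x. G x \<partial>lborel)"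
proof (cases "b = 0")
  case False
  \<comment> \<open>The slab is normal to \<open>b\<close>; the scaling gives
    \<open>c \<bullet> b = 1\<close>.\<close>
  define c where "c = b /\<^sub>R (b \<bullet> b)"
  have cb: "c \<bullet> b = 1" using False by (simp add: c_def)
  have "(\<integral>\<^sup>+x. G (x + (x \<bullet> a) *\<^sub>R b) \<partial>lborel) =
    (\<integral>\<^sup>+x. indicator {0..1} (x \<bullet> c) * (\<integral>\<^sup>+s. G (x + s *\<^sub>R b + ((x + s *\<^sub>R b) \<bullet> a) *\<^sub>R b) \<partial>lborel) \<partial>lborel)"
    by (rule nn_integral_lborel_slab[OF _ cb]) auto
  also have "\<dots> = (\<integral>\<^sup>+x. ennreal (1 / \<bar>1 + a \<bullet> b\<bar>) * (indicator {0..1} (x \<bullet> c) * (\<integral>\<^sup>+s. G (x + s *\<^sub>R b) \<partial>lborel)) \<partial>lborel)"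
  proof (rule nn_integral_cong)
    fix x
    have "(\<integral>\<^sup>+s. G (x + s *\<^sub>R b + ((x + s *\<^sub>R b) \<bullet> a) *\<^sub>R b) \<partial>lborel) =
      (\<integral>\<^sup>+s. G (x + (x \<bullet> a + (1 + a \<bullet> b) * s) *\<^sub>R b) \<partial>lborel)"
      by (intro nn_integral_cong arg_cong[where f=G])
         (simp add: algebra_simps inner_commute)
    also have "\<dots> = ennreal (1 / \<bar>1 + a \<bullet> b\<bar>) * (\<integral>\<^sup>+s. G (x + s *\<^sub>R b) \<partial>lborel)"
      by (rule nn_integral_lborel_real_affine[where g="\<lambda>s. G (x + s *\<^sub>R b)"]) (use ab in auto)
    finally show "indicator {0..1} (x \<bullet> c) * (\<integral>\<^sup>+s. G (x + s *\<^sub>R b + ((x + s *\<^sub>R b) \<bullet> a) *\<^sub>R b) \<partial>lborel) =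
       ennreal (1 / \<bar>1 + a \<bullet> b\<bar>) * (indicator {0..1} (x \<bullet> c) * (\<integral>\<^sup>+s. G (x + s *\<^sub>R b) \<partial>lborel))"
      by (simp add: ac_simps)
  qed
  also have "\<dots> = ennreal (1 / \<bar>1 + a \<bullet> b\<bar>) * (\<integral>\<^sup>+x. indicator {0..1} (x \<bullet> c) * (\<integral>\<^sup>+s. G (x + s *\<^sub>R b) \<partial>lborel) \<partial>lborel)"
    by (rule nn_integral_cmult) auto
  also have "(\<integral>\<^sup>+x. indicator {0..1} (x \<bullet> c) * (\<integral>\<^sup>+s. G (x + s *\<^sub>R b) \<partial>lborel) \<partial>lborel) = (\<integral>\<^sup>+x. G x \<partial>lborel)"
    by (rule nn_integral_lborel_slab[OF _ cb, symmetric]) auto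
  finally show ?thesis .
qed simp

section \<open>Steiner symmetrization and the isodiametric inequality\<close>

definition line_length :: "'a::euclidean_space set \<Rightarrow> 'a \<Rightarrow> 'a \<Rightarrow> ennreal" where
  "line_length A b x = emeasure lborel {s. x + s *\<^sub>R b \<in> A}"

text \<open>The inequality is strict so that lines missing \<open>A\<close> contribute nothing: the projection of \<open>A\<close>
  along \<open>b\<close> need not be a Borel set.\<close>

definition symmetrization :: "'a::euclidean_space \<Rightarrow> 'a set \<Rightarrow> 'a set" where
  "symmetrization b A = {x. ennreal (2 * \<bar>x \<bullet> b\<bar>) < line_length A b x}"

lemma line_length_eq_nn_integral:
  assumes [measurable]: "A \<in> sets borel"
  shows "line_length A b x = (\<integral>\<^sup>+s. indicator A (x + s *\<^sub>R b) \<partial>lborel)"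
proof -
  have "line_length A b x = (\<integral>\<^sup>+s. indicator {s. x + s *\<^sub>R b \<in> A} s \<partial>lborel)"
    unfolding line_length_def by (rule nn_integral_indicator[symmetric]) measurable
  then show ?thesis by (simp add: indicator_def)
qed

lemma borel_measurable_line_length [measurable]:
  assumes [measurable]: "A \<in> sets borel"
  shows "line_length A b \<in> borel_measurable borel"
  unfolding line_length_eq_nn_integral[OF assms, abs_def] by measurable

lemma sets_symmetrization [measurable]:
  assumes [measurable]: "A \<in> sets borel"
  shows "symmetrization b A \<in> sets borel"
  unfolding symmetrization_def by measurable

lemma line_length_translate:
  assumes [measurable]: "A \<in> sets borel"
  shows "line_length A b (x + r *\<^sub>R b) = line_length A b x"
proof -
  have "(\<integral>\<^sup>+s. indicator A (x + (s + r) *\<^sub>R b) \<partial>lborel) = (\<integral>\<^sup>+s. indicator A (x + s *\<^sub>R b) \<partial>lborel)"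
    by (rule nn_integral_lborel_translate) measurable
  then show ?thesis by (simp add: line_length_eq_nn_integral algebra_simps)
qed

text \<open>Each line in direction \<open>b\<close> meets the symmetrized set in an open interval of
  the original line length, centred on the hyperplane orthogonal to \<open>b\<close>; integrating
  over the slab gives equal volumes.\<close>

lemma emeasure_symmetrization:
  assumes [measurable]: "A \<in> sets borel" and b: "norm b = 1" and fin: "\<And>x. line_length A b x < top"
  shows "emeasure lborel (symmetrization b A) = emeasure lborel A"
proof -
  have bb: "b \<bullet> b = 1" using b by (simp add: norm_eq_1)
  have *: "emeasure lborel B = (\<integral>\<^sup>+x. indicator {0..1} (x \<bullet> b) * line_length B b x \<partial>lborel)"
    if [measurable]: "B \<in> sets borel" for B
    using nn_integral_lborel_slab[OF _ bb, of "indicator B"] by (simp add: line_length_eq_nn_integral)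
  have "line_length (symmetrization b A) b x = line_length A b x" for x
  proof -
    obtain l where l: "line_length A b x = ennreal l" "0 \<le> l"
      using fin[of x] by (cases "line_length A b x") auto
    have "x + s *\<^sub>R b \<in> symmetrization b A \<longleftrightarrow> 2 * \<bar>x \<bullet> b + s\<bar> < l" for s
      using l bb by (simp add: symmetrization_def line_length_translate inner_add_left ennreal_less_iff)
    then have "{s. x + s *\<^sub>R b \<in> symmetrization b A} = {- (x \<bullet> b) - l / 2 <..< - (x \<bullet> b) + l / 2}"
      by (simp add: set_eq_iff) (smt (verit) field_sum_of_halves)
    then show ?thesis using l by (simp add: line_length_def[of "symmetrization b A"])
  qed
  then show ?thesis by (subst (1 2) *) auto
qed

text \<open>On two parallel lines, distances depend only on the offset along \<open>b\<close>, here
  \<open>s - r + m\<close>, which is at most \<open>\<rho>\<close> in absolute value for points of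
  \<open>A\<close>. Adding the two extremal cases, the top of one line against the bottom of the
  other and conversely, cancels \<open>m\<close> and bounds the sum of the two extents by
  \<open>2 * \<rho>\<close>. Points of the symmetrized set lie within half the extent of their line
  from the central hyperplane, so their own offset \<open>m\<close> is at most \<open>\<rho>\<close>
  too.\<close>

lemma dist_symmetrization_le:
  assumes A: "\<And>x y. x \<in> A \<Longrightarrow> y \<in> A \<Longrightarrow> dist x y \<le> d" and b: "norm b = 1"
    and x: "x \<in> symmetrization b A" and y: "y \<in> symmetrization b A"
  shows "dist x y \<le> d"
proof -
  have bb: "b \<bullet> b = 1" using b by (simp add: norm_eq_1)
  define S where "S x = {s. x + s *\<^sub>R b \<in> A}" for x
  have ll: "line_length A b x = emeasure lborel (S x)" for x by (simp add: line_length_def S_def)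
  have ne: "S z \<noteq> {}" if "z \<in> symmetrization b A" for z
  proof
    assume "S z = {}"
    with that show False by (simp add: symmetrization_def ll)
  qed
  define m where "m = (x - y) \<bullet> b"
  have *: "(dist x y)\<^sup>2 - m\<^sup>2 + (s - r + m)\<^sup>2 \<le> d\<^sup>2" if "s \<in> S x" "r \<in> S y" for s r
  proof -
    have "dist (x + s *\<^sub>R b) (y + r *\<^sub>R b) \<le> d" using that A by (auto simp: S_def)
    then have "(dist (x + s *\<^sub>R b) (y + r *\<^sub>R b))\<^sup>2 \<le> d\<^sup>2" by (intro power_mono) auto
    also have "(dist (x + s *\<^sub>R b) (y + r *\<^sub>R b))\<^sup>2 = (norm ((x - y) + (s - r) *\<^sub>R b))\<^sup>2"
      by (simp add: dist_norm algebra_simps)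
    also have "\<dots> = (dist x y)\<^sup>2 - m\<^sup>2 + (s - r + m)\<^sup>2"
      unfolding power2_norm_eq_inner dist_norm m_def using bb
      by (simp add: algebra_simps inner_commute power2_eq_square)
    finally show ?thesis .
  qed
  obtain s0 r0 where sr: "s0 \<in> S x" "r0 \<in> S y" using ne[OF x] ne[OF y] by blast
  \<comment> \<open>The largest offset along \<open>b\<close> compatible with distance
    \<open>d\<close>, since the squared distance of the two lines is
    \<open>(dist x y)\<^sup>2 - m\<^sup>2\<close>.\<close>
  define \<rho> where "\<rho> = sqrt (d\<^sup>2 - (dist x y)\<^sup>2 + m\<^sup>2)"
  have nn: "0 \<le> d\<^sup>2 - (dist x y)\<^sup>2 + m\<^sup>2"
    using *[OF sr] by (smt (verit) zero_le_power2)
  have bd: "\<bar>s - r + m\<bar> \<le> \<rho>" if "s \<in> S x" "r \<in> S y" for s r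
    unfolding \<rho>_def using *[OF that] by (intro real_le_rsqrt) auto
  have "norm s \<le> \<rho> + \<bar>r0\<bar> + \<bar>m\<bar>" if "s \<in> S x" for s using bd[OF that sr(2)] by simp
  moreover have "norm r \<le> \<rho> + \<bar>s0\<bar> + \<bar>m\<bar>" if "r \<in> S y" for r using bd[OF sr(1) that] by simp
  ultimately have bs: "bounded (S x)" "bounded (S y)" unfolding bounded_iff by blast+
  have len: "2 * \<bar>z \<bullet> b\<bar> < Sup (S z) - Inf (S z)" if z: "z \<in> symmetrization b A" and bz: "bounded (S z)" for z
  proof -
    have bdd: "bdd_above (S z)" "bdd_below (S z)"
      using bz bounded_imp_bdd_above bounded_imp_bdd_below by auto
    have "S z \<subseteq> {Inf (S z) .. Sup (S z)}"
      using bdd by (auto intro: cInf_lower cSup_upper)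
    moreover have le: "Inf (S z) \<le> Sup (S z)" using ne[OF z] bdd by (meson cInf_le_cSup)
    ultimately have "emeasure lborel (S z) \<le> ennreal (Sup (S z) - Inf (S z))"
      using emeasure_mono[of "S z" "{Inf (S z) .. Sup (S z)}" lborel] by simp
    with z have "ennreal (2 * \<bar>z \<bullet> b\<bar>) < ennreal (Sup (S z) - Inf (S z))"
      by (simp add: symmetrization_def ll)
    then show ?thesis by (simp add: ennreal_less_iff)
  qed
  have "Sup (S x) \<le> \<rho> - m + Inf (S y)"
  proof (rule cSup_least[OF ne[OF x]])
    fix s assume s: "s \<in> S x"
    have "s + m - \<rho> \<le> Inf (S y)" by (rule cInf_greatest[OF ne[OF y]]) (use bd[OF s] in \<open>force\<close>)
    then show "s \<le> \<rho> - m + Inf (S y)" by simp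
  qed
  moreover have "Sup (S y) \<le> \<rho> + m + Inf (S x)"
  proof (rule cSup_least[OF ne[OF y]])
    fix r assume r: "r \<in> S y"
    have "r - m - \<rho> \<le> Inf (S x)" by (rule cInf_greatest[OF ne[OF x]]) (use bd[OF _ r] in \<open>force\<close>)
    then show "r \<le> \<rho> + m + Inf (S x)" by simp
  qed
  ultimately have "2 * \<bar>x \<bullet> b\<bar> + 2 * \<bar>y \<bullet> b\<bar> \<le> 2 * \<rho>"
    using len[OF x bs(1)] len[OF y bs(2)] by linarith
  then have "\<bar>m\<bar> \<le> \<rho>" by (simp add: m_def inner_diff_left)
  then have "m\<^sup>2 \<le> \<rho>\<^sup>2" using power_mono[of "\<bar>m\<bar>" \<rho> 2] by simp
  then have "(dist x y)\<^sup>2 \<le> d\<^sup>2" using nn by (simp add: \<rho>_def)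
  moreover have "0 \<le> d" using A[of "x + s0 *\<^sub>R b" "x + s0 *\<^sub>R b"] sr by (auto simp: S_def)
  ultimately show ?thesis by (rule power2_le_imp_le)
qed

definition reflection :: "'a::euclidean_space \<Rightarrow> 'a \<Rightarrow> 'a" where
  "reflection c x = x - (2 * (x \<bullet> c)) *\<^sub>R c"

lemma reflection_symmetrization:
  assumes "A \<in> sets borel" "norm b = 1" "x \<in> symmetrization b A"
  shows "reflection b x \<in> symmetrization b A"
proof -
  have "line_length A b (reflection b x) = line_length A b x"
    using line_length_translate[OF assms(1), of b x "- (2 * (x \<bullet> b))"] by (simp add: reflection_def)
  moreover have "\<bar>reflection b x \<bullet> b\<bar> = \<bar>x \<bullet> b\<bar>"
    using assms(2) by (simp add: reflection_def inner_diff_left norm_eq_1)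
  ultimately show ?thesis using assms(3) by (simp add: symmetrization_def)
qed

text \<open>The reflection in an orthogonal direction permutes the lines parallel to
  \<open>b\<close> and preserves their lengths in \<open>A\<close>. Hence a symmetry gained in an
  earlier direction survives the later symmetrizations.\<close>

lemma reflection_symmetrization_orthogonal:
  assumes bc: "b \<bullet> c = 0" and c: "norm c = 1" and A: "\<And>x. x \<in> A \<Longrightarrow> reflection c x \<in> A"
    and x: "x \<in> symmetrization b A"
  shows "reflection c x \<in> symmetrization b A"
proof -
  have invol: "reflection c (reflection c y) = y" for y
    using c by (simp add: reflection_def norm_eq_1 inner_diff_left algebra_simps)
  have "reflection c x + s *\<^sub>R b \<in> A \<longleftrightarrow> x + s *\<^sub>R b \<in> A" for s
  proof -
    have "reflection c (x + s *\<^sub>R b) = reflection c x + s *\<^sub>R b"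
      using bc by (simp add: reflection_def inner_add_left)
    then show ?thesis by (metis A invol)
  qed
  then have "line_length A b (reflection c x) = line_length A b x"
    by (simp add: line_length_def)
  moreover have "reflection c x \<bullet> b = x \<bullet> b"
    using bc by (simp add: reflection_def inner_diff_left inner_commute[of c b])
  ultimately show ?thesis using x by (simp add: symmetrization_def)
qed

lemma exists_symmetric_set:
  fixes A :: "'a::euclidean_space set"
  assumes A: "A \<in> sets borel" "\<And>x y. x \<in> A \<Longrightarrow> y \<in> A \<Longrightarrow> dist x y \<le> d"
    and B: "finite B" "B \<subseteq> Basis"
  shows "\<exists>A' :: 'a set. A' \<in> sets borel \<and> (\<forall>x\<in>A'. \<forall>y\<in>A'. dist x y \<le> d) \<and>
    emeasure lborel A' = emeasure lborel A \<and> (\<forall>b\<in>B. \<forall>x\<in>A'. reflection b x \<in> A')"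
  using B
proof (induction B rule: finite_induct)
  case empty then show ?case using A by (intro exI[of _ A]) auto
next
  case (insert b F)
  then obtain A' :: "'a set" where A': "A' \<in> sets borel" "\<And>x y. x\<in>A' \<Longrightarrow> y\<in>A' \<Longrightarrow> dist x y \<le> d"
    "emeasure lborel A' = emeasure lborel A" "\<And>b x. b \<in> F \<Longrightarrow> x\<in>A' \<Longrightarrow> reflection b x \<in> A'"
    by auto
  have b: "norm b = 1" using insert by auto
  have "line_length A' b x < top" for x
  proof -
    have "bounded {s. x + s *\<^sub>R b \<in> A'}"
      unfolding bounded_two_points
      by (rule exI[of _ d]) (use A'(2) b in \<open>fastforce simp: dist_norm simp flip: scaleR_diff_left\<close>)
    then show ?thesis unfolding line_length_def using emeasure_bounded_finite by (metis infinity_ennreal_def)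
  qed
  then have "emeasure lborel (symmetrization b A') = emeasure lborel A"
    using emeasure_symmetrization[OF A'(1) b] A'(3) by simp
  moreover have "reflection c x \<in> symmetrization b A'" if "c \<in> insert b F" "x \<in> symmetrization b A'" for c x
  proof (cases "c = b")
    case True then show ?thesis using reflection_symmetrization[OF A'(1) b that(2)] by simp
  next
    case False
    then have "b \<bullet> c = 0" "norm c = 1" "c \<in> F" using that insert by (auto simp: inner_Basis)
    then show ?thesis using reflection_symmetrization_orthogonal[of b c A' x] A'(4) that by blast
  qed
  ultimately show ?case
    using dist_symmetrization_le[OF A'(2) b] sets_symmetrization[OF A'(1)]
    by (intro exI[of _ "symmetrization b A'"]) blast
qed

text \<open>After symmetrization in all basis directions the set is invariant under the product of
  the coordinate reflections, which is \<open>- x\<close>. The distance of \<open>x\<close> and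
  \<open>- x\<close> then places the set in the ball of radius \<open>d / 2\<close>.\<close>

theorem isodiametric:
  fixes A :: "'a::euclidean_space set"
  assumes A: "A \<in> sets borel" "\<And>x y. x \<in> A \<Longrightarrow> y \<in> A \<Longrightarrow> dist x y \<le> d" "0 \<le> d"
  shows "emeasure lborel A \<le> ennreal (unit_ball_vol (real DIM('a)) * (d / 2) ^ DIM('a))"
proof -
  obtain A' :: "'a set" where A': "A' \<in> sets borel" "\<And>x y. x\<in>A' \<Longrightarrow> y\<in>A' \<Longrightarrow> dist x y \<le> d"
    "emeasure lborel A' = emeasure lborel A" "\<And>b x. b \<in> Basis \<Longrightarrow> x\<in>A' \<Longrightarrow> reflection b x \<in> A'"
    using exists_symmetric_set[OF A(1,2) finite_Basis order_refl] by blast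
  have "x - (\<Sum>b\<in>B. (2 * (x \<bullet> b)) *\<^sub>R b) \<in> A'" if "x \<in> A'" "finite B" "B \<subseteq> Basis" for B x
    using that(2,3)
  proof (induction B rule: finite_induct)
    case (insert b F)
    have "(\<Sum>c\<in>F. (2 * (x \<bullet> c)) *\<^sub>R c) \<bullet> b = (\<Sum>c\<in>F. 0)"
      unfolding inner_sum_left
    proof (rule sum.cong)
      fix c assume "c \<in> F"
      then have "c \<bullet> b = 0" using insert by (intro inner_not_same_Basis) auto
      then show "(2 * (x \<bullet> c)) *\<^sub>R c \<bullet> b = 0" by simp
    qed simp
    then have "reflection b (x - (\<Sum>c\<in>F. (2 * (x \<bullet> c)) *\<^sub>R c)) = x - (\<Sum>c\<in>insert b F. (2 * (x \<bullet> c)) *\<^sub>R c)"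
      using insert by (simp add: reflection_def inner_diff_left algebra_simps)
    then show ?case using A'(4)[of b] insert by (metis insert_subset)
  qed (use that in simp)
  from this[OF _ finite_Basis order_refl] have "x - (\<Sum>b\<in>Basis. (2 * (x \<bullet> b)) *\<^sub>R b) \<in> A'" if "x \<in> A'" for x
    using that .
  moreover have "(\<Sum>b\<in>Basis. (2 * (x \<bullet> b)) *\<^sub>R b) = 2 *\<^sub>R x" for x :: 'a
    using euclidean_representation[of "2 *\<^sub>R x"] by simp
  ultimately have neg: "- x \<in> A'" if "x \<in> A'" for x
    using that by (metis (no_types) add_diff_cancel_left' diff_minus_eq_add minus_diff_eq scaleR_2)
  have "A' \<subseteq> cball 0 (d / 2)"
  proof
    fix x assume x: "x \<in> A'"
    have "dist x (- x) \<le> d" using A'(2) neg x by blast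
    then show "x \<in> cball 0 (d / 2)" by (simp add: dist_norm flip: scaleR_2)
  qed
  then have "emeasure lborel A' \<le> emeasure lborel (cball (0::'a) (d / 2))"
    by (intro emeasure_mono) auto
  also have "\<dots> = ennreal (unit_ball_vol (real DIM('a)) * (d / 2) ^ DIM('a))"
    using A(3) by (intro emeasure_cball) auto
  finally show ?thesis using A'(3) by simp
qed

section \<open>Covering arguments\<close>

text \<open>Vitali's theorems produce countable families indexed by centres and radii, whereas the
  definition asks for sequences; the missing indices are filled with empty sets of weight
  \<open>0\<close>.\<close>

lemma hausdorff_pre_le_countable:
  assumes C: "countable C" "E \<subseteq> (\<Union>i\<in>C. B i)" "\<And>i. i \<in> C \<Longrightarrow> bounded (B i)" "\<And>i. i \<in> C \<Longrightarrow> diameter (B i) \<le> \<delta>"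
    and "0 < \<delta>"
  shows "hausdorff_pre k \<delta> E \<le> (\<integral>\<^sup>+i. hausdorff_weight k (B i) \<partial>count_space C)"
proof -
  let ?n = "to_nat_on C"
  define D where "D j = (if j \<in> ?n ` C then B (from_nat_into C j) else {})" for j
  have inj: "inj_on ?n C" using C(1) by (rule inj_on_to_nat_on)
  have D: "D (?n i) = B i" if "i \<in> C" for i using that C(1) by (simp add: D_def)
  have "hausdorff_pre k \<delta> E \<le> (\<Sum>j. hausdorff_weight k (D j))"
  proof (rule hausdorff_pre_le)
    show "E \<subseteq> (\<Union>j. D j)"
    proof
      fix x assume "x \<in> E"
      then obtain i where "i \<in> C" "x \<in> B i" using C(2) by blast
      then show "x \<in> (\<Union>j. D j)" using D by (intro UN_I[of "?n i"]) auto
    qed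
    show "bounded (D j)" for j using C(1,3) D by (auto simp: D_def)
    show "diameter (D j) \<le> \<delta>" for j using C(1,4) D \<open>0 < \<delta>\<close> by (auto simp: D_def)
  qed
  also have "\<dots> = (\<integral>\<^sup>+j. hausdorff_weight k (D j) \<partial>count_space UNIV)"
    by (simp add: nn_integral_count_space_nat)
  also have "\<dots> = (\<integral>\<^sup>+j. hausdorff_weight k (D j) \<partial>count_space (?n ` C))"
    by (rule nn_integral_count_space_eq) (auto simp: D_def)
  also have "\<dots> = (\<integral>\<^sup>+i. hausdorff_weight k (D (?n i)) \<partial>count_space C)"
    by (rule nn_integral_bij_count_space[OF inj_on_imp_bij_betw[OF inj], symmetric])
  also have "\<dots> = (\<integral>\<^sup>+i. hausdorff_weight k (B i) \<partial>count_space C)"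
    by (intro nn_integral_cong) (simp add: D)
  finally show ?thesis .
qed

lemma hausdorff_weight_ball:
  fixes x :: "'a::euclidean_space"
  assumes "0 < r"
  shows "hausdorff_weight DIM('a) (ball x r) = emeasure lborel (ball x r)"
  using assms emeasure_ball[of r x] by (simp add: hausdorff_weight_def)

lemma hausdorff_weight_ball_scale:
  fixes x :: "'a::euclidean_space"
  assumes "0 < r" "0 < c"
  shows "hausdorff_weight DIM('a) (ball x (c * r)) = ennreal (c ^ DIM('a)) * emeasure lborel (ball x r)"
proof -
  have "0 < c * r" using assms by simp
  then have "\<not> c * r \<le> 0" "\<not> c * r < 0" by linarith+
  then show ?thesis
    using assms emeasure_ball[of r x]
    by (simp add: hausdorff_weight_def power_mult_distrib ennreal_mult'[symmetric] mult_ac)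
qed

lemma emeasure_lebesgue_open_superset:
  fixes S :: "'a::euclidean_space set"
  assumes "S \<in> sets lebesgue" "emeasure lebesgue S < x"
  obtains U where "open U" "S \<subseteq> U" "emeasure lborel U < x"
proof -
  obtain e :: real where e: "0 < e" "emeasure lebesgue S + ennreal e < x"
  proof (cases "x = top")
    case True
    then show ?thesis using assms(2) that[of 1] by (simp add: less_top)
  next
    case False
    then obtain a b where ab: "emeasure lebesgue S = ennreal a" "x = ennreal b" "0 \<le> a" "0 \<le> b"
      using assms(2) by (cases "emeasure lebesgue S"; cases x) auto
    then have "a < b" using assms(2) by (simp add: ennreal_less_iff)
    then have "emeasure lebesgue S + ennreal ((b - a) / 2) < x"
      using ab by (simp add: ennreal_less_iff flip: ennreal_plus) (simp add: field_simps)
    with \<open>a < b\<close> show ?thesis using that[of "(b-a)/2"] by simp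
  qed
  obtain U where U: "open U" "S \<subseteq> U" "(U - S) \<in> lmeasurable" "emeasure lebesgue (U - S) < ennreal e"
    using sets_lebesgue_outer_open[OF assms(1) e(1)] by blast
  have "emeasure lborel U = emeasure lebesgue U" using U(1) by simp
  also have "\<dots> \<le> emeasure lebesgue S + emeasure lebesgue (U - S)"
    using U assms(1) emeasure_subadditive[of S lebesgue "U - S"] by (simp add: Un_absorb1 fmeasurableD)
  also have "\<dots> \<le> emeasure lebesgue S + ennreal e" using U(4) by (intro add_left_mono) simp
  finally show ?thesis using U e(2) that by (meson order_le_less_trans)
qed

text \<open>The Vitali covering theorem leaves a negligible remainder, which is precisely what is to
  be estimated here. The covering lemma with fivefold enlarged balls covers all of \<open>N\<close>;
  its loss \<open>5 ^ DIM('a)\<close> is compensated by the choice of \<open>U\<close>.\<close>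

lemma hausdorff_pre_negligible:
  fixes N :: "'a::euclidean_space set"
  assumes N: "negligible N" and \<delta>: "0 < \<delta>"
  shows "hausdorff_pre DIM('a) \<delta> N = 0"
proof -
  have "hausdorff_pre DIM('a) \<delta> N \<le> ennreal e" if e: "0 < e" for e :: real
  proof -
    let ?c = "ennreal (5 ^ DIM('a))"
    have "N \<in> sets lebesgue" "emeasure lebesgue N = 0"
      using N by (auto simp: negligible_iff_null_sets)
    then obtain U where U: "open U" "N \<subseteq> U" "emeasure lborel U < ennreal (e / 5 ^ DIM('a))"
      using emeasure_lebesgue_open_superset[of N "ennreal (e / 5 ^ DIM('a))"] e by auto
    \<comment> \<open>With radii at most \<open>\<delta> / 10\<close> the enlarged balls have
      diameter at most \<open>\<delta>\<close>.\<close>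
    define K where "K = {(x, r). 0 < r \<and> r \<le> \<delta> / 10 \<and> ball x r \<subseteq> U}"
    have cov: "N \<subseteq> (\<Union>i\<in>K. ball (fst i) (snd i))"
    proof
      fix x assume "x \<in> N"
      then obtain r where r: "0 < r" "ball x r \<subseteq> U" using U openE by blast
      then have "(x, min r (\<delta> / 10)) \<in> K" using \<delta> by (auto simp: K_def)
      then show "x \<in> (\<Union>i\<in>K. ball (fst i) (snd i))" using r \<delta> by (intro UN_I) auto
    qed
    have K0: "0 < snd i \<and> snd i \<le> \<delta> / 10" if "i \<in> K" for i using that by (auto simp: K_def)
    obtain C where C: "countable C" "C \<subseteq> K"
       "pairwise (\<lambda>i j. disjnt (ball (fst i) (snd i)) (ball (fst j) (snd j))) C"
       "N \<subseteq> (\<Union>i\<in>C. ball (fst i) (5 * snd i))"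
      by (rule Vitali_covering_lemma_balls[of N fst snd K "\<delta> / 10", OF cov K0])
    have "i \<in> K" if "i \<in> C" for i using C(2) that by blast
    then have pos: "0 < snd i" "snd i \<le> \<delta> / 10" "ball (fst i) (snd i) \<subseteq> U" if "i \<in> C" for i
      using that by (fastforce simp: K_def)+
    have le: "(\<integral>\<^sup>+i. emeasure lborel (ball (fst i) (snd i)) \<partial>count_space C) \<le> ennreal (e / 5 ^ DIM('a))"
    proof -
      have "(\<integral>\<^sup>+i. emeasure lborel (ball (fst i) (snd i)) \<partial>count_space C) = emeasure lborel (\<Union>i\<in>C. ball (fst i) (snd i))"
        using C(1,3) by (intro emeasure_UN_countable[symmetric])
          (auto simp: disjoint_family_on_def pairwise_def disjnt_def)
      also have "\<dots> \<le> emeasure lborel U" using pos(3) U(1) by (intro emeasure_mono UN_least) auto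
      finally show ?thesis using U(3) by simp
    qed
    have "hausdorff_pre DIM('a) \<delta> N \<le> (\<integral>\<^sup>+i. hausdorff_weight DIM('a) (ball (fst i) (5 * snd i)) \<partial>count_space C)"
      by (rule hausdorff_pre_le_countable[OF C(1,4) _ _ \<delta>]) (use pos(1,2) \<delta> in \<open>simp_all add: mult.commute\<close>)
    also have "\<dots> = (\<integral>\<^sup>+i. ?c * emeasure lborel (ball (fst i) (snd i)) \<partial>count_space C)"
      by (intro nn_integral_cong hausdorff_weight_ball_scale) (use pos in auto)
    also have "\<dots> = ?c * (\<integral>\<^sup>+i. emeasure lborel (ball (fst i) (snd i)) \<partial>count_space C)"
      by (rule nn_integral_cmult) auto
    also have "\<dots> \<le> ?c * ennreal (e / 5 ^ DIM('a))" using le by (intro mult_left_mono) auto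
    also have "\<dots> = ennreal e" using e by (simp flip: ennreal_mult')
    finally show ?thesis .
  qed
  then show ?thesis using ennreal_le_epsilon[of 0 "hausdorff_pre DIM('a) \<delta> N"] by simp
qed

lemma hausdorff_measure_negligible:
  fixes N :: "'a::euclidean_space set"
  assumes "negligible N"
  shows "hausdorff_measure DIM('a) N = 0"
  using hausdorff_measure_least[of "DIM('a)" N 0] hausdorff_pre_negligible[OF assms] by simp

text \<open>The weight of a ball is its volume, so filling an open superset with small disjoint
  balls up to a null set gives a cover whose total weight is at most the volume of the
  superset.\<close>

lemma hausdorff_measure_le_lborel:
  fixes A :: "'a::euclidean_space set"
  assumes A: "A \<in> sets borel"
  shows "hausdorff_measure DIM('a) A \<le> emeasure lborel A"
proof (rule hausdorff_measure_least)
  fix \<delta> :: real assume \<delta>: "0 < \<delta>"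
  show "hausdorff_pre DIM('a) \<delta> A \<le> emeasure lborel A"
  proof (rule dense_ge)
    fix z assume "emeasure lborel A < z"
    then obtain U where U: "open U" "A \<subseteq> U" "emeasure lborel U < z"
      using emeasure_lebesgue_open_superset[of A z] A by auto
    define K where "K = {(x, r). 0 < r \<and> r \<le> \<delta> / 2 \<and> ball x r \<subseteq> U}"
    have vit: "\<exists>i. i \<in> K \<and> x \<in> ball (fst i) (snd i) \<and> snd i < d" if x: "x \<in> A" and d: "0 < d" for x d
    proof -
      obtain r where r: "0 < r" "ball x r \<subseteq> U" using U openE x by blast
      then have "(x, min (d / 2) (min r (\<delta> / 2))) \<in> K" using \<delta> d by (auto simp: K_def)
      then show ?thesis using r \<delta> d by (intro exI[of _ "(x, min (d / 2) (min r (\<delta> / 2)))"]) auto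
    qed
    obtain C where C: "countable C" "C \<subseteq> K"
       "pairwise (\<lambda>i j. disjnt (ball (fst i) (snd i)) (ball (fst j) (snd j))) C"
       "negligible (A - (\<Union>i\<in>C. ball (fst i) (snd i)))"
      by (rule Vitali_covering_theorem_balls[of A K fst snd, OF vit])
    have "i \<in> K" if "i \<in> C" for i using C(2) that by blast
    then have pos: "0 < snd i" "snd i \<le> \<delta> / 2" "ball (fst i) (snd i) \<subseteq> U" if "i \<in> C" for i
      using that by (fastforce simp: K_def)+
    let ?U = "\<Union>i\<in>C. ball (fst i) (snd i)"
    have "hausdorff_pre DIM('a) \<delta> A \<le> hausdorff_pre DIM('a) \<delta> ((A - ?U) \<union> ?U)"
      by (intro hausdorff_pre_mono) auto
    also have "\<dots> \<le> hausdorff_pre DIM('a) \<delta> (A - ?U) + hausdorff_pre DIM('a) \<delta> ?U"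
      by (rule hausdorff_pre_Un_le[OF \<delta>])
    also have "\<dots> = hausdorff_pre DIM('a) \<delta> ?U"
      using hausdorff_pre_negligible[OF C(4) \<delta>] by simp
    also have "\<dots> \<le> (\<integral>\<^sup>+i. hausdorff_weight DIM('a) (ball (fst i) (snd i)) \<partial>count_space C)"
      by (rule hausdorff_pre_le_countable[OF C(1) order_refl _ _ \<delta>]) (use pos(1,2) \<delta> in \<open>simp_all add: mult.commute\<close>)
    also have "\<dots> = (\<integral>\<^sup>+i. emeasure lborel (ball (fst i) (snd i)) \<partial>count_space C)"
      by (intro nn_integral_cong hausdorff_weight_ball) (use pos in auto)
    also have "\<dots> = emeasure lborel ?U"
      using C(1,3) by (intro emeasure_UN_countable[symmetric])
        (auto simp: disjoint_family_on_def pairwise_def disjnt_def)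
    also have "\<dots> \<le> emeasure lborel U" using pos(3) U(1) by (intro emeasure_mono UN_least) auto
    finally show "hausdorff_pre DIM('a) \<delta> A \<le> z" using U(3) by simp
  qed
qed

text \<open>By the isodiametric inequality no covering set has volume above its weight. Closures
  make the covering sets Borel and keep their diameters; the single scale \<open>1\<close> suffices
  because the bound holds for covers of every size. For non-Borel sets the left side is
  \<open>0\<close> by convention.\<close>

lemma lborel_le_hausdorff_measure:
  fixes A :: "'a::euclidean_space set"
  shows "emeasure lborel A \<le> hausdorff_measure DIM('a) A"
proof (cases "A \<in> sets borel")
  case True
  have "emeasure lborel A \<le> hausdorff_pre DIM('a) 1 A"
  proof (rule hausdorff_pre_greatest)
    fix C :: "nat \<Rightarrow> 'a set"
    assume C: "A \<subseteq> (\<Union>j. C j)" "\<And>j. bounded (C j)"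
    have "emeasure lborel A \<le> emeasure lborel (\<Union>j. closure (C j))"
      using C(1) closure_subset by (intro emeasure_mono) (blast, simp)
    also have "\<dots> \<le> (\<Sum>j. emeasure lborel (closure (C j)))"
      by (intro emeasure_subadditive_countably) auto
    also have "\<dots> \<le> (\<Sum>j. hausdorff_weight DIM('a) (C j))"
    proof (intro suminf_le)
      fix j
      show "emeasure lborel (closure (C j)) \<le> hausdorff_weight DIM('a) (C j)"
      proof (cases "C j = {}")
        case False
        have "dist x y \<le> diameter (C j)" if "x \<in> closure (C j)" "y \<in> closure (C j)" for x y
          using diameter_bounded_bound[OF bounded_closure[OF C(2)] that] diameter_closure[OF C(2)] by simp
        then have "emeasure lborel (closure (C j)) \<le>
            ennreal (unit_ball_vol (real DIM('a)) * (diameter (C j) / 2) ^ DIM('a))"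
          by (intro isodiametric) (auto simp: diameter_ge_0 C(2))
        then show ?thesis using False by (simp add: hausdorff_weight_def)
      qed simp
    qed auto
    finally show "emeasure lborel A \<le> (\<Sum>j. hausdorff_weight DIM('a) (C j))" .
  qed
  also have "\<dots> \<le> hausdorff_measure DIM('a) A" by (rule hausdorff_pre_le_measure) simp
  finally show ?thesis .
qed (simp add: emeasure_notin_sets)

section \<open>Vitali estimates that lead to null sets\<close>

text \<open>Disjoint balls exhaust \<open>S\<close> up to a null set, and \<open>le\<close>
  transfers their relevant parts \<open>A i\<close> to disjoint sets \<open>B i\<close> inside
  \<open>U\<close>. The families stay separate because \<open>B i\<close> may live in another space
  (images and preimages of intervals) and because \<open>A i\<close> may be a ball with a hole
  (porosity). As \<open>S\<close> is arbitrary, the bound is stated for a measurable superset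
  \<open>V\<close>.\<close>

lemma Vitali_upper_bound:
  fixes a :: "'i \<Rightarrow> 'a::euclidean_space" and B :: "'i \<Rightarrow> 'b::euclidean_space set"
  assumes r: "\<And>i. i \<in> K \<Longrightarrow> 0 < r i"
    and S: "\<And>x d. x \<in> S \<Longrightarrow> 0 < d \<Longrightarrow> \<exists>i. i \<in> K \<and> x \<in> cball (a i) (r i) \<and> r i < d"
    and A: "\<And>i. i \<in> K \<Longrightarrow> A i \<in> sets borel" "\<And>i. i \<in> K \<Longrightarrow> A i \<subseteq> cball (a i) (r i)"
      "\<And>i. i \<in> K \<Longrightarrow> S \<inter> cball (a i) (r i) \<subseteq> A i"
    and B: "\<And>i. i \<in> K \<Longrightarrow> B i \<in> sets borel" "\<And>i. i \<in> K \<Longrightarrow> B i \<subseteq> U" "U \<in> sets borel"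
      "\<And>i j. i \<in> K \<Longrightarrow> j \<in> K \<Longrightarrow> disjnt (cball (a i) (r i)) (cball (a j) (r j)) \<Longrightarrow> B i \<inter> B j = {}"
    and le: "\<And>i. i \<in> K \<Longrightarrow> emeasure lborel (A i) \<le> c * emeasure lborel (B i)"
  shows "\<exists>V\<in>sets lebesgue. S \<subseteq> V \<and> emeasure lebesgue V \<le> c * emeasure lborel U"
proof -
  obtain C where C: "countable C" "C \<subseteq> K"
     "pairwise (\<lambda>i j. disjnt (cball (a i) (r i)) (cball (a j) (r j))) C"
     "negligible (S - (\<Union>i\<in>C. cball (a i) (r i)))"
    by (rule Vitali_covering_theorem_cballs[of K r S a, OF r S])
  have CK: "i \<in> K" if "i \<in> C" for i using C(2) that by blast
  have disj: "disjnt (cball (a i) (r i)) (cball (a j) (r j))" if "i \<in> C" "j \<in> C" "i \<noteq> j" for i j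
    using C(3) that by (auto simp: pairwise_def)
  let ?N = "S - (\<Union>i\<in>C. cball (a i) (r i))" and ?W = "\<Union>i\<in>C. A i"
  have W: "?W \<in> sets borel" using C(1) A(1) CK by auto
  have "emeasure lebesgue (?N \<union> ?W) = emeasure lebesgue ?W"
    using C(4) W by (subst Un_commute, intro emeasure_Un_null_set) (auto simp: negligible_iff_null_sets)
  also have "\<dots> = emeasure lborel ?W" using W by simp
  also have "\<dots> = (\<integral>\<^sup>+i. emeasure lborel (A i) \<partial>count_space C)"
  proof (rule emeasure_UN_countable)
    show "disjoint_family_on A C"
      unfolding disjoint_family_on_def
    proof (intro ballI impI)
      fix i j assume ij: "i \<in> C" "j \<in> C" "i \<noteq> j"
      then show "A i \<inter> A j = {}"
        using disj[OF ij] A(2)[OF CK[OF ij(1)]] A(2)[OF CK[OF ij(2)]] by (auto simp: disjnt_def)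
    qed
  qed (use C(1) A(1) CK in auto)
  also have "\<dots> \<le> (\<integral>\<^sup>+i. c * emeasure lborel (B i) \<partial>count_space C)"
    using le CK by (intro nn_integral_mono) auto
  also have "\<dots> = c * (\<integral>\<^sup>+i. emeasure lborel (B i) \<partial>count_space C)"
    by (rule nn_integral_cmult) auto
  also have "\<dots> \<le> c * emeasure lborel U"
  proof (rule mult_left_mono)
    have "(\<integral>\<^sup>+i. emeasure lborel (B i) \<partial>count_space C) = emeasure lborel (\<Union>i\<in>C. B i)"
      using C(1) B(1,4) CK disj by (intro emeasure_UN_countable[symmetric]) (auto simp: disjoint_family_on_def)
    also have "\<dots> \<le> emeasure lborel U" using B(2,3) CK by (intro emeasure_mono UN_least) auto
    finally show "(\<integral>\<^sup>+i. emeasure lborel (B i) \<partial>count_space C) \<le> emeasure lborel U" .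
  qed simp
  finally have "emeasure lebesgue (?N \<union> ?W) \<le> c * emeasure lborel U" .
  moreover have "?N \<union> ?W \<in> sets lebesgue" using C(4) W by (auto simp: negligible_iff_null_sets)
  moreover have "S \<subseteq> ?N \<union> ?W" using A(3) CK by blast
  ultimately show ?thesis by blast
qed

text \<open>Each application of \<open>step\<close> followed by outer regularity turns one open
  neighbourhood of \<open>E\<close> into another of volume smaller by a fixed factor, so the volumes
  of neighbourhoods decrease geometrically to \<open>0\<close>.\<close>

lemma negligible_contraction:
  fixes E :: "'a::euclidean_space set"
  assumes \<theta>: "0 \<le> \<theta>" "\<theta> < 1" and "bounded E"
    and step: "\<And>U. open U \<Longrightarrow> E \<subseteq> U \<Longrightarrow> emeasure lborel U < top \<Longrightarrow>
      \<exists>V\<in>sets lebesgue. E \<subseteq> V \<and> emeasure lebesgue V \<le> ennreal \<theta> * emeasure lborel U"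
  shows "negligible E"
proof -
  \<comment> \<open>The gap between \<open>\<theta>\<close> and \<open>\<theta>'\<close> pays for
    enlarging \<open>V\<close> to an open set, so that \<open>step\<close> can be applied
    again.\<close>
  define \<theta>' where "\<theta>' = (\<theta> + 1) / 2"
  have \<theta>': "\<theta> < \<theta>'" "\<theta>' < 1" "0 < \<theta>'" using \<theta> by (auto simp: \<theta>'_def)
  obtain r where r: "E \<subseteq> ball 0 r" "0 < r" using \<open>bounded E\<close> bounded_subset_ballD by blast
  define m where "m = emeasure lborel (ball (0::'a) r)"
  have m: "m < top" unfolding m_def using emeasure_lborel_ball_finite by simp
  have it: "\<exists>U. open U \<and> E \<subseteq> U \<and> emeasure lborel U \<le> ennreal (\<theta>' ^ n) * m" for n
  proof (induction n)
    case 0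
    show ?case using r by (intro exI[of _ "ball 0 r"]) (auto simp: m_def)
  next
    case (Suc n)
    then obtain U where U: "open U" "E \<subseteq> U" "emeasure lborel U \<le> ennreal (\<theta>' ^ n) * m" by blast
    have "ennreal (\<theta>' ^ n) * m < top" using m by (simp add: ennreal_mult_less_top)
    then have Ut: "emeasure lborel U < top" using U(3) by (rule order_le_less_trans[rotated])
    show ?case
    proof (cases "emeasure lborel U = 0")
      \<comment> \<open>The strict inequality of the other case fails for volume \<open>0\<close>,
        but then \<open>U\<close> itself serves again.\<close>
      case True then show ?thesis using U by (intro exI[of _ U]) simp
    next
      case False
      obtain V where V: "V \<in> sets lebesgue" "E \<subseteq> V" "emeasure lebesgue V \<le> ennreal \<theta> * emeasure lborel U"
        using step[OF U(1,2) Ut] by blast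
      have "ennreal \<theta> * emeasure lborel U < ennreal \<theta>' * emeasure lborel U"
        using False Ut \<theta>' \<theta> by (intro ennreal_mult_strict_right_mono) (auto simp: ennreal_less_iff zero_less_iff_neq_zero)
      with V(3) have "emeasure lebesgue V < ennreal \<theta>' * emeasure lborel U" by (rule order_le_less_trans)
      then obtain U' where U': "open U'" "V \<subseteq> U'" "emeasure lborel U' < ennreal \<theta>' * emeasure lborel U"
        by (rule emeasure_lebesgue_open_superset[OF V(1)])
      have "emeasure lborel U' \<le> ennreal \<theta>' * (ennreal (\<theta>' ^ n) * m)"
        using U'(3) mult_left_mono[OF U(3), of "ennreal \<theta>'"] by simp
      also have "\<dots> = ennreal (\<theta>' ^ Suc n) * m" using \<theta>' by (simp add: ennreal_mult mult.assoc)
      finally show ?thesis using U' V(2) by blast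
    qed
  qed
  obtain m' where m': "m = ennreal m'" "0 \<le> m'" using m by (cases m) auto
  show ?thesis
    unfolding negligible_outer_le
  proof (intro allI impI)
    fix e :: real assume e: "0 < e"
    have "(\<lambda>n. \<theta>' ^ n * m') \<longlonglongrightarrow> 0 * m'" using \<theta>' by (intro tendsto_intros LIMSEQ_power_zero) auto
    then have "\<forall>\<^sub>F n in sequentially. \<theta>' ^ n * m' < e" using e by (intro order_tendstoD) auto
    then obtain n where n: "\<theta>' ^ n * m' < e" by (auto dest: eventually_happens)
    obtain U where U: "open U" "E \<subseteq> U" "emeasure lborel U \<le> ennreal (\<theta>' ^ n) * m" using it by blast
    have *: "emeasure lborel U \<le> ennreal (\<theta>' ^ n * m')" using U(3) m' \<theta>' by (simp add: ennreal_mult)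
    have "U \<in> lmeasurable" using U(1) * by (intro fmeasurableI) (auto simp: order_le_less_trans)
    moreover have "measure lebesgue U \<le> e"
      unfolding measure_def using n e U(1) order_trans[OF * ennreal_leI[of _ e]] by (intro enn2real_leI) auto
    ultimately show "\<exists>T. E \<subseteq> T \<and> T \<in> lmeasurable \<and> measure lebesgue T \<le> e" using U by blast
  qed
qed

lemma negligible_countable_UN:
  assumes "countable I" "\<And>i. i \<in> I \<Longrightarrow> negligible (f i)"
  shows "negligible (\<Union>i\<in>I. f i)"
  using assms by (intro negligible_countable_Union) auto

section \<open>Differentiability of Lipschitz functions\<close>

text \<open>The image intervals \<open>{g u..g v}\<close> with slope at most \<open>p\<close> form a
  Vitali family for the image of \<open>E\<close>: they become arbitrarily short because
  \<open>g\<close> is Lipschitz. Disjoint image intervals come from disjoint intervals in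
  \<open>U\<close>, and each shrinks length by the factor \<open>p\<close>.\<close>

lemma increasing_image_le:
  fixes g :: "real \<Rightarrow> real"
  assumes mono: "\<And>x y. x < y \<Longrightarrow> g x < g y" and lip: "\<And>x y. x < y \<Longrightarrow> g y - g x \<le> L * (y - x)" and L: "0 < L"
    and p: "0 \<le> p" and U: "open U" "E \<subseteq> U"
    and slopes: "\<And>x d. x \<in> E \<Longrightarrow> 0 < d \<Longrightarrow> \<exists>u v. u < v \<and> x \<in> {u..v} \<and> v - u < d \<and> g v - g u \<le> p * (v - u)"
  shows "\<exists>V\<in>sets lebesgue. g ` E \<subseteq> V \<and> emeasure lebesgue V \<le> ennreal p * emeasure lborel U"
proof -
  define K where "K = {i. fst i < snd i \<and> {fst i..snd i} \<subseteq> U \<and> g (snd i) - g (fst i) \<le> p * (snd i - fst i)}"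
  define a where "a i = (g (fst i) + g (snd i)) / 2" for i
  define r where "r i = (g (snd i) - g (fst i)) / 2" for i
  have cb: "cball (a i) (r i) = {g (fst i)..g (snd i)}" for i
    unfolding cball_eq_atLeastAtMost a_def r_def by (auto simp: field_simps)
  have le: "g x \<le> g y" if "x \<le> y" for x y using mono that by (metis less_eq_real_def)
  show ?thesis
  proof (rule Vitali_upper_bound[of K r "g ` E" a "\<lambda>i. {g (fst i)..g (snd i)}" "\<lambda>i. {fst i..snd i}"])
    show "0 < r i" if "i \<in> K" for i using that mono by (auto simp: K_def r_def)
    show "\<exists>i. i \<in> K \<and> y \<in> cball (a i) (r i) \<and> r i < d" if y: "y \<in> g ` E" and d: "0 < d" for y d
    proof -
      obtain x where x: "x \<in> E" "y = g x" using y by blast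
      obtain e where e: "0 < e" "ball x e \<subseteq> U" using U x openE by blast
      obtain u v where uv: "u < v" "x \<in> {u..v}" "v - u < min e (d / L)" "g v - g u \<le> p * (v - u)"
        using slopes[OF x(1), of "min e (d / L)"] e d L by auto
      have "{u..v} \<subseteq> ball x e" using uv by (auto simp: dist_real_def)
      then have "(u, v) \<in> K" using uv e by (auto simp: K_def)
      moreover have "r (u, v) < d"
      proof -
        have "g v - g u \<le> L * (v - u)" using lip uv by blast
        also have "\<dots> < L * (d / L)" using uv L by (intro mult_strict_left_mono) auto
        finally show ?thesis using d L by (simp add: r_def)
      qed
      ultimately show ?thesis using x uv(2) le unfolding cb by (intro exI[of _ "(u, v)"]) auto
    qed
    show "{fst i..snd i} \<inter> {fst j..snd j} = {}" if "disjnt (cball (a i) (r i)) (cball (a j) (r j))" for i j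
      using that le unfolding cb by (auto simp: disjnt_def)
    show "emeasure lborel {g (fst i)..g (snd i)} \<le> ennreal p * emeasure lborel {fst i..snd i}" if "i \<in> K" for i
      using that le p by (auto simp: K_def simp flip: ennreal_mult' intro!: ennreal_leI)
  qed (use U in \<open>auto simp: cb K_def\<close>)
qed

text \<open>The roles of domain and range are exchanged: the Vitali family consists of the intervals
  \<open>{u..v}\<close> themselves, the Lipschitz bound keeps their images inside \<open>U\<close>,
  and strict monotonicity makes images of disjoint intervals disjoint.\<close>

lemma increasing_preimage_le:
  fixes g :: "real \<Rightarrow> real"
  assumes mono: "\<And>x y. x < y \<Longrightarrow> g x < g y" and lip: "\<And>x y. x < y \<Longrightarrow> g y - g x \<le> L * (y - x)" and L: "0 < L"
    and q: "0 < q" and U: "open U" "g ` E \<subseteq> U"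
    and slopes: "\<And>x d. x \<in> E \<Longrightarrow> 0 < d \<Longrightarrow> \<exists>u v. u < v \<and> x \<in> {u..v} \<and> v - u < d \<and> g v - g u \<ge> q * (v - u)"
  shows "\<exists>V\<in>sets lebesgue. E \<subseteq> V \<and> emeasure lebesgue V \<le> ennreal (1 / q) * emeasure lborel U"
proof -
  define K where "K = {i. fst i < snd i \<and> {g (fst i)..g (snd i)} \<subseteq> U \<and> g (snd i) - g (fst i) \<ge> q * (snd i - fst i)}"
  define a where "a i = (fst i + snd i :: real) / 2" for i
  define r where "r i = (snd i - fst i :: real) / 2" for i
  have cb: "cball (a i) (r i) = {fst i..snd i}" for i
    unfolding cball_eq_atLeastAtMost a_def r_def by (auto simp: field_simps)
  have le: "g x \<le> g y" if "x \<le> y" for x y using mono that by (metis less_eq_real_def)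
  show ?thesis
  proof (rule Vitali_upper_bound[of K r E a "\<lambda>i. {fst i..snd i}" "\<lambda>i. {g (fst i)..g (snd i)}"])
    show "0 < r i" if "i \<in> K" for i using that by (auto simp: K_def r_def)
    show "\<exists>i. i \<in> K \<and> x \<in> cball (a i) (r i) \<and> r i < d" if x: "x \<in> E" and d: "0 < d" for x d
    proof -
      obtain e where e: "0 < e" "ball (g x) e \<subseteq> U" using U x openE by blast
      obtain u v where uv: "u < v" "x \<in> {u..v}" "v - u < min d (e / L)" "g v - g u \<ge> q * (v - u)"
        using slopes[OF x, of "min d (e / L)"] e d L by auto
      have "g v - g u \<le> L * (v - u)" using lip uv by blast
      also have "\<dots> < L * (e / L)" using uv L by (intro mult_strict_left_mono) auto
      finally have "g v - g u < e" using L by simp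
      moreover have "g u \<le> g x" "g x \<le> g v" using uv(2) le by auto
      ultimately have "{g u..g v} \<subseteq> ball (g x) e" by (auto simp: dist_real_def)
      then have "(u, v) \<in> K" using uv e by (auto simp: K_def)
      then show ?thesis using uv unfolding cb by (intro exI[of _ "(u, v)"]) (auto simp: r_def)
    qed
    show "{g (fst i)..g (snd i)} \<inter> {g (fst j)..g (snd j)} = {}"
      if ij: "i \<in> K" "j \<in> K" "disjnt (cball (a i) (r i)) (cball (a j) (r j))" for i j
    proof -
      have "snd i < fst j \<or> snd j < fst i"
        using ij unfolding cb by (auto simp: K_def disjnt_def max_def min_def split: if_splits)
      then show ?thesis using mono by (smt (verit) IntE atLeastAtMost_iff ex_in_conv)
    qed
    show "emeasure lborel {fst i..snd i} \<le> ennreal (1 / q) * emeasure lborel {g (fst i)..g (snd i)}" if i: "i \<in> K" for i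
    proof -
      have "snd i - fst i \<le> 1 / q * (g (snd i) - g (fst i))" using i q by (simp add: K_def field_simps)
      then show ?thesis
        using i le[of "fst i" "snd i"] q by (simp add: K_def ennreal_leI flip: ennreal_mult')
    qed
  qed (use U in \<open>auto simp: cb K_def\<close>)
qed

text \<open>Slopes at most \<open>p\<close> shrink a neighbourhood \<open>U\<close> of
  \<open>E\<close> to a set around the image of volume at most \<open>p\<close> times that of
  \<open>U\<close>; slopes at least \<open>q\<close> bring this back to \<open>E\<close> with factor
  \<open>1 / q\<close>. Since \<open>p < q\<close>, the composite is a contraction.\<close>

lemma negligible_two_slopes:
  fixes g :: "real \<Rightarrow> real"
  assumes mono: "\<And>x y. x < y \<Longrightarrow> g x < g y" and lip: "\<And>x y. x < y \<Longrightarrow> g y - g x \<le> L * (y - x)" and L: "0 < L"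
    and pq: "0 \<le> p" "p < q" and "bounded E"
    and slopes: "\<And>x d. x \<in> E \<Longrightarrow> 0 < d \<Longrightarrow> \<exists>u v. u < v \<and> x \<in> {u..v} \<and> v - u < d \<and> g v - g u \<le> p * (v - u)"
      "\<And>x d. x \<in> E \<Longrightarrow> 0 < d \<Longrightarrow> \<exists>u v. u < v \<and> x \<in> {u..v} \<and> v - u < d \<and> g v - g u \<ge> q * (v - u)"
  shows "negligible E"
proof (rule negligible_contraction[where \<theta> = "(p + q) / 2 / q"])
  show "0 \<le> (p + q) / 2 / q" "(p + q) / 2 / q < 1" using pq by auto
  show "bounded E" by fact
  fix U assume U: "open U" "E \<subseteq> U" "emeasure lborel U < top"
  \<comment> \<open>The mean replaces \<open>p\<close> so that the superset of the image can be made
    open between the two estimates.\<close>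
  let ?p = "(p + q) / 2"
  show "\<exists>V\<in>sets lebesgue. E \<subseteq> V \<and> emeasure lebesgue V \<le> ennreal (?p / q) * emeasure lborel U"
  proof (cases "emeasure lborel U = 0")
    case True then show ?thesis using U by (intro bexI[of _ U]) auto
  next
    case False
    obtain V where V: "V \<in> sets lebesgue" "g ` E \<subseteq> V" "emeasure lebesgue V \<le> ennreal p * emeasure lborel U"
      using increasing_image_le[OF mono lip L pq(1) U(1,2) slopes(1)] by blast
    have "ennreal p * emeasure lborel U < ennreal ?p * emeasure lborel U"
      using False U pq by (intro ennreal_mult_strict_right_mono) (auto simp: ennreal_less_iff zero_less_iff_neq_zero)
    with V(3) have "emeasure lebesgue V < ennreal ?p * emeasure lborel U" by (rule order_le_less_trans)
    then obtain U' where U': "open U'" "V \<subseteq> U'" "emeasure lborel U' < ennreal ?p * emeasure lborel U"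
      by (rule emeasure_lebesgue_open_superset[OF V(1)])
    have "0 < q" "g ` E \<subseteq> U'" using pq U' V by auto
    from increasing_preimage_le[OF mono lip L this(1) U'(1) this(2) slopes(2)]
    obtain V' where V': "V' \<in> sets lebesgue" "E \<subseteq> V'" "emeasure lebesgue V' \<le> ennreal (1 / q) * emeasure lborel U'" by blast
    have "ennreal (1 / q) * emeasure lborel U' \<le> ennreal (1 / q) * (ennreal ?p * emeasure lborel U)"
      using U'(3) by (intro mult_left_mono) auto
    also have "\<dots> = ennreal (?p / q) * emeasure lborel U"
      using pq by (simp add: mult.assoc[symmetric] mult.commute[of q] flip: ennreal_mult)
    finally show ?thesis using V' by (meson order_trans)
  qed
qed

text \<open>A bounded function without a limit has lower limit strictly below its upper limit.
  Rational separators are wanted because they index a countable family of exceptional sets.\<close>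

lemma exists_separating_rats:
  fixes Q :: "'a \<Rightarrow> real"
  assumes F: "F \<noteq> bot" and bd: "\<forall>\<^sub>F h in F. \<bar>Q h\<bar> \<le> M" and no: "\<nexists>l. (Q \<longlongrightarrow> l) F"
  shows "\<exists>p\<in>\<rat>. \<exists>q\<in>\<rat>. p < q \<and> (\<exists>\<^sub>F h in F. Q h < p) \<and> (\<exists>\<^sub>F h in F. Q h > q)"
proof -
  let ?e = "\<lambda>h. ereal (Q h)"
  have lo: "ereal (- M) \<le> Liminf F ?e" using bd by (intro Liminf_bounded) (auto elim!: eventually_mono)
  have hi: "Limsup F ?e \<le> ereal M" using bd by (intro Limsup_bounded) (auto elim!: eventually_mono)
  have le: "Liminf F ?e \<le> Limsup F ?e" by (rule Liminf_le_Limsup[OF F])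
  have "Liminf F ?e \<noteq> Limsup F ?e"
  proof
    assume eq: "Liminf F ?e = Limsup F ?e"
    have "\<exists>l. Limsup F ?e = ereal l" using lo hi eq by (cases "Limsup F ?e") auto
    then obtain l where "Limsup F ?e = ereal l" ..
    then have "(?e \<longlongrightarrow> ereal l) F" using eq F by (intro Liminf_eq_Limsup) auto
    then show False using no by auto
  qed
  with le have "Liminf F ?e < Limsup F ?e" by simp
  then obtain a where a: "Liminf F ?e < ereal a" "ereal a < Limsup F ?e" using ereal_dense2 by blast
  then obtain b where b: "ereal a < ereal b" "ereal b < Limsup F ?e" using ereal_dense2 by blast
  obtain c where c: "a < c" "c < b" using b dense by auto
  obtain p where p: "p \<in> \<rat>" "a < p" "p < c" using Rats_dense_in_real[OF c(1)] by blast
  obtain q where q: "q \<in> \<rat>" "c < q" "q < b" using Rats_dense_in_real[OF c(2)] by blast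
  have "\<exists>\<^sub>F h in F. Q h < p"
  proof (rule ccontr)
    assume "\<not> ?thesis"
    then have "\<forall>\<^sub>F h in F. ereal p \<le> ?e h" by (simp add: not_frequently not_less)
    from Liminf_bounded[OF this] have "ereal p < ereal a" using a(1) by (rule order_le_less_trans)
    then show False using p by simp
  qed
  moreover have "\<exists>\<^sub>F h in F. Q h > q"
  proof (rule ccontr)
    assume "\<not> ?thesis"
    then have "\<forall>\<^sub>F h in F. ?e h \<le> ereal q" by (simp add: not_frequently not_less)
    from Limsup_bounded[OF this] have "ereal b < ereal q" using b(2) by (rule order_less_le_trans[rotated])
    then show False using q by simp
  qed
  ultimately show ?thesis using p q by (intro bexI[of _ p] bexI[of _ q]) auto
qed

theorem lipschitz_real_differentiable_ae:
  fixes g :: "real \<Rightarrow> real"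
  assumes g: "L-lipschitz_on UNIV g"
  shows "negligible {x. \<nexists>D. (g has_real_derivative D) (at x)}"
proof -
  define M where "M = L + 1"
  have M: "0 < M" using lipschitz_on_nonneg[OF g] by (simp add: M_def)
  have gM: "\<bar>g y - g x\<bar> \<le> M * \<bar>y - x\<bar>" for x y
    using lipschitz_onD[OF g, of y x] by (simp add: dist_real_def M_def distrib_right)
  \<comment> \<open>A linear term changes nothing about differentiability and makes the function
    strictly increasing, with all slopes between \<open>M\<close> and \<open>3 * M\<close>.\<close>
  define k where "k x = g x + 2 * M * x" for x
  have k: "M * (y - x) \<le> k y - k x" "k y - k x \<le> 3 * M * (y - x)" if "x < y" for x y
    using gM[of y x] that by (auto simp: k_def algebra_simps abs_le_iff)
  have kmono: "k x < k y" if "x < y" for x y using k(1)[OF that] M that mult_pos_pos[of M "y - x"] by linarith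
  define lo where "lo p = {x. \<forall>d>0. \<exists>u v. u < v \<and> x \<in> {u..v} \<and> v - u < d \<and> k v - k u \<le> p * (v - u)}" for p
  define hi where "hi q = {x. \<forall>d>0. \<exists>u v. u < v \<and> x \<in> {u..v} \<and> v - u < d \<and> k v - k u \<ge> q * (v - u)}" for q
  have neg: "negligible (lo p \<inter> hi q \<inter> ball 0 (real n))" if "p < q" for p q n
  proof (cases "0 \<le> p")
    case True
    show ?thesis
      by (rule negligible_two_slopes[OF kmono k(2) _ True that]) (use M in \<open>auto simp: lo_def hi_def\<close>)
  next
    case False
    \<comment> \<open>All slopes of \<open>k\<close> are positive, so none is bounded by a negative
      \<open>p\<close>.\<close>
    have "lo p = {}"
    proof (rule ccontr)
      assume "lo p \<noteq> {}"
      then obtain u v where "u < v" "k v - k u \<le> p * (v - u)" unfolding lo_def using zero_less_one by blast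
      moreover have "p * (v - u) < 0" "0 < M * (v - u)"
        using M False \<open>u < v\<close> by (auto intro: mult_neg_pos)
      ultimately show False using k(1)[of u v] by linarith
    qed
    then show ?thesis by simp
  qed
  have sub: "{x. \<nexists>D. (g has_real_derivative D) (at x)} \<subseteq> (\<Union>p\<in>\<rat>. \<Union>q\<in>\<rat> \<inter> {p<..}. \<Union>n. lo p \<inter> hi q \<inter> ball 0 (real n))"
  proof
    fix x assume "x \<in> {x. \<nexists>D. (g has_real_derivative D) (at x)}"
    then have nd: "\<nexists>D. (g has_real_derivative D) (at x)" by simp
    define Q where "Q h = (k (x + h) - k x) / h" for h
    have "\<nexists>l. (Q \<longlongrightarrow> l) (at 0)"
    proof
      assume "\<exists>l. (Q \<longlongrightarrow> l) (at 0)"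
      then obtain l where "(Q \<longlongrightarrow> l) (at 0)" ..
      then have "(k has_real_derivative l) (at x)" by (simp add: DERIV_def Q_def[abs_def])
      then have "((\<lambda>x. k x - 2 * M * x) has_real_derivative l - 2 * M) (at x)"
        by (auto intro!: derivative_eq_intros)
      then show False using nd by (simp add: k_def)
    qed
    moreover have "\<forall>\<^sub>F h in at 0. \<bar>Q h\<bar> \<le> 3 * M"
      unfolding eventually_at_filter
    proof (intro always_eventually allI impI)
      fix h :: real assume "h \<noteq> 0"
      have "\<bar>k (x + h) - k x\<bar> \<le> 3 * M * \<bar>h\<bar>"
        using gM[of "x + h" x] M by (auto simp: k_def abs_le_iff algebra_simps abs_if split: if_splits)
      then show "\<bar>Q h\<bar> \<le> 3 * M" using \<open>h \<noteq> 0\<close> by (simp add: Q_def field_simps)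
    qed
    ultimately obtain p q where pq: "p \<in> \<rat>" "q \<in> \<rat>" "p < q"
       "\<exists>\<^sub>F h in at 0. Q h < p" "\<exists>\<^sub>F h in at 0. Q h > q"
      using exists_separating_rats[of "at (0::real)" Q "3 * M"] by auto
    \<comment> \<open>The point \<open>x\<close> becomes the left or right endpoint of the interval
      according to the sign of \<open>h\<close>; both one-sided quotients equal
      \<open>Q h\<close>.\<close>
    have fr: "\<exists>u v. u < v \<and> x \<in> {u..v} \<and> v - u < d \<and> P ((k v - k u) / (v - u))"
      if fr: "\<exists>\<^sub>F h in at 0. P (Q h)" and d: "0 < d" for P and d :: real
    proof -
      have "\<exists>h. h \<noteq> 0 \<and> \<bar>h\<bar> < d \<and> P (Q h)"
        using fr d by (force simp: frequently_def eventually_at dist_real_def)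
      then obtain h where h: "h \<noteq> 0" "\<bar>h\<bar> < d" "P (Q h)" by blast
      have eq: "(k x - k (x + h)) / (x - (x + h)) = Q h" using h(1) by (simp add: Q_def field_simps)
      show ?thesis
      proof (cases "0 < h")
        case True
        then show ?thesis using h by (intro exI[of _ x] exI[of _ "x + h"]) (simp add: Q_def)
      next
        case False
        then show ?thesis using h eq by (intro exI[of _ "x + h"] exI[of _ x]) (simp only: eq, simp)
      qed
    qed
    have "x \<in> lo p" unfolding lo_def
    proof (intro CollectI allI impI)
      fix d :: real assume "0 < d"
      then obtain u v where "u < v" "x \<in> {u..v}" "v - u < d" "(k v - k u) / (v - u) < p" using fr[OF pq(4)] by blast
      then show "\<exists>u v. u < v \<and> x \<in> {u..v} \<and> v - u < d \<and> k v - k u \<le> p * (v - u)"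
        by (intro exI[of _ u] exI[of _ v]) (auto simp: pos_divide_less_eq)
    qed
    moreover have "x \<in> hi q" unfolding hi_def
    proof (intro CollectI allI impI)
      fix d :: real assume "0 < d"
      then obtain u v where "u < v" "x \<in> {u..v}" "v - u < d" "(k v - k u) / (v - u) > q" using fr[OF pq(5)] by blast
      then show "\<exists>u v. u < v \<and> x \<in> {u..v} \<and> v - u < d \<and> k v - k u \<ge> q * (v - u)"
        by (intro exI[of _ u] exI[of _ v]) (auto simp: pos_less_divide_eq)
    qed
    moreover obtain n where "\<bar>x\<bar> < real n" using reals_Archimedean2 by blast
    ultimately show "x \<in> (\<Union>p\<in>\<rat>. \<Union>q\<in>\<rat> \<inter> {p<..}. \<Union>n. lo p \<inter> hi q \<inter> ball 0 (real n))"
      using pq by (auto simp: dist_real_def)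
  qed
  have "negligible (\<Union>p\<in>\<rat>. \<Union>q\<in>\<rat> \<inter> {p<..}. \<Union>n. lo p \<inter> hi q \<inter> ball 0 (real n))"
    by (intro negligible_countable_UN neg) (auto simp: countable_rat intro: countable_Int1)
  then show ?thesis using sub negligible_subset by blast
qed

text \<open>Almost every point of \<open>E\<close> has points of \<open>E\<close> at distance \<open>o(|z - x|)\<close> from every nearby \<open>z\<close>. In
  Rademacher's theorem this allows to move along a coordinate polygon from \<open>x\<close>, replacing each corner
  by a point where the partial derivative is nearly the one at \<open>x\<close>.\<close>

lemma negligible_porous:
  fixes E :: "'a::euclidean_space set"
  shows "negligible {x \<in> E. \<exists>c>0. \<forall>d>0. \<exists>z. 0 < dist z x \<and> dist z x < d \<and> ball z (c * dist z x) \<inter> E = {}}"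
proof -
  \<comment> \<open>Constants \<open>1 / Suc k\<close> and bounded parts give a countable union of
    sets to which the contraction argument applies.\<close>
  define P where "P k n = {x \<in> E \<inter> ball 0 (real n). \<forall>d>0. \<exists>z. 0 < dist z x \<and> dist z x < d \<and>
     ball z (1 / real (Suc k) * dist z x) \<inter> E = {}}" for k n
  have neg: "negligible (P k n)" for k n
  proof -
    define c where "c = 1 / real (Suc k)"
    have c: "0 < c" "c \<le> 1" by (auto simp: c_def)
    \<comment> \<open>With \<open>\<rho> = dist z x\<close>, the ball of radius
      \<open>2 * \<rho>\<close> about \<open>x\<close> contains the hole of radius
      \<open>c * \<rho>\<close> about \<open>z\<close>, because \<open>c \<le> 1\<close>. The hole
      occupies the fraction \<open>(c / 2) ^ DIM('a)\<close> of the volume.\<close>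
    define \<theta> where "\<theta> = 1 - (c / 2) ^ DIM('a)"
    have th: "0 \<le> \<theta>" "\<theta> < 1" using c by (auto simp: \<theta>_def power_le_one)
    show ?thesis
    proof (rule negligible_contraction[OF th])
      show "bounded (P k n)" by (rule bounded_subset[OF bounded_ball[of 0 "real n"]]) (auto simp: P_def)
      fix U assume U: "open U" "P k n \<subseteq> U"
      define K where "K = {(x, z). 0 < dist z x \<and> cball x (2 * dist z x) \<subseteq> U \<and> ball z (c * dist z x) \<inter> E = {}}"
      define r where "r = (\<lambda>(x, z :: 'a). 2 * dist z x)"
      define h where "h = (\<lambda>(x, z :: 'a). ball z (c * dist z x))"
      show "\<exists>V\<in>sets lebesgue. P k n \<subseteq> V \<and> emeasure lebesgue V \<le> ennreal \<theta> * emeasure lborel U"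
      proof (rule Vitali_upper_bound[of K r "P k n" fst "\<lambda>i. cball (fst i) (r i) - h i" "\<lambda>i. cball (fst i) (r i)"])
        show "\<exists>i. i \<in> K \<and> x \<in> cball (fst i) (r i) \<and> r i < d" if x: "x \<in> P k n" and d: "0 < d" for x d
        proof -
          obtain e where e: "0 < e" "ball x e \<subseteq> U" using U x openE by blast
          then have "0 < min d e / 2" using d by simp
          then obtain z where z: "0 < dist z x" "dist z x < min d e / 2" "ball z (c * dist z x) \<inter> E = {}"
            using x unfolding P_def c_def by blast
          have "cball x (2 * dist z x) \<subseteq> ball x e" using z(2) by auto
          then have "(x, z) \<in> K" using z e by (auto simp: K_def)
          then show ?thesis using z by (intro exI[of _ "(x, z)"]) (auto simp: r_def)
        qed
        show "P k n \<inter> cball (fst i) (r i) \<subseteq> cball (fst i) (r i) - h i" if "i \<in> K" for i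
          using that by (auto simp: K_def h_def P_def case_prod_beta)
        show "emeasure lborel (cball (fst i) (r i) - h i) \<le> ennreal \<theta> * emeasure lborel (cball (fst i) (r i))" if i: "i \<in> K" for i
        proof -
          obtain x z where xz: "i = (x, z)" by (cases i)
          define \<rho> where "\<rho> = dist z x"
          have \<rho>: "0 < \<rho>" using i by (simp add: K_def xz \<rho>_def)
          have cr: "c * \<rho> \<le> \<rho>" using c \<rho> by simp
          let ?v = "unit_ball_vol (real DIM('a))" and ?B = "cball (fst i) (r i)"
          have "h i \<subseteq> ?B"
          proof
            fix y assume "y \<in> h i"
            then have "dist z y < c * \<rho>" by (simp add: h_def xz \<rho>_def)
            then show "y \<in> ?B" using dist_triangle[of x y z] cr by (simp add: xz r_def \<rho>_def dist_commute)
          qed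
          then have "emeasure lborel (?B - h i) = emeasure lborel ?B - emeasure lborel (h i)"
            using emeasure_lborel_ball_finite[of z "c * \<rho>"]
            by (intro emeasure_Diff) (auto simp: h_def xz \<rho>_def)
          also have B: "emeasure lborel ?B = ennreal (?v * (2 * \<rho>) ^ DIM('a))"
            using \<rho> by (simp add: xz r_def emeasure_cball flip: \<rho>_def)
          also have "emeasure lborel (h i) = ennreal (?v * (c * \<rho>) ^ DIM('a))"
            using \<rho> c by (simp add: xz h_def emeasure_ball flip: \<rho>_def)
          also have "ennreal (?v * (2 * \<rho>) ^ DIM('a)) - ennreal (?v * (c * \<rho>) ^ DIM('a)) =
              ennreal (?v * (2 * \<rho>) ^ DIM('a) - ?v * (c * \<rho>) ^ DIM('a))"
            using \<rho> c by (intro ennreal_minus) simp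
          also have "?v * (2 * \<rho>) ^ DIM('a) - ?v * (c * \<rho>) ^ DIM('a) = \<theta> * (?v * (2 * \<rho>) ^ DIM('a))"
            by (simp add: \<theta>_def power_divide power_mult_distrib field_simps)
          finally show ?thesis using \<rho> th unfolding B by (simp add: ennreal_mult')
        qed
      qed (use U in \<open>auto simp: K_def r_def h_def case_prod_beta disjnt_def\<close>)
    qed
  qed
  have "negligible (\<Union>k\<in>UNIV. \<Union>n\<in>UNIV. P k n)" by (intro negligible_countable_UN neg) auto
  moreover have "{x \<in> E. \<exists>c>0. \<forall>d>0. \<exists>z. 0 < dist z x \<and> dist z x < d \<and> ball z (c * dist z x) \<inter> E = {}} \<subseteq> (\<Union>k\<in>UNIV. \<Union>n\<in>UNIV. P k n)"
  proof clarify
    fix x :: 'a and c :: real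
    assume x: "x \<in> E" and c: "0 < c" "\<forall>d>0. \<exists>z. 0 < dist z x \<and> dist z x < d \<and> ball z (c * dist z x) \<inter> E = {}"
    obtain k where k: "inverse (real (Suc k)) < c" using reals_Archimedean c by blast
    obtain n where "norm x < real n" using reals_Archimedean2 by blast
    moreover have "\<exists>z. 0 < dist z x \<and> dist z x < d \<and> ball z (1 / real (Suc k) * dist z x) \<inter> E = {}" if d: "0 < d" for d
    proof -
      obtain z where z: "0 < dist z x" "dist z x < d" "ball z (c * dist z x) \<inter> E = {}"
        using c(2)[rule_format, OF d] by (elim exE conjE)
      have "ball z (1 / real (Suc k) * dist z x) \<subseteq> ball z (c * dist z x)"
        using k z(1) by (intro subset_ball mult_right_mono) (simp_all add: inverse_eq_divide)
      then have "ball z (1 / real (Suc k) * dist z x) \<inter> E \<subseteq> ball z (c * dist z x) \<inter> E"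
        by (rule Int_mono) simp
      then show ?thesis using z by (intro exI[of _ z]) simp
    qed
    ultimately have "x \<in> P k n" using x by (auto simp: P_def)
    then show "x \<in> (\<Union>k\<in>UNIV. \<Union>n\<in>UNIV. P k n)" by blast
  qed
  ultimately show ?thesis by (rule negligible_subset)
qed

section \<open>From partial derivatives to Rademacher's theorem\<close>

text \<open>Both approximations are compared on a short vector parallel to \<open>p - q\<close>, on
  which the two linear maps differ the most.\<close>

lemma linear_approximations_close:
  fixes F :: "'a::real_inner \<Rightarrow> real"
  assumes \<delta>: "0 < \<delta>"
    and p: "\<And>v. norm v < \<delta> \<Longrightarrow> \<bar>F (x + v) - F x - p \<bullet> v\<bar> \<le> a * norm v"
    and q: "\<And>v. norm v < \<delta> \<Longrightarrow> \<bar>F (x + v) - F x - q \<bullet> v\<bar> \<le> b * norm v"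
    and "0 \<le> a + b"
  shows "norm (p - q) \<le> a + b"
proof (cases "p = q")
  case False
  define w where "w = p - q"
  have w: "0 < norm w" using False by (simp add: w_def)
  define t where "t = \<delta> / 2 / norm w"
  have t: "0 < t" "norm (t *\<^sub>R w) < \<delta>" using w \<delta> by (auto simp: t_def)
  have "\<bar>p \<bullet> (t *\<^sub>R w) - q \<bullet> (t *\<^sub>R w)\<bar> \<le> a * norm (t *\<^sub>R w) + b * norm (t *\<^sub>R w)"
    using p[OF t(2)] q[OF t(2)] by linarith
  also have "p \<bullet> (t *\<^sub>R w) - q \<bullet> (t *\<^sub>R w) = t * (norm w)\<^sup>2"
    unfolding power2_norm_eq_inner by (simp add: w_def inner_diff_left algebra_simps)
  also have "\<bar>t * (norm w)\<^sup>2\<bar> = (t * norm w) * norm w" using t by (simp add: power2_eq_square)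
  also have "a * norm (t *\<^sub>R w) + b * norm (t *\<^sub>R w) = (t * norm w) * (a + b)"
    using t by (simp add: algebra_simps)
  finally show ?thesis using t w by (simp add: w_def)
qed (use assms in simp)

text \<open>Each accuracy may come with its own slope. Slopes of accuracies \<open>e n\<close> and
  \<open>e m\<close> differ by at most \<open>e n + e m\<close>, so they form a Cauchy sequence, and
  its limit is the gradient.\<close>

lemma gderiv_of_approximations:
  fixes F :: "'a::euclidean_space \<Rightarrow> real"
  assumes "\<And>\<epsilon>. 0 < \<epsilon> \<Longrightarrow> \<exists>q. \<exists>\<delta>>0. \<forall>v. norm v < \<delta> \<longrightarrow> \<bar>F (x + v) - F x - q \<bullet> v\<bar> \<le> \<epsilon> * norm v"
  shows "\<exists>D. GDERIV F x :> D"
proof -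
  define e where "e n = inverse (real (Suc n))" for n
  have e: "0 < e n" for n by (simp add: e_def)
  obtain q \<delta> where q: "\<And>n. 0 < \<delta> n" "\<And>n v. norm v < \<delta> n \<Longrightarrow> \<bar>F (x + v) - F x - q n \<bullet> v\<bar> \<le> e n * norm v"
    using assms[OF e] by metis
  have le: "norm (q n - q m) \<le> e n + e m" for n m
    using q e[of n] e[of m] by (intro linear_approximations_close[where \<delta> = "min (\<delta> n) (\<delta> m)" and F = F and x = x]) auto
  have e0: "e \<longlonglongrightarrow> 0" unfolding e_def by (rule LIMSEQ_inverse_real_of_nat)
  have "Cauchy q"
    unfolding Cauchy_altdef2
  proof (intro allI impI)
    fix \<epsilon> :: real assume "0 < \<epsilon>"
    then obtain N where N: "\<And>n. n \<ge> N \<Longrightarrow> e n < \<epsilon> / 2"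
      using order_tendstoD(2)[OF e0, of "\<epsilon> / 2"] by (auto simp: eventually_sequentially)
    have "dist (q n) (q N) < \<epsilon>" if "n \<ge> N" for n
      using le[of n N] N[OF that] N[OF order_refl] by (simp add: dist_norm)
    then show "\<exists>N. \<forall>n\<ge>N. dist (q n) (q N) < \<epsilon>" by blast
  qed
  then obtain D where D: "q \<longlonglongrightarrow> D" using Cauchy_convergent_iff convergent_def by blast
  have "(F has_derivative (\<lambda>h. h \<bullet> D)) (at x)"
    unfolding has_derivative_at_alt
  proof (intro conjI allI impI)
    show "bounded_linear (\<lambda>h. h \<bullet> D)" by (rule bounded_linear_inner_left)
    fix \<epsilon> :: real assume "0 < \<epsilon>"
    have "(\<lambda>n. e n + norm (q n - D)) \<longlonglongrightarrow> 0 + norm (D - D)" by (intro tendsto_intros e0 D)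
    then have "\<forall>\<^sub>F n in sequentially. e n + norm (q n - D) < \<epsilon>" using \<open>0 < \<epsilon>\<close> by (intro order_tendstoD) auto
    then obtain n where n: "e n + norm (q n - D) < \<epsilon>" by (auto dest: eventually_happens)
    show "\<exists>d>0. \<forall>y. norm (y - x) < d \<longrightarrow> norm (F y - F x - (y - x) \<bullet> D) \<le> \<epsilon> * norm (y - x)"
    proof (intro exI[of _ "\<delta> n"] conjI allI impI q(1))
      fix y assume y: "norm (y - x) < \<delta> n"
      have "\<bar>F y - F x - q n \<bullet> (y - x)\<bar> \<le> e n * norm (y - x)" using q(2)[OF y] by simp
      moreover have "\<bar>(q n - D) \<bullet> (y - x)\<bar> \<le> norm (q n - D) * norm (y - x)" by (rule Cauchy_Schwarz_ineq2)
      ultimately have "\<bar>F y - F x - (y - x) \<bullet> D\<bar> \<le> (e n + norm (q n - D)) * norm (y - x)"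
        by (simp add: inner_diff_left inner_commute[of _ D] distrib_right)
      also have "\<dots> \<le> \<epsilon> * norm (y - x)" using n by (intro mult_right_mono) auto
      finally show "norm (F y - F x - (y - x) \<bullet> D) \<le> \<epsilon> * norm (y - x)" by simp
    qed
  qed
  then show ?thesis by (auto simp: gderiv_def)
qed

text \<open>These sets are closed, so countable unions and intersections over rational data are Borel sets
  and no measurability of derivatives is needed.\<close>

definition partial_approx :: "('a::euclidean_space \<Rightarrow> real) \<Rightarrow> 'a \<Rightarrow> real \<Rightarrow> real \<Rightarrow> real \<Rightarrow> 'a set" where
  "partial_approx F b \<epsilon> q \<delta> = {x. \<forall>s. \<bar>s\<bar> < \<delta> \<longrightarrow> \<bar>F (x + s *\<^sub>R b) - F x - q * s\<bar> \<le> \<epsilon> * \<bar>s\<bar>}"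

lemma closed_partial_approx:
  assumes "continuous_on UNIV F"
  shows "closed (partial_approx F b \<epsilon> q \<delta>)"
proof -
  have "closed {x. \<bar>F (x + s *\<^sub>R b) - F x - q * s\<bar> \<le> \<epsilon> * \<bar>s\<bar>}" for s
    by (intro closed_Collect_le continuous_intros continuous_on_compose2[OF assms]) auto
  then have "closed (\<Inter>s\<in>{s. \<bar>s\<bar> < \<delta>}. {x. \<bar>F (x + s *\<^sub>R b) - F x - q * s\<bar> \<le> \<epsilon> * \<bar>s\<bar>})"
    by (intro closed_INT) auto
  moreover have "(\<Inter>s\<in>{s. \<bar>s\<bar> < \<delta>}. {x. \<bar>F (x + s *\<^sub>R b) - F x - q * s\<bar> \<le> \<epsilon> * \<bar>s\<bar>}) = partial_approx F b \<epsilon> q \<delta>"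
    by (auto simp: partial_approx_def)
  ultimately show ?thesis by simp
qed

text \<open>On every line in direction \<open>b\<close> the one-dimensional theorem leaves only a
  null set of bad points. The bad set is Borel, so integration along lines makes it null in the
  whole space.\<close>

lemma negligible_not_partial_approx:
  fixes F :: "'a::euclidean_space \<Rightarrow> real"
  assumes F: "L-lipschitz_on UNIV F" and b: "norm b = 1"
  shows "negligible (- (\<Inter>k::nat. \<Union>q\<in>\<rat>. \<Union>m::nat. partial_approx F b (inverse (Suc k)) q (inverse (Suc m))))"
proof -
  define G where "G = (\<Inter>k::nat. \<Union>q\<in>\<rat>. \<Union>m::nat. partial_approx F b (inverse (Suc k)) q (inverse (Suc m)))"
  have P: "partial_approx F b \<epsilon> q \<delta> \<in> sets borel" for \<epsilon> q \<delta>
    by (intro borel_closed closed_partial_approx lipschitz_on_continuous_on[OF F])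
  have [measurable]: "G \<in> sets borel" unfolding G_def
    by (intro sets.countable_INT'' sets.countable_UN'' countable_rat countableI_type P) auto
  have bb: "b \<bullet> b = 1" using b by (simp add: norm_eq_1)
  have fib: "(\<integral>\<^sup>+s. indicator (- G) (x + s *\<^sub>R b) \<partial>lborel) = 0" for x
  proof -
    define g where "g s = F (x + s *\<^sub>R b)" for s
    have g: "L-lipschitz_on UNIV g"
    proof (rule lipschitz_onI)
      fix s t :: real
      have "dist (g s) (g t) \<le> L * dist (x + s *\<^sub>R b) (x + t *\<^sub>R b)"
        unfolding g_def by (rule lipschitz_onD[OF F]) auto
      also have "dist (x + s *\<^sub>R b) (x + t *\<^sub>R b) = dist s t"
        using b by (simp add: dist_norm flip: scaleR_diff_left)
      finally show "dist (g s) (g t) \<le> L * dist s t" .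
    qed (rule lipschitz_on_nonneg[OF F])
    have "{s. x + s *\<^sub>R b \<in> - G} \<subseteq> {s. \<nexists>D. (g has_real_derivative D) (at s)}"
    proof (intro subsetI CollectI notI)
      fix s assume s: "s \<in> {s. x + s *\<^sub>R b \<in> - G}" and "\<exists>D. (g has_real_derivative D) (at s)"
      then obtain D where D: "(g has_derivative (\<lambda>h. D * h)) (at s)" by (auto simp: has_field_derivative_def)
      have "x + s *\<^sub>R b \<in> G" unfolding G_def
      proof (intro INT_I)
        fix k :: nat
        define e where "e = inverse (real (Suc k))"
        have e: "0 < e" by (simp add: e_def)
        then obtain d where d: "0 < d" "\<And>y. \<bar>y - s\<bar> < d \<Longrightarrow> \<bar>g y - g s - D * (y - s)\<bar> \<le> e / 2 * \<bar>y - s\<bar>"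
          using D unfolding has_derivative_at_alt by (metis half_gt_zero real_norm_def)
        \<comment> \<open>Half of \<open>e\<close> goes to the derivative, the other half to
          replacing \<open>D\<close> by a rational slope.\<close>
        obtain q where q: "q \<in> \<rat>" "D < q" "q < D + e / 2" using Rats_dense_in_real[of D "D + e/2"] e by auto
        obtain m where m: "inverse (real (Suc m)) < d" using reals_Archimedean d by blast
        have "x + s *\<^sub>R b \<in> partial_approx F b e q (inverse (Suc m))"
          unfolding partial_approx_def
        proof (intro CollectI allI impI)
          fix h assume h: "\<bar>h\<bar> < inverse (real (Suc m))"
          then have "\<bar>g (s + h) - g s - D * h\<bar> \<le> e / 2 * \<bar>h\<bar>" using d(2)[of "s + h"] m by simp
          moreover have "\<bar>(D - q) * h\<bar> \<le> e / 2 * \<bar>h\<bar>" unfolding abs_mult using q by (intro mult_right_mono) auto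
          ultimately have "\<bar>g (s + h) - g s - q * h\<bar> \<le> e * \<bar>h\<bar>"
            unfolding left_diff_distrib by linarith
          then show "\<bar>F (x + s *\<^sub>R b + h *\<^sub>R b) - F (x + s *\<^sub>R b) - q * h\<bar> \<le> e * \<bar>h\<bar>"
            by (simp add: g_def algebra_simps)
        qed
        then show "x + s *\<^sub>R b \<in> (\<Union>q\<in>\<rat>. \<Union>m::nat. partial_approx F b (inverse (Suc k)) q (inverse (Suc m)))"
          using q(1) unfolding e_def by blast
      qed
      then show False using s by simp
    qed
    then have "negligible {s. x + s *\<^sub>R b \<in> - G}"
      using lipschitz_real_differentiable_ae[OF g] negligible_subset by blast
    moreover have m: "{s. x + s *\<^sub>R b \<in> - G} \<in> sets borel" by measurable
    ultimately have "emeasure lborel {s. x + s *\<^sub>R b \<in> - G} = 0"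
      by (simp add: negligible_iff_null_sets null_sets_def)
    then have "(\<integral>\<^sup>+s. indicator {s. x + s *\<^sub>R b \<in> - G} s \<partial>lborel) = 0" using m by simp
    then show ?thesis by (simp add: indicator_def)
  qed
  have "emeasure lborel (- G) = (\<integral>\<^sup>+x. indicator (- G) x \<partial>lborel)" by simp
  also have "\<dots> = 0"
    by (subst nn_integral_lborel_slab[OF _ bb]) (auto simp: fib)
  finally have "- G \<in> null_sets lborel" by (auto simp: null_sets_def)
  then show ?thesis unfolding G_def[symmetric] negligible_iff_null_sets by (rule null_sets_completionI)
qed

theorem Rademacher:
  fixes F :: "'a::euclidean_space \<Rightarrow> real"
  assumes F: "L-lipschitz_on UNIV F"
  shows "AE x in lborel. \<exists>D. GDERIV F x :> D"
proof -
  have L: "0 \<le> L" by (rule lipschitz_on_nonneg[OF F])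
  let ?P = "\<lambda>b k q m. partial_approx F b (inverse (Suc k)) q (inverse (Suc m))"
  define G where "G b = (\<Inter>k::nat. \<Union>q\<in>\<rat>. \<Union>m::nat. ?P b k q m)" for b
  define por where "por E = {x \<in> E. \<exists>c>0. \<forall>d>0. \<exists>z. 0 < dist z x \<and> dist z x < d \<and> ball z (c * dist z x) \<inter> E = {}}" for E :: "'a set"
  \<comment> \<open>Outside \<open>Bad\<close>, for every basis direction and accuracy,
    \<open>x\<close> lies in some approximation set with rational slope and is not a point of
    porosity of that set. All indices are countable.\<close>
  define Bad where "Bad = (\<Union>b\<in>Basis. - G b \<union> (\<Union>k::nat\<in>UNIV. \<Union>q\<in>\<rat>. \<Union>m::nat\<in>UNIV. por (?P b k q m)))"
  have "negligible Bad" unfolding Bad_def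
  proof (intro negligible_countable_UN negligible_Un countable_rat)
    show "countable (Basis :: 'a set)" by (simp add: countable_finite)
    show "negligible (por (?P b k q m))" for b k q m unfolding por_def by (rule negligible_porous)
    show "negligible (- G b)" if "b \<in> Basis" for b
      unfolding G_def using that by (intro negligible_not_partial_approx[OF F]) simp
  qed auto
  then have "AE x in lborel. x \<notin> Bad"
    using AE_not_in[of Bad lebesgue] by (simp add: negligible_iff_null_sets AE_completion_iff)
  then show ?thesis
  proof (rule eventually_mono)
    fix x assume nb: "x \<notin> Bad"
    show "\<exists>D. GDERIV F x :> D"
    proof (rule gderiv_of_approximations)
      fix \<epsilon>0 :: real assume \<epsilon>0: "0 < \<epsilon>0"
      \<comment> \<open>Each coordinate step costs \<open>(2 * L + 1) * \<epsilon> * norm v\<close>: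
        two Lipschitz moves between a corner and its substitute, and one error of the partial
        derivative.\<close>
      define A where "A = real DIM('a) * (2 * L + 1)"
      have A: "0 < A" using L by (simp add: A_def add_nonneg_pos)
      define \<epsilon> where "\<epsilon> = \<epsilon>0 / A"
      have \<epsilon>: "0 < \<epsilon>" using A \<epsilon>0 by (simp add: \<epsilon>_def)
      obtain k where k: "inverse (real (Suc k)) < \<epsilon>" using reals_Archimedean \<epsilon> by blast
      have "\<exists>q m. x \<in> ?P b k q m \<and> x \<notin> por (?P b k q m)" if "b \<in> Basis" for b
      proof -
        have "x \<in> G b" using nb that by (auto simp: Bad_def)
        then obtain q m where qm: "q \<in> \<rat>" "x \<in> ?P b k q m" unfolding G_def by blast
        moreover have "x \<notin> por (?P b k q m)" using nb that qm(1) by (auto simp: Bad_def)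
        ultimately show ?thesis by blast
      qed
      then obtain q m where qm: "\<And>b. b \<in> Basis \<Longrightarrow> x \<in> ?P b k (q b) (m b)"
         "\<And>b. b \<in> Basis \<Longrightarrow> x \<notin> por (?P b k (q b) (m b))" by metis
      define E where "E b = ?P b k (q b) (m b)" for b
      have "\<exists>d>0. \<forall>z. 0 < dist z x \<longrightarrow> dist z x < d \<longrightarrow> ball z (\<epsilon> * dist z x) \<inter> E b \<noteq> {}" if b: "b \<in> Basis" for b
        using qm[OF b] \<epsilon> unfolding por_def E_def by blast
      then obtain d where d: "\<And>b. b \<in> Basis \<Longrightarrow> 0 < d b"
        "\<And>b z. b \<in> Basis \<Longrightarrow> 0 < dist z x \<Longrightarrow> dist z x < d b \<Longrightarrow> ball z (\<epsilon> * dist z x) \<inter> E b \<noteq> {}"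
        by metis
      define \<delta> where "\<delta> = Min ((\<lambda>b. min (d b) (inverse (Suc (m b)))) ` Basis)"
      have \<delta>: "0 < \<delta>" unfolding \<delta>_def using d(1) by (subst Min_gr_iff) auto
      have \<delta>le: "\<delta> \<le> d b" "\<delta> \<le> inverse (Suc (m b))" if "b \<in> Basis" for b
        using Min_le[of "(\<lambda>b. min (d b) (inverse (real (Suc (m b))))) ` Basis" "min (d b) (inverse (real (Suc (m b))))"] that
        by (auto simp: \<delta>_def)
      have main: "\<bar>F (x + (\<Sum>b\<in>B. (v \<bullet> b) *\<^sub>R b)) - F x - (\<Sum>b\<in>B. q b * (v \<bullet> b))\<bar> \<le> real (card B) * (2 * L + 1) * \<epsilon> * norm v"
        if v: "norm v < \<delta>" and B: "finite B" "B \<subseteq> Basis" for v B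
        using B
      proof (induction B rule: finite_induct)
        case (insert b B)
        have b: "b \<in> Basis" and BB: "B \<subseteq> Basis" using insert by auto
        define w where "w = (\<Sum>b\<in>B. (v \<bullet> b) *\<^sub>R b)"
        define z where "z = x + w"
        have "norm w \<le> norm v"
        proof -
          have wb: "w \<bullet> c = (if c \<in> B then v \<bullet> c else 0)" if c: "c \<in> Basis" for c
          proof -
            have "w \<bullet> c = (\<Sum>b\<in>B. (if b = c then v \<bullet> c else 0))"
              unfolding w_def inner_sum_left using BB c by (intro sum.cong) (auto simp: inner_Basis)
            then show ?thesis using insert(1) by simp
          qed
          show ?thesis by (rule norm_le_componentwise) (simp add: wb)
        qed
        then have zx: "dist z x \<le> norm v" by (simp add: z_def dist_norm)
        \<comment> \<open>The corner \<open>z\<close> may lack a good partial derivative.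
          Nonporosity at \<open>x\<close> supplies a nearby substitute in \<open>E b\<close>, where
          the same slope \<open>q b\<close> works as at \<open>x\<close>. It says nothing about
          \<open>z = x\<close>, but \<open>x\<close> lies in \<open>E b\<close> itself.\<close>
        obtain z' where z': "z' \<in> E b" "dist z z' \<le> \<epsilon> * norm v"
        proof (cases "z = x")
          case True
          then show ?thesis using that[of x] qm(1)[OF b] \<epsilon> by (simp add: E_def)
        next
          case False
          then have "0 < dist z x" "dist z x < d b" using zx v \<delta>le[OF b] by auto
          then obtain z' where "z' \<in> E b" "dist z z' < \<epsilon> * dist z x" using d(2)[OF b] by (force simp: disjoint_iff)
          moreover have "\<epsilon> * dist z x \<le> \<epsilon> * norm v" using zx \<epsilon> by simp
          ultimately show ?thesis using that by force
        qed
        let ?s = "v \<bullet> b"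
        have s: "\<bar>?s\<bar> \<le> norm v" using Basis_le_norm[OF b, of v] by simp
        have "\<bar>F (z' + ?s *\<^sub>R b) - F z' - q b * ?s\<bar> \<le> inverse (real (Suc k)) * \<bar>?s\<bar>"
          using z'(1) s v \<delta>le(2)[OF b] unfolding E_def partial_approx_def by auto
        also have "\<dots> \<le> \<epsilon> * norm v" using k s \<epsilon> by (intro mult_mono) auto
        finally have 1: "\<bar>F (z' + ?s *\<^sub>R b) - F z' - q b * ?s\<bar> \<le> \<epsilon> * norm v" .
        have lip: "\<bar>F y - F y'\<bar> \<le> L * (\<epsilon> * norm v)" if "dist y y' \<le> \<epsilon> * norm v" for y y'
          using lipschitz_onD[OF F, of y y'] mult_left_mono[OF that L] by (simp add: dist_real_def)
        have 2: "\<bar>F z - F z'\<bar> \<le> L * (\<epsilon> * norm v)" by (rule lip[OF z'(2)])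
        have 3: "\<bar>F (z + ?s *\<^sub>R b) - F (z' + ?s *\<^sub>R b)\<bar> \<le> L * (\<epsilon> * norm v)" by (rule lip) (use z'(2) in simp)
        have 4: "\<bar>F z - F x - (\<Sum>b\<in>B. q b * (v \<bullet> b))\<bar> \<le> real (card B) * (2 * L + 1) * \<epsilon> * norm v"
          using insert.IH[OF BB] by (simp add: z_def w_def)
        have sums: "x + (\<Sum>b\<in>insert b B. (v \<bullet> b) *\<^sub>R b) = z + ?s *\<^sub>R b"
          "(\<Sum>b\<in>insert b B. q b * (v \<bullet> b)) = q b * ?s + (\<Sum>b\<in>B. q b * (v \<bullet> b))"
          "real (card (insert b B)) * (2 * L + 1) * \<epsilon> * norm v =
            real (card B) * (2 * L + 1) * \<epsilon> * norm v + 2 * (L * (\<epsilon> * norm v)) + \<epsilon> * norm v"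
          using insert by (auto simp: z_def w_def algebra_simps)
        show ?case unfolding sums using 1 2 3 4 by linarith
      qed simp
      show "\<exists>q. \<exists>\<delta>>0. \<forall>v. norm v < \<delta> \<longrightarrow> \<bar>F (x + v) - F x - q \<bullet> v\<bar> \<le> \<epsilon>0 * norm v"
      proof (intro exI[of _ "\<Sum>b\<in>Basis. q b *\<^sub>R b"] exI[of _ \<delta>] conjI allI impI \<delta>)
        fix v :: 'a assume v: "norm v < \<delta>"
        have "real DIM('a) * (2 * L + 1) * \<epsilon> = \<epsilon>0" using A by (simp add: \<epsilon>_def flip: A_def)
        then show "\<bar>F (x + v) - F x - (\<Sum>b\<in>Basis. q b *\<^sub>R b) \<bullet> v\<bar> \<le> \<epsilon>0 * norm v"
          using main[OF v finite_Basis order_refl]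
          by (simp add: euclidean_representation inner_sum_left inner_commute[of v])
             (simp add: inner_commute[of _ v] euclidean_representation)
      qed
    qed
  qed
qed

section \<open>The area formula\<close>

text \<open>By Cauchy-Binet, the Jacobian of \<open>x \<mapsto> (x', W x, h x)\<close> with gradients \<open>w\<close> and \<open>h\<close>: the
  entries are the \<open>n \<times> n\<close> minors.\<close>

definition graph_jacobian :: "'b::euclidean_space \<times> real \<Rightarrow> 'b \<times> real \<Rightarrow> real" where
  "graph_jacobian w h = sqrt ((snd w)\<^sup>2 + (snd h)\<^sup>2 + (norm (snd w *\<^sub>R fst h - snd h *\<^sub>R fst w))\<^sup>2)"

definition graph_linear :: "'b::euclidean_space \<times> real \<Rightarrow> 'b \<times> real \<Rightarrow> 'b \<times> real \<Rightarrow> 'b \<times> real \<times> real" where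
  "graph_linear w h v = (fst v, w \<bullet> v, h \<bullet> v)"

text \<open>Rotating the last two coordinates makes the image of the vertical direction a multiple \<open>\<rho>\<close> of the
  first of them; the remaining map \<open>v' \<mapsto> (v', d \<bullet> v')\<close> has the same norm as \<open>v' + \<kappa> (d \<bullet> v') d\<close> if
  \<open>(1 + \<kappa> |d|\<^sup>2)\<^sup>2 = 1 + |d|\<^sup>2\<close>. Both factors are rank-one perturbations of the identity.\<close>

lemma graph_linear_isometric_model:
  fixes w h :: "'b::euclidean_space \<times> real"
  assumes "snd w \<noteq> 0"
  obtains S where "linear S" "\<And>v. norm (S v) = norm (graph_linear w h v)"
    "\<And>G :: 'b \<times> real \<Rightarrow> ennreal. G \<in> borel_measurable borel \<Longrightarrow>
       (\<integral>\<^sup>+x. G (S x) \<partial>lborel) = ennreal (1 / graph_jacobian w h) * (\<integral>\<^sup>+x. G x \<partial>lborel)"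
proof -
  obtain a \<alpha> where w: "w = (a, \<alpha>)" by (cases w)
  obtain b \<beta> where h: "h = (b, \<beta>)" by (cases h)
  have \<alpha>: "\<alpha> \<noteq> 0" using assms by (simp add: w)
  define \<rho> where "\<rho> = sqrt (\<alpha>\<^sup>2 + \<beta>\<^sup>2)"
  have \<rho>: "0 < \<rho>" using \<alpha> by (simp add: \<rho>_def add_pos_nonneg)
  have \<rho>2: "\<rho>\<^sup>2 = \<alpha>\<^sup>2 + \<beta>\<^sup>2" by (simp add: \<rho>_def)
  define e where "e = (\<alpha> *\<^sub>R a + \<beta> *\<^sub>R b) /\<^sub>R \<rho>"
  define d where "d = (\<alpha> *\<^sub>R b - \<beta> *\<^sub>R a) /\<^sub>R \<rho>"
  define \<sigma> where "\<sigma> = sqrt (1 + (norm d)\<^sup>2)"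
  have \<sigma>: "1 \<le> \<sigma>" "\<sigma>\<^sup>2 = 1 + d \<bullet> d" by (auto simp: \<sigma>_def power2_norm_eq_inner)
  define \<kappa> where "\<kappa> = 1 / (1 + \<sigma>)"
  have \<kappa>: "1 + \<kappa> * (d \<bullet> d) = \<sigma>"
  proof -
    have "d \<bullet> d = (\<sigma> - 1) * (\<sigma> + 1)" using \<sigma>(2) by (simp add: algebra_simps power2_eq_square)
    then show ?thesis using \<sigma>(1) by (simp add: \<kappa>_def add.commute[of 1 \<sigma>])
  qed
  define R1 where "R1 v = v + (v \<bullet> (e, \<rho> - 1)) *\<^sub>R (0 :: 'b, 1 :: real)" for v
  define R2 where "R2 v = v + (v \<bullet> (\<kappa> *\<^sub>R d, 0 :: real)) *\<^sub>R (d, 0)" for v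
  have R12: "R2 (R1 v) = (fst v + (\<kappa> * (d \<bullet> fst v)) *\<^sub>R d, \<rho> * snd v + e \<bullet> fst v)" for v
    by (cases v) (simp add: R1_def R2_def algebra_simps inner_commute)
  show thesis
  proof (rule that[of "\<lambda>v. R2 (R1 v)"])
    show "linear (\<lambda>v. R2 (R1 v))"
      unfolding R12 by (rule linearI) (auto simp: algebra_simps inner_add_right)
    show "norm (R2 (R1 v)) = norm (graph_linear w h v)" for v
    proof -
      obtain v' vn where v: "v = (v', vn)" by (cases v)
      define A where "A = a \<bullet> v'"
      define B where "B = b \<bullet> v'"
      define D where "D = d \<bullet> v'"
      have D: "D = (\<alpha> * B - \<beta> * A) / \<rho>" and E: "e \<bullet> v' = (\<alpha> * A + \<beta> * B) / \<rho>"
        by (simp_all add: D_def d_def e_def A_def B_def inner_add_left inner_diff_left divide_inverse mult.commute)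
      have "(norm (v' + (\<kappa> * D) *\<^sub>R d))\<^sup>2 = (norm v')\<^sup>2 + D\<^sup>2 * (\<kappa> * (2 + \<kappa> * (d \<bullet> d)))"
        unfolding power2_norm_eq_inner
        by (simp add: inner_add_left inner_add_right D_def inner_commute[of v' d] power2_eq_square algebra_simps)
      also have "\<kappa> * (2 + \<kappa> * (d \<bullet> d)) = 1"
      proof -
        have "2 + \<kappa> * (d \<bullet> d) = 1 + \<sigma>" using \<kappa> by simp
        then show ?thesis using \<sigma>(1) by (simp add: \<kappa>_def)
      qed
      finally have 1: "(norm (v' + (\<kappa> * D) *\<^sub>R d))\<^sup>2 = (norm v')\<^sup>2 + D\<^sup>2" by simp
      have 2: "D\<^sup>2 + (\<rho> * vn + e \<bullet> v')\<^sup>2 = (A + \<alpha> * vn)\<^sup>2 + (B + \<beta> * vn)\<^sup>2"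
      proof -
        have "\<rho>\<^sup>2 * (D\<^sup>2 + (\<rho> * vn + e \<bullet> v')\<^sup>2) = (\<rho> * D)\<^sup>2 + (\<rho>\<^sup>2 * vn + \<rho> * (e \<bullet> v'))\<^sup>2"
          by (simp add: power2_eq_square algebra_simps)
        also have "\<rho> * D = \<alpha> * B - \<beta> * A" using \<rho> by (simp add: D)
        also have "\<rho> * (e \<bullet> v') = \<alpha> * A + \<beta> * B" using \<rho> by (simp add: E)
        also have "(\<alpha> * B - \<beta> * A)\<^sup>2 + (\<rho>\<^sup>2 * vn + (\<alpha> * A + \<beta> * B))\<^sup>2 =
            \<rho>\<^sup>2 * ((A + \<alpha> * vn)\<^sup>2 + (B + \<beta> * vn)\<^sup>2)"
          unfolding \<rho>2 by (simp add: power2_eq_square algebra_simps)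
        finally show ?thesis using \<rho> by simp
      qed
      have "(norm (R2 (R1 v)))\<^sup>2 = (norm (graph_linear w h v))\<^sup>2"
        unfolding R12 graph_linear_def norm_Pair v w h using 1 2
        by (simp add: D_def A_def B_def)
      then show ?thesis by (simp add: power2_eq_iff_nonneg)
    qed
    fix G :: "'b \<times> real \<Rightarrow> ennreal" assume [measurable]: "G \<in> borel_measurable borel"
    have "(\<integral>\<^sup>+x. G (R2 (R1 x)) \<partial>lborel) = ennreal (1 / \<bar>1 + (e, \<rho> - 1) \<bullet> (0 :: 'b, 1 :: real)\<bar>) * (\<integral>\<^sup>+x. G (R2 x) \<partial>lborel)"
      unfolding R1_def by (rule nn_integral_rank_one[where G="\<lambda>x. G (R2 x)"]) (use \<rho> in \<open>auto simp: R2_def\<close>)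
    also have "(\<integral>\<^sup>+x. G (R2 x) \<partial>lborel) = ennreal (1 / \<bar>1 + (\<kappa> *\<^sub>R d, 0 :: real) \<bullet> (d, 0)\<bar>) * (\<integral>\<^sup>+x. G x \<partial>lborel)"
      unfolding R2_def by (rule nn_integral_rank_one) (use \<kappa> \<sigma> in auto)
    also have "1 + (\<kappa> *\<^sub>R d, 0 :: real) \<bullet> (d, 0) = \<sigma>" using \<kappa> by simp
    also have "1 + (e, \<rho> - 1) \<bullet> (0 :: 'b, 1 :: real) = \<rho>" by simp
    also have "ennreal (1 / \<bar>\<rho>\<bar>) * (ennreal (1 / \<bar>\<sigma>\<bar>) * (\<integral>\<^sup>+x. G x \<partial>lborel)) = ennreal (1 / (\<rho> * \<sigma>)) * (\<integral>\<^sup>+x. G x \<partial>lborel)"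
      using \<rho> \<sigma> by (simp add: mult.assoc[symmetric] flip: ennreal_mult')
    also have "\<rho> * \<sigma> = graph_jacobian w h"
    proof -
      have "(norm (\<alpha> *\<^sub>R b - \<beta> *\<^sub>R a))\<^sup>2 = \<rho>\<^sup>2 * (norm d)\<^sup>2"
        using \<rho> by (simp add: d_def power_mult_distrib power_inverse)
      then show ?thesis
        using \<rho> unfolding graph_jacobian_def w h \<sigma>_def \<rho>_def real_sqrt_mult[symmetric]
        by (simp add: \<rho>2[unfolded \<rho>_def] algebra_simps)
    qed
    finally show "(\<integral>\<^sup>+x. G (R2 (R1 x)) \<partial>lborel) = ennreal (1 / graph_jacobian w h) * (\<integral>\<^sup>+x. G x \<partial>lborel)" .
  qed
qed

text \<open>Write \<open>T\<close> for the norm of the image. Then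
  \<open>norm (fst v) \<le> T\<close>, and \<open>1 / 4 \<le> snd w\<close> recovers
  \<open>\<bar>snd v\<bar> \<le> 4 * (1 + M) * T\<close> from \<open>w \<bullet> v\<close>. The
  estimate turns errors relative to \<open>norm v\<close> into errors relative to the linear
  image.\<close>

lemma norm_le_graph_linear:
  assumes "norm w \<le> M" "1 / 4 \<le> snd w"
  shows "norm v \<le> (5 + 4 * M) * norm (graph_linear w h v)"
proof -
  let ?T = "norm (graph_linear w h v)"
  have f: "norm (fst v) \<le> ?T" using norm_fst_le[of "fst v" "(w \<bullet> v, h \<bullet> v)"] by (simp add: graph_linear_def)
  have "norm (w \<bullet> v, h \<bullet> v) \<le> ?T" using norm_snd_le[of "(w \<bullet> v, h \<bullet> v)" "fst v"] by (simp add: graph_linear_def)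
  moreover have "\<bar>w \<bullet> v\<bar> \<le> norm (w \<bullet> v, h \<bullet> v)" by (simp add: norm_Pair real_le_rsqrt)
  ultimately have g: "\<bar>w \<bullet> v\<bar> \<le> ?T" by linarith
  have "norm (fst w) \<le> M" using assms(1) norm_fst_le[of "fst w" "snd w"] by simp
  then have "\<bar>fst w \<bullet> fst v\<bar> \<le> M * ?T"
    using Cauchy_Schwarz_ineq2[of "fst w" "fst v"] f norm_ge_zero[of "fst w"]
    by (meson mult_mono norm_ge_zero order_trans)
  moreover have "w \<bullet> v = fst w \<bullet> fst v + snd w * snd v" by (simp add: inner_prod_def)
  ultimately have "\<bar>snd w * snd v\<bar> \<le> (1 + M) * ?T" using g by (simp add: algebra_simps)
  moreover have "1 / 4 * \<bar>snd v\<bar> \<le> \<bar>snd w * snd v\<bar>" unfolding abs_mult using assms(2) by (intro mult_right_mono) auto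
  ultimately have "\<bar>snd v\<bar> \<le> 4 * ((1 + M) * ?T)" by linarith
  moreover have "norm v \<le> norm (fst v) + \<bar>snd v\<bar>"
    using norm_Pair_le[of "fst v" "snd v"] by simp
  ultimately show ?thesis using f by (simp add: algebra_simps)
qed

text \<open>The linear map takes values in \<open>(n+1)\<close>-space, so \<Phi> is compared with
  the isometric model \<open>S\<close> into \<open>n\<close>-space: \<Phi> after the inverse of
  \<open>S\<close> has Lipschitz constant \<open>1 + \<eta>\<close>, and its inverse
  \<open>1 / (1 - \<eta>)\<close>. On \<open>n\<close>-space Hausdorff and Lebesgue measure agree,
  and \<open>S\<close> scales volume by the Jacobian.\<close>

lemma area_of_nearly_linear_piece:
  fixes \<Phi> :: "'b::euclidean_space \<times> real \<Rightarrow> 'b \<times> real \<times> real"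
  assumes A: "A \<in> sets borel" and w: "snd w \<noteq> 0" and \<eta>: "0 \<le> \<eta>" "\<eta> < 1"
    and near: "\<And>x y. x \<in> A \<Longrightarrow> y \<in> A \<Longrightarrow>
      norm (\<Phi> y - \<Phi> x - graph_linear w h (y - x)) \<le> \<eta> * norm (graph_linear w h (y - x))"
  shows "hausdorff_measure DIM('b \<times> real) (\<Phi> ` A) \<le>
      ennreal ((1 + \<eta>) ^ DIM('b \<times> real) * graph_jacobian w h) * emeasure lborel A"
    and "ennreal ((1 - \<eta>) ^ DIM('b \<times> real) * graph_jacobian w h) * emeasure lborel A \<le>
      hausdorff_measure DIM('b \<times> real) (\<Phi> ` A)"
proof -
  let ?n = "DIM('b \<times> real)" and ?J = "graph_jacobian w h"
  obtain S where S: "linear S" "\<And>v. norm (S v) = norm (graph_linear w h v)"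
    "\<And>G :: 'b \<times> real \<Rightarrow> ennreal. G \<in> borel_measurable borel \<Longrightarrow>
       (\<integral>\<^sup>+x. G (S x) \<partial>lborel) = ennreal (1 / ?J) * (\<integral>\<^sup>+x. G x \<partial>lborel)"
    by (rule graph_linear_isometric_model[OF w, of h]) (rule that)
  have J: "0 < ?J" using w by (simp add: graph_jacobian_def add_pos_nonneg)
  have "inj S"
  proof (subst linear_injective_0[OF S(1)], intro allI impI)
    fix v assume "S v = 0"
    then have "graph_linear w h v = 0" using S(2)[of v] by simp
    then show "v = 0" using w by (cases v; cases w) (auto simp: graph_linear_def zero_prod_def)
  qed
  then obtain S' where S': "linear S'" "\<And>x. S' (S x) = x" "\<And>x. S (S' x) = x"
    using linear_injective_isomorphism[OF S(1)] by blast
  have [measurable]: "S' \<in> borel_measurable borel" "S \<in> borel_measurable borel"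
    using S' S by (auto intro!: borel_measurable_continuous_onI linear_continuous_on simp: linear_conv_bounded_linear)
  have SA: "S ` A = S' -` A \<inter> space borel" using S' by (auto simp: image_iff) metis
  then have SAb: "S ` A \<in> sets borel" using measurable_sets[OF _ A, of S' borel] by simp
  have "emeasure lborel A = (\<integral>\<^sup>+x. indicator (S ` A) (S x) \<partial>lborel)"
    using A inj_image_mem_iff[OF \<open>inj S\<close>] by (simp add: indicator_def flip: nn_integral_indicator)
  also have "\<dots> = ennreal (1 / ?J) * emeasure lborel (S ` A)"
    using SAb by (subst S(3)) auto
  finally have "ennreal ?J * emeasure lborel A = (ennreal ?J * ennreal (1 / ?J)) * emeasure lborel (S ` A)"
    by (simp only: mult.assoc)
  also have "ennreal ?J * ennreal (1 / ?J) = 1" using J by (simp flip: ennreal_mult')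
  finally have LS: "emeasure lborel (S ` A) = ennreal ?J * emeasure lborel A" by simp
  have near': "norm (\<Phi> y - \<Phi> x) \<le> (1 + \<eta>) * norm (S y - S x)"
    "(1 - \<eta>) * norm (S y - S x) \<le> norm (\<Phi> y - \<Phi> x)" if "x \<in> A" "y \<in> A" for x y
  proof -
    have eq: "norm (S y - S x) = norm (graph_linear w h (y - x))"
      using S(2)[of "y - x"] linear_diff[OF S(1)] by simp
    show "norm (\<Phi> y - \<Phi> x) \<le> (1 + \<eta>) * norm (S y - S x)"
      "(1 - \<eta>) * norm (S y - S x) \<le> norm (\<Phi> y - \<Phi> x)"
      unfolding eq using near[OF that]
        norm_triangle_sub[of "\<Phi> y - \<Phi> x" "graph_linear w h (y - x)"]
        norm_triangle_sub[of "graph_linear w h (y - x)" "\<Phi> y - \<Phi> x"]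
      by (simp_all add: algebra_simps norm_minus_commute)
  qed
  have "(1 + \<eta>)-lipschitz_on (S ` A) (\<Phi> \<circ> S')"
    using near'(1) \<eta> by (intro lipschitz_onI) (auto simp: dist_norm S')
  then have "hausdorff_measure ?n ((\<Phi> \<circ> S') ` (S ` A)) \<le> ennreal ((1 + \<eta>) ^ ?n) * hausdorff_measure ?n (S ` A)"
    using \<eta> by (intro hausdorff_measure_lipschitz_image) auto
  also have "\<dots> \<le> ennreal ((1 + \<eta>) ^ ?n) * (ennreal ?J * emeasure lborel A)"
    using hausdorff_measure_le_lborel[OF SAb] LS by (intro mult_left_mono) auto
  also have "(\<Phi> \<circ> S') ` (S ` A) = \<Phi> ` A" by (simp add: image_image S')
  finally show "hausdorff_measure ?n (\<Phi> ` A) \<le> ennreal ((1 + \<eta>) ^ ?n * ?J) * emeasure lborel A"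
    using \<eta> J by (simp add: ennreal_mult mult.assoc)
  have inj: "inj_on \<Phi> A"
  proof (rule inj_onI)
    fix x y assume xy: "x \<in> A" "y \<in> A" "\<Phi> x = \<Phi> y"
    then have "(1 - \<eta>) * norm (S y - S x) \<le> 0" using near'(2)[of x y] by simp
    then have "S y = S x" using \<eta> by (simp add: mult_le_0_iff)
    then show "x = y" using \<open>inj S\<close> by (simp add: inj_eq)
  qed
  have "(1 / (1 - \<eta>))-lipschitz_on (\<Phi> ` A) (S \<circ> inv_into A \<Phi>)"
    using near'(2) \<eta> inj by (intro lipschitz_onI) (auto simp: dist_norm field_simps)
  then have "hausdorff_measure ?n ((S \<circ> inv_into A \<Phi>) ` (\<Phi> ` A)) \<le> ennreal ((1 / (1 - \<eta>)) ^ ?n) * hausdorff_measure ?n (\<Phi> ` A)"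
    using \<eta> by (intro hausdorff_measure_lipschitz_image) auto
  moreover have "(S \<circ> inv_into A \<Phi>) ` (\<Phi> ` A) = S ` A"
    using inj by (auto simp: image_image)
  moreover have "emeasure lborel (S ` A) \<le> hausdorff_measure ?n (S ` A)"
    by (rule lborel_le_hausdorff_measure)
  ultimately have "ennreal ?J * emeasure lborel A \<le> ennreal ((1 / (1 - \<eta>)) ^ ?n) * hausdorff_measure ?n (\<Phi> ` A)"
    using LS by simp
  then have "ennreal ((1 - \<eta>) ^ ?n) * (ennreal ?J * emeasure lborel A) \<le>
      ennreal ((1 - \<eta>) ^ ?n) * (ennreal ((1 / (1 - \<eta>)) ^ ?n) * hausdorff_measure ?n (\<Phi> ` A))"
    by (intro mult_left_mono) auto
  also have "\<dots> = ennreal ((1 - \<eta>) ^ ?n * (1 / (1 - \<eta>)) ^ ?n) * hausdorff_measure ?n (\<Phi> ` A)"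
    using \<eta> by (subst ennreal_mult) (auto simp: mult.assoc)
  also have "(1 - \<eta>) ^ ?n * (1 / (1 - \<eta>)) ^ ?n = 1" using \<eta> by (simp flip: power_mult_distrib)
  finally show "ennreal ((1 - \<eta>) ^ ?n * ?J) * emeasure lborel A \<le> hausdorff_measure ?n (\<Phi> ` A)"
    using \<eta> J by (simp add: ennreal_mult mult.assoc)
qed

section \<open>Cutting the domain into nearly linear pieces\<close>

definition gradient_approx :: "('a::euclidean_space \<Rightarrow> real) \<Rightarrow> real \<Rightarrow> 'a \<Rightarrow> real \<Rightarrow> 'a set" where
  "gradient_approx F \<epsilon> q \<delta> = {x. \<forall>y. dist y x < \<delta> \<longrightarrow> \<bar>F y - F x - q \<bullet> (y - x)\<bar> \<le> \<epsilon> * norm (y - x)}"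

lemma closed_gradient_approx:
  assumes "continuous_on UNIV F"
  shows "closed (gradient_approx F \<epsilon> q \<delta>)"
proof -
  have "closed ({x. \<delta> \<le> dist y x} \<union> {x. \<bar>F y - F x - q \<bullet> (y - x)\<bar> \<le> \<epsilon> * norm (y - x)})" for y
    by (intro closed_Un closed_Collect_le continuous_intros continuous_on_compose2[OF assms]) auto
  then have "closed (\<Inter>y. {x. \<delta> \<le> dist y x} \<union> {x. \<bar>F y - F x - q \<bullet> (y - x)\<bar> \<le> \<epsilon> * norm (y - x)})"
    by (intro closed_INT) auto
  moreover have "(\<Inter>y. {x. \<delta> \<le> dist y x} \<union> {x. \<bar>F y - F x - q \<bullet> (y - x)\<bar> \<le> \<epsilon> * norm (y - x)}) = gradient_approx F \<epsilon> q \<delta>"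
    by (auto simp: gradient_approx_def not_le[symmetric])
  ultimately show ?thesis by simp
qed

lemma gderiv_approx:
  assumes "GDERIV F x :> D" "0 < \<epsilon>"
  obtains \<delta> where "0 < \<delta>" "\<And>y. dist y x < \<delta> \<Longrightarrow> \<bar>F y - F x - D \<bullet> (y - x)\<bar> \<le> \<epsilon> * norm (y - x)"
proof -
  have "(F has_derivative (\<lambda>h. h \<bullet> D)) (at x)" using assms(1) by (simp add: gderiv_def)
  then obtain \<delta> where "0 < \<delta>" "\<forall>y. norm (y - x) < \<delta> \<longrightarrow> norm (F y - F x - (y - x) \<bullet> D) \<le> \<epsilon> * norm (y - x)"
    unfolding has_derivative_at_alt using assms(2) by blast
  then show ?thesis by (intro that[of \<delta>]) (auto simp: dist_norm inner_commute)
qed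

lemma gderiv_gradient_approx:
  assumes D: "GDERIV F x :> D" and x: "x \<in> gradient_approx F \<epsilon> q \<delta>" and \<delta>: "0 < \<delta>"
  shows "norm (D - q) \<le> \<epsilon>"
proof (rule field_le_epsilon)
  fix e :: real assume e: "0 < e"
  obtain \<delta>' where \<delta>': "0 < \<delta>'" "\<And>y. dist y x < \<delta>' \<Longrightarrow> \<bar>F y - F x - D \<bullet> (y - x)\<bar> \<le> e * norm (y - x)"
    by (rule gderiv_approx[OF D e]) (rule that)
  have "0 \<le> \<epsilon>"
  proof -
    obtain y where "y \<noteq> x" "dist y x < \<delta>" using perfect_choose_dist[OF \<delta>] by blast
    then have "0 \<le> \<epsilon> * norm (y - x)" "0 < norm (y - x)" using x by (auto simp: gradient_approx_def intro: order_trans)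
    then show ?thesis by (simp add: zero_le_mult_iff)
  qed
  have "\<bar>F (x + v) - F x - q \<bullet> v\<bar> \<le> \<epsilon> * norm v" if "norm v < \<delta>" for v
    using x[unfolded gradient_approx_def, simplified, rule_format, of "x + v"] that by (simp add: dist_norm)
  moreover have "\<bar>F (x + v) - F x - D \<bullet> v\<bar> \<le> e * norm v" if "norm v < \<delta>'" for v
    using \<delta>'(2)[of "x + v"] that by (simp add: dist_norm)
  ultimately have "norm (D - q) \<le> e + \<epsilon>"
    using \<delta> \<delta>'(1) \<open>0 \<le> \<epsilon>\<close> e
    by (intro linear_approximations_close[where \<delta> = "min \<delta> \<delta>'" and F = F and x = x]) auto
  then show "norm (D - q) \<le> \<epsilon> + e" by (simp only: add.commute)
qed

text \<open>Being \<open>M\<close>-Lipschitz means being approximated with error \<open>M\<close> by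
  the slope \<open>0\<close>.\<close>

lemma norm_gderiv_lipschitz_le:
  fixes F :: "'a::euclidean_space \<Rightarrow> real"
  assumes F: "M-lipschitz_on UNIV F" and D: "GDERIV F x :> D"
  shows "norm D \<le> M"
proof -
  have "x \<in> gradient_approx F M 0 1"
    using lipschitz_onD[OF F] by (auto simp: gradient_approx_def dist_norm)
  from gderiv_gradient_approx[OF D this] show ?thesis by simp
qed

lemma nearly_linear_partition:
  fixes W h :: "'a::euclidean_space \<Rightarrow> real"
  assumes cont: "continuous_on UNIV W" "continuous_on UNIV h" and \<epsilon>: "0 < \<epsilon>"
  obtains P :: "nat \<Rightarrow> 'a set" and p q :: "nat \<Rightarrow> 'a" where
    "\<And>i. P i \<in> sets borel" "disjoint_family P"
    "\<And>x D D'. GDERIV W x :> D \<Longrightarrow> GDERIV h x :> D' \<Longrightarrow> x \<in> (\<Union>i. P i)"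
    "\<And>i x y. x \<in> P i \<Longrightarrow> y \<in> P i \<Longrightarrow> \<bar>W y - W x - p i \<bullet> (y - x)\<bar> \<le> \<epsilon> * norm (y - x)"
    "\<And>i x y. x \<in> P i \<Longrightarrow> y \<in> P i \<Longrightarrow> \<bar>h y - h x - q i \<bullet> (y - x)\<bar> \<le> \<epsilon> * norm (y - x)"
    "\<And>i x D. x \<in> P i \<Longrightarrow> GDERIV W x :> D \<Longrightarrow> norm (D - p i) \<le> \<epsilon>"
    "\<And>i x D. x \<in> P i \<Longrightarrow> GDERIV h x :> D \<Longrightarrow> norm (D - q i) \<le> \<epsilon>"
proof -
  obtain Q :: "'a set" where Q: "countable Q" "\<And>X. open X \<Longrightarrow> X \<noteq> {} \<Longrightarrow> \<exists>d\<in>Q. d \<in> X"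
    using countable_dense_exists by blast
  have dense: "\<exists>d\<in>Q. dist x d < e" if "0 < e" for x e
    using Q(2)[of "ball x e"] that by auto
  define I where "I = Q \<times> Q \<times> (UNIV :: nat set) \<times> Q"
  have "countable I" unfolding I_def using Q(1) by auto
  have "Q \<noteq> {}" using dense[of 1] by auto
  then have "I \<noteq> {}" by (auto simp: I_def)
  \<comment> \<open>Each piece fixes two slopes from a dense set and a radius
    \<open>1 / Suc m\<close> on which both approximations hold. The ball of half that radius puts
    any two points of the piece within the radius of each other.\<close>
  define R where "R = (\<lambda>(q1, q2, m :: nat, z). gradient_approx W \<epsilon> q1 (inverse (Suc m)) \<inter>
      gradient_approx h \<epsilon> q2 (inverse (Suc m)) \<inter> ball z (inverse (Suc m) / 2))"
  define J where "J = from_nat_into I"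
  define P where "P = disjointed (\<lambda>i. R (J i))"
  have PR: "P i \<subseteq> R (J i)" for i unfolding P_def by (rule disjointed_subset)
  have Rb: "R i \<in> sets borel" for i
    by (cases i) (simp add: R_def sets.Int borel_closed closed_gradient_approx cont)
  have diam: "dist y x < inverse (Suc m)" if "x \<in> R (q1, q2, m, z)" "y \<in> R (q1, q2, m, z)" for x y q1 q2 m z
  proof -
    have "dist z x < inverse (Suc m) / 2" "dist z y < inverse (Suc m) / 2" using that by (auto simp: R_def)
    then show ?thesis using dist_triangle[of y x z] by (simp add: dist_commute)
  qed
  show thesis
  proof (rule that[of P "\<lambda>i. fst (J i)" "\<lambda>i. fst (snd (J i))"])
    show "P i \<in> sets borel" for i
    proof -
      have "range (\<lambda>i. R (J i)) \<subseteq> sets borel" using Rb by blast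
      from sets.range_disjointed_sets[OF this] show ?thesis unfolding P_def by blast
    qed
    show "disjoint_family P" unfolding P_def by (rule disjoint_family_disjointed)
    show "x \<in> (\<Union>i. P i)" if D: "GDERIV W x :> D" and D': "GDERIV h x :> D'" for x D D'
    proof -
      have e2: "0 < \<epsilon> / 2" using \<epsilon> by simp
      have *: "\<exists>q\<in>Q. \<exists>d>0. \<forall>\<delta>\<le>d. x \<in> gradient_approx F \<epsilon> q \<delta>" if D: "GDERIV F x :> D" for F D
      proof -
        obtain d where d: "0 < d" "\<And>y. dist y x < d \<Longrightarrow> \<bar>F y - F x - D \<bullet> (y - x)\<bar> \<le> \<epsilon> / 2 * norm (y - x)"
          by (rule gderiv_approx[OF D e2]) (rule that)
        obtain q where q: "q \<in> Q" "dist D q < \<epsilon> / 2" using dense[OF e2] by blast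
        have "\<bar>F y - F x - q \<bullet> (y - x)\<bar> \<le> \<epsilon> * norm (y - x)" if "dist y x < d" for y
        proof -
          have "\<bar>(D - q) \<bullet> (y - x)\<bar> \<le> norm (D - q) * norm (y - x)" by (rule Cauchy_Schwarz_ineq2)
          also have "\<dots> \<le> \<epsilon> / 2 * norm (y - x)" using q(2) by (intro mult_right_mono) (auto simp: dist_norm)
          finally show ?thesis using d(2)[OF that] unfolding inner_diff_left by linarith
        qed
        then show ?thesis using q(1) d(1) unfolding gradient_approx_def by (intro bexI[of _ q] exI[of _ d]) auto
      qed
      obtain q1 d1 where 1: "q1 \<in> Q" "0 < d1" "\<And>\<delta>. \<delta> \<le> d1 \<Longrightarrow> x \<in> gradient_approx W \<epsilon> q1 \<delta>"
        using *[OF D] by blast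
      obtain q2 d2 where 2: "q2 \<in> Q" "0 < d2" "\<And>\<delta>. \<delta> \<le> d2 \<Longrightarrow> x \<in> gradient_approx h \<epsilon> q2 \<delta>"
        using *[OF D'] by blast
      have "0 < min d1 d2" using 1 2 by simp
      then obtain m where m: "inverse (real (Suc m)) < min d1 d2" using reals_Archimedean by blast
      obtain z where z: "z \<in> Q" "dist x z < inverse (real (Suc m)) / 2"
        using dense[of "inverse (real (Suc m)) / 2" x] by auto
      have "(q1, q2, m, z) \<in> I" using 1 2 z by (auto simp: I_def)
      then obtain i where i: "J i = (q1, q2, m, z)"
        unfolding J_def using \<open>countable I\<close> by (metis from_nat_into_to_nat_on)
      have "x \<in> R (J i)" unfolding i R_def using 1(3) 2(3) m z by (auto simp: dist_commute)
      then have "x \<in> (\<Union>i. R (J i))" by blast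
      then show ?thesis unfolding P_def UN_disjointed_eq .
    qed
    fix i
    obtain q1 q2 m z where J: "J i = (q1, q2, m, z)" by (cases "J i") auto
    have PJ: "x \<in> R (q1, q2, m, z)" if "x \<in> P i" for x using PR[of i] that J by auto
    show "\<bar>W y - W x - fst (J i) \<bullet> (y - x)\<bar> \<le> \<epsilon> * norm (y - x)" if "x \<in> P i" "y \<in> P i" for x y
      using PJ[OF that(1)] diam[OF PJ[OF that(1)] PJ[OF that(2)]]
      unfolding J R_def by (auto simp: gradient_approx_def)
    show "\<bar>h y - h x - fst (snd (J i)) \<bullet> (y - x)\<bar> \<le> \<epsilon> * norm (y - x)" if "x \<in> P i" "y \<in> P i" for x y
      using PJ[OF that(1)] diam[OF PJ[OF that(1)] PJ[OF that(2)]]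
      unfolding J R_def by (auto simp: gradient_approx_def)
    show "norm (D - fst (J i)) \<le> \<epsilon>" if "x \<in> P i" "GDERIV W x :> D" for x D
      using PJ[OF that(1)] unfolding J
      by (intro gderiv_gradient_approx[OF that(2), where \<delta> = "inverse (Suc m)"]) (auto simp: R_def)
    show "norm (D - fst (snd (J i))) \<le> \<epsilon>" if "x \<in> P i" "GDERIV h x :> D" for x D
      using PJ[OF that(1)] unfolding J
      by (intro gderiv_gradient_approx[OF that(2), where \<delta> = "inverse (Suc m)"]) (auto simp: R_def)
  qed
qed

text \<open>The sets are exhausted from inside by compact sets. Their images are compact, and
  disjoint by injectivity, so Hausdorff measure is superadditive on them.\<close>

lemma sum_lborel_le_hausdorff_measure_image:
  fixes \<Phi> :: "'a::euclidean_space \<Rightarrow> 'c::euclidean_space"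
  assumes E: "\<And>i. i \<in> I \<Longrightarrow> B i \<in> sets borel" "\<And>i. i \<in> I \<Longrightarrow> bounded (B i)" "\<And>i. i \<in> I \<Longrightarrow> B i \<subseteq> E"
    and I: "finite I" "disjoint_family_on B I"
    and c: "\<And>i. i \<in> I \<Longrightarrow> 0 \<le> c i"
    and \<Phi>: "continuous_on E \<Phi>" "inj_on \<Phi> E"
    and le: "\<And>i K. i \<in> I \<Longrightarrow> K \<in> sets borel \<Longrightarrow> K \<subseteq> B i \<Longrightarrow> ennreal (c i) * emeasure lborel K \<le> hausdorff_measure k (\<Phi> ` K)"
  shows "(\<Sum>i\<in>I. ennreal (c i) * emeasure lborel (B i)) \<le> hausdorff_measure k (\<Phi> ` E)"
proof (rule ennreal_le_epsilon)
  fix e :: real assume e: "0 < e"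
  \<comment> \<open>The total error is at most \<open>(\<Sum>i\<in>I. c i) * e'\<close>; the summand
    \<open>1\<close> keeps the divisor positive.\<close>
  define s where "s = (\<Sum>i\<in>I. c i) + 1"
  have s: "0 < s" using c by (simp add: s_def add_nonneg_pos sum_nonneg)
  define e' where "e' = e / s"
  have e': "0 < e'" using e s by (simp add: e'_def)
  have "\<exists>K. compact K \<and> K \<subseteq> B i \<and> emeasure lborel (B i) \<le> emeasure lborel K + ennreal e'" if i: "i \<in> I" for i
  proof -
    have "B i \<in> sets lebesgue" using E(1)[OF i] by simp
    then obtain K where K: "closed K" "K \<subseteq> B i" "B i - K \<in> lmeasurable" "emeasure lebesgue (B i - K) < ennreal e'"
      by (rule sets_lebesgue_inner_closed[OF _ e'])
    have "compact K" using K E(2)[OF i] by (meson bounded_subset compact_eq_bounded_closed)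
    have Bi: "B i - K \<in> sets borel" using E(1)[OF i] K(1) by auto
    have "emeasure lborel (B i) \<le> emeasure lborel K + emeasure lborel (B i - K)"
      using emeasure_subadditive[of K lborel "B i - K"] K(1,2) E(1)[OF i] Bi by (simp add: Un_absorb1)
    also have "\<dots> \<le> emeasure lborel K + ennreal e'" using K(4) Bi by (intro add_left_mono) simp
    finally show ?thesis using \<open>compact K\<close> K(2) by blast
  qed
  then obtain K where K: "\<And>i. i \<in> I \<Longrightarrow> compact (K i)" "\<And>i. i \<in> I \<Longrightarrow> K i \<subseteq> B i"
    "\<And>i. i \<in> I \<Longrightarrow> emeasure lborel (B i) \<le> emeasure lborel (K i) + ennreal e'" by metis
  have "(\<Sum>i\<in>I. ennreal (c i) * emeasure lborel (B i)) \<le> (\<Sum>i\<in>I. ennreal (c i) * (emeasure lborel (K i) + ennreal e'))"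
    by (intro sum_mono mult_left_mono K) auto
  also have "\<dots> = (\<Sum>i\<in>I. ennreal (c i) * emeasure lborel (K i)) + (\<Sum>i\<in>I. ennreal (c i) * ennreal e')"
    by (simp add: distrib_left sum.distrib)
  also have "(\<Sum>i\<in>I. ennreal (c i) * ennreal e') = ennreal ((\<Sum>i\<in>I. c i) * e')"
    using c e' by (simp add: sum_distrib_right flip: ennreal_mult)
  also have "\<dots> \<le> ennreal e"
  proof (rule ennreal_leI)
    have "(\<Sum>i\<in>I. c i) * e' \<le> s * e'" using e' by (intro mult_right_mono) (auto simp: s_def)
    then show "(\<Sum>i\<in>I. c i) * e' \<le> e" using s by (simp add: e'_def)
  qed
  also have "(\<Sum>i\<in>I. ennreal (c i) * emeasure lborel (K i)) \<le> (\<Sum>i\<in>I. hausdorff_measure k (\<Phi> ` K i))"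
    using K by (intro sum_mono le) (auto simp: borel_compact)
  also have "\<dots> \<le> hausdorff_measure k (\<Union>i\<in>I. \<Phi> ` K i)"
  proof (rule hausdorff_measure_UN_compact[OF I(1)])
    show "disjoint_family_on (\<lambda>i. \<Phi> ` K i) I"
      unfolding disjoint_family_on_def
    proof (intro ballI impI)
      fix i j assume ij: "i \<in> I" "j \<in> I" "i \<noteq> j"
      have "B i \<inter> B j = {}" using disjoint_family_onD[OF I(2) ij] .
      then have "K i \<inter> K j = {}" "K i \<subseteq> E" "K j \<subseteq> E"
        using K(2)[OF ij(1)] K(2)[OF ij(2)] E(3)[OF ij(1)] E(3)[OF ij(2)] by blast+
      then show "\<Phi> ` K i \<inter> \<Phi> ` K j = {}" using inj_on_image_Int[OF \<Phi>(2), of "K i" "K j"] by simp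
    qed
    fix i assume i: "i \<in> I"
    show "compact (\<Phi> ` K i)"
      using K(1,2)[OF i] E(3)[OF i] by (intro compact_continuous_image continuous_on_subset[OF \<Phi>(1)]) auto
  qed
  also have "\<dots> \<le> hausdorff_measure k (\<Phi> ` E)"
  proof (rule hausdorff_measure_mono)
    show "(\<Union>i\<in>I. \<Phi> ` K i) \<subseteq> \<Phi> ` E" using K(2) E(3) by blast
  qed
  finally show "(\<Sum>i\<in>I. ennreal (c i) * emeasure lborel (B i)) \<le> hausdorff_measure k (\<Phi> ` E) + ennreal e"
    by (simp add: add_mono)
qed

lemma continuous_graph_jacobian: "continuous_on UNIV (\<lambda>p. graph_jacobian (fst p) (snd p))"
  unfolding graph_jacobian_def by (intro continuous_intros)

lemma borel_measurable_graph_jacobian [measurable]: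
  assumes [measurable]: "f \<in> borel_measurable M" "g \<in> borel_measurable M"
  shows "(\<lambda>x. graph_jacobian (f x) (g x)) \<in> borel_measurable M"
proof -
  have "(\<lambda>x. (\<lambda>p. graph_jacobian (fst p) (snd p)) (f x, g x)) \<in> borel_measurable M"
    by (rule measurable_compose[OF _ borel_measurable_continuous_onI[OF continuous_graph_jacobian]])
       (simp add: borel_measurable_Pair)
  then show ?thesis by simp
qed

lemma graph_jacobian_nonneg [simp]: "0 \<le> graph_jacobian w h"
  by (simp add: graph_jacobian_def)

lemma graph_jacobian_bounded:
  obtains B where "\<And>w h. norm w \<le> M \<Longrightarrow> norm h \<le> M \<Longrightarrow> graph_jacobian w h \<le> B"
proof -
  let ?S = "(\<lambda>p. graph_jacobian (fst p) (snd p)) ` (cball 0 M \<times> cball (0 :: 'a \<times> real) M)"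
  have "compact ?S"
    by (intro compact_continuous_image continuous_on_subset[OF continuous_graph_jacobian] compact_Times compact_cball) auto
  from compact_imp_bounded[OF this] obtain B where B: "\<forall>y\<in>?S. norm y \<le> B"
    unfolding bounded_iff by (elim exE)
  have "graph_jacobian w h \<le> B" if "norm w \<le> M" "norm h \<le> M" for w h :: "'a \<times> real"
  proof -
    have "graph_jacobian w h \<in> ?S" by (rule image_eqI[of _ _ "(w, h)"]) (use that in auto)
    from bspec[OF B this] show ?thesis by simp
  qed
  then show ?thesis by (rule that)
qed

lemma graph_jacobian_uniformly_continuous:
  assumes "0 < \<eta>"
  obtains \<delta> where "0 < \<delta>" "\<And>w h w' h'. norm w \<le> M \<Longrightarrow> norm h \<le> M \<Longrightarrow> norm w' \<le> M \<Longrightarrow> norm h' \<le> M \<Longrightarrow>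
     norm (w' - w) < \<delta> \<Longrightarrow> norm (h' - h) < \<delta> \<Longrightarrow> \<bar>graph_jacobian w' h' - graph_jacobian w h\<bar> < \<eta>"
proof -
  let ?C = "cball 0 M \<times> cball (0 :: 'a \<times> real) M"
  have "uniformly_continuous_on ?C (\<lambda>p. graph_jacobian (fst p) (snd p))"
    by (intro compact_uniformly_continuous continuous_on_subset[OF continuous_graph_jacobian] compact_Times compact_cball) auto
  from this[unfolded uniformly_continuous_on_def, rule_format, OF assms]
  obtain \<delta> where \<delta>: "0 < \<delta>" "\<forall>p\<in>?C. \<forall>p'\<in>?C.
      dist p' p < \<delta> \<longrightarrow> dist (graph_jacobian (fst p') (snd p')) (graph_jacobian (fst p) (snd p)) < \<eta>"
    by (elim exE conjE)
  have "\<bar>graph_jacobian w' h' - graph_jacobian w h\<bar> < \<eta>"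
    if "norm w \<le> M" "norm h \<le> M" "norm w' \<le> M" "norm h' \<le> M" "norm (w' - w) < \<delta> / 2" "norm (h' - h) < \<delta> / 2"
    for w h w' h' :: "'a \<times> real"
  proof -
    have "dist (w', h') (w, h) < \<delta>"
      using norm_Pair_le[of "w' - w" "h' - h"] that by (simp add: dist_norm)
    then show ?thesis using \<delta>(2)[rule_format, of "(w, h)" "(w', h')"] that by (simp add: dist_real_def)
  qed
  then show ?thesis using \<delta>(1) by (intro that[of "\<delta> / 2"]) auto
qed

lemma lipschitz_graph_map:
  assumes W: "M-lipschitz_on UNIV W" and h: "M-lipschitz_on UNIV h"
  shows "(1 + 2 * M)-lipschitz_on UNIV (\<lambda>x :: 'b::euclidean_space \<times> real. (fst x, W x :: real, h x :: real))"
proof (rule lipschitz_onI)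
  fix x y :: "'b \<times> real"
  have "dist (fst x, W x, h x) (fst y, W y, h y) \<le> dist (fst x) (fst y) + (dist (W x) (W y) + dist (h x) (h y))"
    using norm_Pair_le[of "fst x - fst y" "(W x - W y, h x - h y)"] norm_Pair_le[of "W x - W y" "h x - h y"]
    by (simp add: dist_norm)
  also have "\<dots> \<le> dist x y + (M * dist x y + M * dist x y)"
    by (intro add_mono dist_fst_le lipschitz_onD[OF W] lipschitz_onD[OF h]) auto
  finally show "dist (fst x, W x, h x) (fst y, W y, h y) \<le> (1 + 2 * M) * dist x y" by (simp add: algebra_simps)
qed (use lipschitz_on_nonneg[OF W] in simp)

section \<open>The area formula for graph maps\<close>

context
  fixes W h :: "'b::euclidean_space \<times> real \<Rightarrow> real" and M :: real and E :: "('b \<times> real) set"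
    and gW gh :: "'b \<times> real \<Rightarrow> 'b \<times> real"
  assumes W: "M-lipschitz_on UNIV W" and h: "M-lipschitz_on UNIV h"
    and gW [measurable]: "gW \<in> borel_measurable borel" and gh [measurable]: "gh \<in> borel_measurable borel"
    and E [measurable]: "E \<in> sets borel" and bE: "bounded E"
    and ae: "AE x in lborel. x \<in> E \<longrightarrow> GDERIV W x :> gW x \<and> GDERIV h x :> gh x \<and> 1 / 2 \<le> snd (gW x)"
    and inj: "inj_on (\<lambda>x. (fst x, W x, h x)) E"
begin

text \<open>On a piece with frozen slopes \<open>p i\<close> and \<open>q i\<close>, \<eta> bounds
  both the distortion of the linear map and the oscillation of the Jacobian. The upper bound follows
  by countable subadditivity, the lower one from finite partial sums over the pieces.\<close>

lemma area_formula_graph_approx: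
  assumes \<eta>: "0 < \<eta>" "\<eta> < 1"
  shows "hausdorff_measure DIM('b \<times> real) ((\<lambda>x. (fst x, W x, h x)) ` E) \<le>
      ennreal ((1 + \<eta>) ^ DIM('b \<times> real)) * ((\<integral>\<^sup>+x\<in>E. ennreal (graph_jacobian (gW x) (gh x)) \<partial>lborel) + ennreal \<eta> * emeasure lborel E)" (is ?upper)
    and "ennreal ((1 - \<eta>) ^ DIM('b \<times> real)) * (\<integral>\<^sup>+x\<in>E. ennreal (graph_jacobian (gW x) (gh x)) \<partial>lborel) \<le>
      hausdorff_measure DIM('b \<times> real) ((\<lambda>x. (fst x, W x, h x)) ` E) + ennreal \<eta> * emeasure lborel E" (is ?lower)
proof -
  let ?\<Phi> = "\<lambda>x. (fst x, W x, h x)" and ?n = "DIM('b \<times> real)"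
  let ?j = "\<lambda>x. graph_jacobian (gW x) (gh x)"
  have M: "0 \<le> M" by (rule lipschitz_on_nonneg[OF W])
  have lip: "(1 + 2 * M)-lipschitz_on UNIV ?\<Phi>" by (rule lipschitz_graph_map[OF W h])
  obtain \<delta> where \<delta>: "0 < \<delta>" "\<And>w h w' h' :: 'b \<times> real. norm w \<le> M + 1 \<Longrightarrow> norm h \<le> M + 1 \<Longrightarrow> norm w' \<le> M + 1 \<Longrightarrow> norm h' \<le> M + 1 \<Longrightarrow>
     norm (w' - w) < \<delta> \<Longrightarrow> norm (h' - h) < \<delta> \<Longrightarrow> \<bar>graph_jacobian w' h' - graph_jacobian w h\<bar> < \<eta>"
    by (rule graph_jacobian_uniformly_continuous[OF \<eta>(1), of "M + 1"]) (rule that)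
  define c where "c = 5 + 4 * (M + 1)"
  have c: "0 < c" using M by (simp add: c_def)
  \<comment> \<open>\<open>1 / 4\<close> keeps \<open>snd (p i) \<ge> 1 / 4\<close> and the slopes
    within \<open>M + 1\<close>; \<open>\<eta> / (2 * c)\<close> makes the linearization error of
    both components together at most \<eta>; \<open>\<delta> / 2\<close> keeps the Jacobian within
    \<eta> of its frozen value.\<close>
  define \<epsilon> where "\<epsilon> = min (1 / 4) (min (\<eta> / (2 * c)) (\<delta> / 2))"
  have \<epsilon>: "0 < \<epsilon>" "\<epsilon> \<le> 1 / 4" "\<epsilon> < \<delta>" using \<delta> \<eta> c by (auto simp: \<epsilon>_def)
  have \<epsilon>c: "2 * \<epsilon> * c \<le> \<eta>"
  proof -
    have "\<epsilon> \<le> \<eta> / (2 * c)" by (simp add: \<epsilon>_def)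
    then show ?thesis using c by (simp add: field_simps)
  qed
  obtain P :: "nat \<Rightarrow> ('b \<times> real) set" and p q :: "nat \<Rightarrow> 'b \<times> real" where
    P: "\<And>i. P i \<in> sets borel" "disjoint_family P"
    "\<And>x D D'. GDERIV W x :> D \<Longrightarrow> GDERIV h x :> D' \<Longrightarrow> x \<in> (\<Union>i. P i)"
    "\<And>i x y. x \<in> P i \<Longrightarrow> y \<in> P i \<Longrightarrow> \<bar>W y - W x - p i \<bullet> (y - x)\<bar> \<le> \<epsilon> * norm (y - x)"
    "\<And>i x y. x \<in> P i \<Longrightarrow> y \<in> P i \<Longrightarrow> \<bar>h y - h x - q i \<bullet> (y - x)\<bar> \<le> \<epsilon> * norm (y - x)"
    "\<And>i x D. x \<in> P i \<Longrightarrow> GDERIV W x :> D \<Longrightarrow> norm (D - p i) \<le> \<epsilon>"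
    "\<And>i x D. x \<in> P i \<Longrightarrow> GDERIV h x :> D \<Longrightarrow> norm (D - q i) \<le> \<epsilon>"
    by (rule nearly_linear_partition[OF lipschitz_on_continuous_on[OF W] lipschitz_on_continuous_on[OF h] \<epsilon>(1)]) (rule that)
  obtain N where N: "\<And>x. x \<notin> N \<Longrightarrow> x \<in> E \<longrightarrow> GDERIV W x :> gW x \<and> GDERIV h x :> gh x \<and> 1 / 2 \<le> snd (gW x)"
      "N \<in> null_sets lborel"
    using AE_E3[OF ae] by auto
  have [measurable]: "N \<in> sets borel" using N(2) by auto
  define B where "B i = P i \<inter> E - N" for i
  have [measurable]: "B i \<in> sets borel" for i using P(1)[of i] by (simp add: B_def)
  have disj: "disjoint_family B" using P(2) by (auto simp: disjoint_family_on_def B_def)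
  have good: "GDERIV W x :> gW x" "GDERIV h x :> gh x" "1 / 2 \<le> snd (gW x)" if "x \<in> E - N" for x
    using N(1) that by auto
  have UB: "(\<Union>i. B i) = E - N"
  proof
    show "E - N \<subseteq> (\<Union>i. B i)"
    proof
      fix x assume x: "x \<in> E - N"
      then have "x \<in> (\<Union>i. P i)" using P(3) good by blast
      then show "x \<in> (\<Union>i. B i)" using x by (auto simp: B_def)
    qed
  qed (auto simp: B_def)
  have pq: "snd (p i) \<noteq> 0" "norm (p i) \<le> M + 1" "1 / 4 \<le> snd (p i)"
      "\<bar>?j x - graph_jacobian (p i) (q i)\<bar> < \<eta>" if x: "x \<in> B i" for x i
  proof -
    have g: "GDERIV W x :> gW x" "GDERIV h x :> gh x" "1 / 2 \<le> snd (gW x)" and xP: "x \<in> P i"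
      using good x by (auto simp: B_def)
    have n: "norm (gW x - p i) \<le> \<epsilon>" "norm (gh x - q i) \<le> \<epsilon>" using P(6)[OF xP g(1)] P(7)[OF xP g(2)] .
    have m: "norm (gW x) \<le> M" "norm (gh x) \<le> M"
      using norm_gderiv_lipschitz_le[OF W g(1)] norm_gderiv_lipschitz_le[OF h g(2)] .
    have pm: "norm (p i) \<le> M + 1" "norm (q i) \<le> M + 1"
      using n m \<epsilon> norm_triangle_sub[of "p i" "gW x"] norm_triangle_sub[of "q i" "gh x"]
      by (simp_all add: norm_minus_commute)
    have "norm (snd v) \<le> norm v" for v :: "'b \<times> real" using norm_snd_le[of "snd v" "fst v"] by simp
    from this[of "gW x - p i"] have "\<bar>snd (gW x) - snd (p i)\<bar> \<le> norm (gW x - p i)" by simp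
    then show "1 / 4 \<le> snd (p i)" using g(3) n \<epsilon> by linarith
    then show "snd (p i) \<noteq> 0" by simp
    show "norm (p i) \<le> M + 1" by fact
    show "\<bar>?j x - graph_jacobian (p i) (q i)\<bar> < \<eta>"
      using m n pm \<epsilon> by (intro \<delta>(2)) auto
  qed
  have near: "norm (?\<Phi> y - ?\<Phi> x - graph_linear (p i) (q i) (y - x)) \<le> \<eta> * norm (graph_linear (p i) (q i) (y - x))"
    if x: "x \<in> B i" and y: "y \<in> B i" for x y i
  proof -
    let ?T = "graph_linear (p i) (q i) (y - x)"
    have xy: "x \<in> P i" "y \<in> P i" using x y by (auto simp: B_def)
    have "norm (?\<Phi> y - ?\<Phi> x - ?T) \<le> \<bar>W y - W x - p i \<bullet> (y - x)\<bar> + \<bar>h y - h x - q i \<bullet> (y - x)\<bar>"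
      using norm_Pair_le[of "W y - W x - p i \<bullet> (y - x)" "h y - h x - q i \<bullet> (y - x)"]
      by (simp add: graph_linear_def)
    also have "\<dots> \<le> 2 * \<epsilon> * norm (y - x)" using P(4)[OF xy] P(5)[OF xy] by simp
    also have "\<dots> \<le> 2 * \<epsilon> * (c * norm ?T)"
      unfolding c_def using pq[OF x] \<epsilon> by (intro mult_left_mono norm_le_graph_linear) auto
    also have "\<dots> = (2 * \<epsilon> * c) * norm ?T" by simp
    also have "\<dots> \<le> \<eta> * norm ?T" using \<epsilon>c by (intro mult_right_mono) auto
    finally show ?thesis .
  qed
  have up: "hausdorff_measure ?n (?\<Phi> ` B i) \<le> ennreal ((1 + \<eta>) ^ ?n) * (\<integral>\<^sup>+x. ennreal (?j x + \<eta>) * indicator (B i) x \<partial>lborel)" for i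
  proof (cases "B i = {}")
    case False
    then obtain x where x: "x \<in> B i" by blast
    have "hausdorff_measure ?n (?\<Phi> ` B i) \<le> ennreal ((1 + \<eta>) ^ ?n * graph_jacobian (p i) (q i)) * emeasure lborel (B i)"
      using \<eta> by (intro area_of_nearly_linear_piece(1) pq(1)[OF x] near) auto
    also have "\<dots> = ennreal ((1 + \<eta>) ^ ?n) * (\<integral>\<^sup>+x. ennreal (graph_jacobian (p i) (q i)) * indicator (B i) x \<partial>lborel)"
      using \<eta> by (subst nn_integral_cmult_indicator) (auto simp: ennreal_mult mult.assoc)
    also have "\<dots> \<le> ennreal ((1 + \<eta>) ^ ?n) * (\<integral>\<^sup>+x. ennreal (?j x + \<eta>) * indicator (B i) x \<partial>lborel)"
    proof (intro mult_left_mono nn_integral_mono)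
      show "ennreal (graph_jacobian (p i) (q i)) * indicator (B i) x \<le> ennreal (?j x + \<eta>) * indicator (B i) x" for x
        using pq(4)[of x i] by (auto split: split_indicator intro!: ennreal_leI)
    qed simp
    finally show ?thesis .
  qed simp
  have sumj: "(\<Sum>i. \<integral>\<^sup>+x. f x * indicator (B i) x \<partial>lborel) = (\<integral>\<^sup>+x. f x * indicator (E - N) x \<partial>lborel)"
    if [measurable]: "f \<in> borel_measurable borel" for f :: "_ \<Rightarrow> ennreal"
    unfolding UB[symmetric] by (rule nn_integral_disjoint_family[symmetric]) (use disj in auto)
  have EN: "(\<integral>\<^sup>+x. f x * indicator (E - N) x \<partial>lborel) = (\<integral>\<^sup>+x. f x * indicator E x \<partial>lborel)" for f :: "_ \<Rightarrow> ennreal"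
    by (rule nn_integral_cong_AE) (use AE_not_in[OF N(2)] in \<open>auto elim!: eventually_mono split: split_indicator\<close>)
  have plus: "(\<integral>\<^sup>+x. ennreal (?j x + \<eta>) * indicator E x \<partial>lborel) = (\<integral>\<^sup>+x\<in>E. ennreal (?j x) \<partial>lborel) + ennreal \<eta> * emeasure lborel E"
  proof -
    have "(\<integral>\<^sup>+x. ennreal (?j x + \<eta>) * indicator E x \<partial>lborel) = (\<integral>\<^sup>+x. ennreal (?j x) * indicator E x + ennreal \<eta> * indicator E x \<partial>lborel)"
      using \<eta> by (intro nn_integral_cong) (auto split: split_indicator)
    also have "\<dots> = (\<integral>\<^sup>+x\<in>E. ennreal (?j x) \<partial>lborel) + (\<integral>\<^sup>+x. ennreal \<eta> * indicator E x \<partial>lborel)"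
      by (rule nn_integral_add) auto
    also have "(\<integral>\<^sup>+x. ennreal \<eta> * indicator E x \<partial>lborel) = ennreal \<eta> * emeasure lborel E"
      by (rule nn_integral_cmult_indicator) simp
    finally show ?thesis .
  qed
  show ?upper
  proof -
    \<comment> \<open>The exceptional set has an image of measure \<open>0\<close>, since the map is
      Lipschitz and null sets of \<open>n\<close>-space have Hausdorff measure
      \<open>0\<close>.\<close>
    have neg: "negligible (E \<inter> N)"
      using N(2) by (metis inf_commute negligible_Int negligible_iff_null_sets null_sets_completionI)
    have "hausdorff_measure ?n (?\<Phi> ` (E \<inter> N)) \<le> ennreal ((1 + 2 * M) ^ ?n) * hausdorff_measure ?n (E \<inter> N)"
      using M by (intro hausdorff_measure_lipschitz_image lipschitz_on_subset[OF lip]) auto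
    also have "\<dots> = 0" using hausdorff_measure_negligible[OF neg] by simp
    finally have 0: "hausdorff_measure ?n (?\<Phi> ` (E \<inter> N)) = 0" by simp
    have "E \<inter> N \<union> (\<Union>i. B i) = E" unfolding UB by blast
    moreover have "?\<Phi> ` (E \<inter> N \<union> (\<Union>i. B i)) = ?\<Phi> ` (E \<inter> N) \<union> (\<Union>i. ?\<Phi> ` B i)"
      by (simp only: image_Un image_UN)
    ultimately have "?\<Phi> ` E = ?\<Phi> ` (E \<inter> N) \<union> (\<Union>i. ?\<Phi> ` B i)"
      by simp
    then have "hausdorff_measure ?n (?\<Phi> ` E) \<le> hausdorff_measure ?n (?\<Phi> ` (E \<inter> N)) + hausdorff_measure ?n (\<Union>i. ?\<Phi> ` B i)"
      using hausdorff_measure_Un_le by simp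
    also have "\<dots> = hausdorff_measure ?n (\<Union>i. ?\<Phi> ` B i)" using 0 by simp
    also have "\<dots> \<le> (\<Sum>i. hausdorff_measure ?n (?\<Phi> ` B i))" by (rule hausdorff_measure_UN_le)
    also have "\<dots> \<le> (\<Sum>i. ennreal ((1 + \<eta>) ^ ?n) * (\<integral>\<^sup>+x. ennreal (?j x + \<eta>) * indicator (B i) x \<partial>lborel))"
      by (intro suminf_le up) auto
    also have "\<dots> = ennreal ((1 + \<eta>) ^ ?n) * (\<Sum>i. \<integral>\<^sup>+x. ennreal (?j x + \<eta>) * indicator (B i) x \<partial>lborel)" by simp
    also have "(\<Sum>i. \<integral>\<^sup>+x. ennreal (?j x + \<eta>) * indicator (B i) x \<partial>lborel) = (\<integral>\<^sup>+x. ennreal (?j x + \<eta>) * indicator (E - N) x \<partial>lborel)"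
      by (rule sumj) auto
    finally show ?thesis unfolding EN plus .
  qed
  show ?lower
  proof -
    define J where "J i = (if B i = {} then 0 else graph_jacobian (p i) (q i))" for i
    have J: "0 \<le> J i" for i by (simp add: J_def)
    have lo: "ennreal ((1 - \<eta>) ^ ?n * J i) * emeasure lborel K \<le> hausdorff_measure ?n (?\<Phi> ` K)"
      if K: "K \<in> sets borel" "K \<subseteq> B i" for K i
    proof (cases "B i = {}")
      case False
      then obtain x where x: "x \<in> B i" by blast
      have "ennreal ((1 - \<eta>) ^ ?n * graph_jacobian (p i) (q i)) * emeasure lborel K \<le> hausdorff_measure ?n (?\<Phi> ` K)"
        using \<eta> K(2) by (intro area_of_nearly_linear_piece(2) K(1) pq(1)[OF x] near) auto
      then show ?thesis using False by (simp add: J_def)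
    qed (use K in simp)
    have "(\<Sum>i<m. ennreal ((1 - \<eta>) ^ ?n * J i) * emeasure lborel (B i)) \<le> hausdorff_measure ?n (?\<Phi> ` E)" for m
    proof (rule sum_lborel_le_hausdorff_measure_image)
      show "bounded (B i)" for i using bE by (rule bounded_subset) (auto simp: B_def)
      show "B i \<subseteq> E" for i by (auto simp: B_def)
      show "disjoint_family_on B {..<m}" using disj by (auto simp: disjoint_family_on_def)
      show "0 \<le> (1 - \<eta>) ^ ?n * J i" for i using \<eta> J by simp
      show "continuous_on E ?\<Phi>" by (rule continuous_on_subset[OF lipschitz_on_continuous_on[OF lip]]) simp
    qed (use inj lo in auto)
    then have S: "(\<Sum>i. ennreal ((1 - \<eta>) ^ ?n * J i) * emeasure lborel (B i)) \<le> hausdorff_measure ?n (?\<Phi> ` E)"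
      by (intro suminf_le_const summableI)
    have "(\<integral>\<^sup>+x\<in>E. ennreal (?j x) \<partial>lborel) = (\<Sum>i. \<integral>\<^sup>+x. ennreal (?j x) * indicator (B i) x \<partial>lborel)"
      by (subst sumj) (auto simp: EN)
    also have "\<dots> \<le> (\<Sum>i. ennreal (J i) * emeasure lborel (B i) + (\<integral>\<^sup>+x. ennreal \<eta> * indicator (B i) x \<partial>lborel))"
    proof (intro suminf_le)
      fix i
      have "(\<integral>\<^sup>+x. ennreal (?j x) * indicator (B i) x \<partial>lborel) \<le>
         (\<integral>\<^sup>+x. ennreal (J i) * indicator (B i) x + ennreal \<eta> * indicator (B i) x \<partial>lborel)"
      proof (intro nn_integral_mono)
        fix x
        show "ennreal (?j x) * indicator (B i) x \<le> ennreal (J i) * indicator (B i) x + ennreal \<eta> * indicator (B i) x"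
        proof (cases "x \<in> B i")
          case True
          then have "?j x \<le> J i + \<eta>" using pq(4)[OF True] by (auto simp: J_def)
          then show ?thesis using True J[of i] \<eta> by (simp add: ennreal_leI flip: ennreal_plus)
        qed simp
      qed
      also have "\<dots> = (\<integral>\<^sup>+x. ennreal (J i) * indicator (B i) x \<partial>lborel) + (\<integral>\<^sup>+x. ennreal \<eta> * indicator (B i) x \<partial>lborel)"
        by (rule nn_integral_add) auto
      finally show "(\<integral>\<^sup>+x. ennreal (?j x) * indicator (B i) x \<partial>lborel) \<le>
          ennreal (J i) * emeasure lborel (B i) + (\<integral>\<^sup>+x. ennreal \<eta> * indicator (B i) x \<partial>lborel)"
        by (simp add: nn_integral_cmult_indicator)
    qed auto
    also have "\<dots> = (\<Sum>i. ennreal (J i) * emeasure lborel (B i)) + (\<Sum>i. \<integral>\<^sup>+x. ennreal \<eta> * indicator (B i) x \<partial>lborel)"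
      by (rule suminf_add[symmetric]) auto
    also have "(\<Sum>i. \<integral>\<^sup>+x. ennreal \<eta> * indicator (B i) x \<partial>lborel) = ennreal \<eta> * emeasure lborel E"
      by (subst sumj) (auto simp: EN nn_integral_cmult_indicator)
    finally have "ennreal ((1 - \<eta>) ^ ?n) * (\<integral>\<^sup>+x\<in>E. ennreal (?j x) \<partial>lborel) \<le>
       ennreal ((1 - \<eta>) ^ ?n) * ((\<Sum>i. ennreal (J i) * emeasure lborel (B i)) + ennreal \<eta> * emeasure lborel E)"
      by (rule mult_left_mono) simp
    also have "\<dots> = (\<Sum>i. ennreal ((1 - \<eta>) ^ ?n * J i) * emeasure lborel (B i)) + ennreal ((1 - \<eta>) ^ ?n) * (ennreal \<eta> * emeasure lborel E)"
      using J \<eta> by (simp add: distrib_left ennreal_mult mult.assoc)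
    also have "\<dots> \<le> hausdorff_measure ?n (?\<Phi> ` E) + 1 * (ennreal \<eta> * emeasure lborel E)"
      using \<eta> power_le_one[of "1 - \<eta>" ?n] by (intro add_mono S mult_right_mono) auto
    finally show ?thesis by simp
  qed
qed

theorem area_formula_graph:
  "hausdorff_measure DIM('b \<times> real) ((\<lambda>x. (fst x, W x, h x)) ` E) =
     (\<integral>\<^sup>+x\<in>E. ennreal (graph_jacobian (gW x) (gh x)) \<partial>lborel)"
    "(\<integral>\<^sup>+x\<in>E. ennreal (graph_jacobian (gW x) (gh x)) \<partial>lborel) < top"
proof -
  let ?H = "hausdorff_measure DIM('b \<times> real) ((\<lambda>x. (fst x, W x, h x)) ` E)"
  let ?I = "\<integral>\<^sup>+x\<in>E. ennreal (graph_jacobian (gW x) (gh x)) \<partial>lborel" and ?n = "DIM('b \<times> real)"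
  have l: "emeasure lborel E < top" using emeasure_bounded_finite[OF bE] by simp
  obtain B where B: "\<And>w h :: 'b \<times> real. norm w \<le> M \<Longrightarrow> norm h \<le> M \<Longrightarrow> graph_jacobian w h \<le> B"
    by (rule graph_jacobian_bounded[of M]) (rule that)
  have "?I \<le> (\<integral>\<^sup>+x. ennreal B * indicator E x \<partial>lborel)"
  proof (rule nn_integral_mono_AE)
    show "AE x in lborel. ennreal (graph_jacobian (gW x) (gh x)) * indicator E x \<le> ennreal B * indicator E x"
      using ae
    proof (rule eventually_mono)
      fix x assume x: "x \<in> E \<longrightarrow> GDERIV W x :> gW x \<and> GDERIV h x :> gh x \<and> 1 / 2 \<le> snd (gW x)"
      show "ennreal (graph_jacobian (gW x) (gh x)) * indicator E x \<le> ennreal B * indicator E x"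
        using x norm_gderiv_lipschitz_le[OF W, of x "gW x"] norm_gderiv_lipschitz_le[OF h, of x "gh x"] B[of "gW x" "gh x"]
        by (auto split: split_indicator intro!: ennreal_leI)
    qed
  qed
  also have "\<dots> = ennreal B * emeasure lborel E" by (rule nn_integral_cmult_indicator) simp
  also have "\<dots> < top" using l by (simp add: ennreal_mult_less_top)
  finally show fin: "?I < top" .
  obtain i where i: "?I = ennreal i" "0 \<le> i" using fin by (cases ?I) auto
  obtain a where a: "emeasure lborel E = ennreal a" "0 \<le> a" using l by (cases "emeasure lborel E") auto
  have up: "?H \<le> ennreal ((1 + \<eta>) ^ ?n * (i + \<eta> * a))" if "0 < \<eta>" "\<eta> < 1" for \<eta>
    using area_formula_graph_approx(1)[OF that] that i a by (simp flip: ennreal_plus ennreal_mult)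
  \<comment> \<open>Any admissible \<eta> shows that \<open>?H\<close> is finite; the estimates then
    become inequalities of reals and pass to the limit at \<eta> = 0.\<close>
  obtain b where b: "?H = ennreal b" "0 \<le> b"
    using order_le_less_trans[OF up[of "1/2"] ennreal_less_top] by (cases ?H) auto
  have u: "b \<le> (1 + \<eta>) ^ ?n * (i + \<eta> * a)" if "0 < \<eta>" "\<eta> < 1" for \<eta>
    using up[OF that] that i a b by simp
  have lo: "(1 - \<eta>) ^ ?n * i \<le> b + \<eta> * a" if "0 < \<eta>" "\<eta> < 1" for \<eta>
    using area_formula_graph_approx(2)[OF that] that i a b by (simp flip: ennreal_plus ennreal_mult)
  have ev: "\<forall>\<^sub>F \<eta> in at_right (0::real). 0 < \<eta> \<and> \<eta> < 1"
    unfolding eventually_at_right_field by (intro exI[of _ 1]) auto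
  have "((\<lambda>\<eta>. (1 + \<eta>) ^ ?n * (i + \<eta> * a)) \<longlongrightarrow> (1 + 0) ^ ?n * (i + 0 * a)) (at_right 0)"
    by (intro tendsto_intros)
  then have "b \<le> (1 + 0) ^ ?n * (i + 0 * a)"
    by (rule tendsto_lowerbound) (use ev u in \<open>auto elim!: eventually_mono\<close>)
  moreover have "(1 - 0) ^ ?n * i \<le> b + 0 * a"
  proof (rule tendsto_le[of "at_right (0::real)"])
    show "((\<lambda>\<eta>. b + \<eta> * a) \<longlongrightarrow> b + 0 * a) (at_right 0)" by (intro tendsto_intros)
    show "((\<lambda>\<eta>. (1 - \<eta>) ^ ?n * i) \<longlongrightarrow> (1 - 0) ^ ?n * i) (at_right 0)" by (intro tendsto_intros)
  qed (use ev lo in \<open>auto elim!: eventually_mono\<close>)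
  ultimately show "?H = ?I" using i b by simp
qed

end

section \<open>Lipschitz functions: extension, gradient, integration\<close>

text \<open>McShane's extension: the infimum of the cones \<open>f y + L * dist x y\<close> is
  \<open>L\<close>-Lipschitz, and at a point of \<open>S\<close> the cone with vertex there is the
  lowest.\<close>

lemma lipschitz_extension:
  fixes f :: "'a::metric_space \<Rightarrow> real"
  assumes f: "L-lipschitz_on S f"
  obtains F where "L-lipschitz_on UNIV F" "\<And>x. x \<in> S \<Longrightarrow> F x = f x"
proof (cases "S = {}")
  case True
  have "L-lipschitz_on UNIV (\<lambda>_ :: 'a. 0 :: real)" using lipschitz_on_nonneg[OF f] by (auto intro: lipschitz_onI)
  then show ?thesis using True that by blast
next
  case False
  have L: "0 \<le> L" by (rule lipschitz_on_nonneg[OF f])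
  define F where "F x = (INF y\<in>S. f y + L * dist x y)" for x
  have bdd: "bdd_below ((\<lambda>y. f y + L * dist x y) ` S)" for x
  proof -
    obtain z where z: "z \<in> S" using False by blast
    have "f z - L * dist x z \<le> f y + L * dist x y" if "y \<in> S" for y
    proof -
      have "f z - f y \<le> L * dist z y" using lipschitz_onD[OF f z that] by (simp add: dist_real_def)
      also have "\<dots> \<le> L * (dist x z + dist x y)"
        using L dist_triangle[of z y x] by (intro mult_left_mono) (auto simp: dist_commute)
      finally show ?thesis by (simp add: algebra_simps)
    qed
    then show ?thesis by (intro bdd_belowI2[of _ "f z - L * dist x z"])
  qed
  have le: "F x \<le> F x' + L * dist x x'" for x x'
  proof -
    have "F x - L * dist x x' \<le> F x'" unfolding F_def[of x']
    proof (rule cINF_greatest[OF False])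
      fix y assume y: "y \<in> S"
      have "F x \<le> f y + L * dist x y" unfolding F_def by (rule cINF_lower[OF bdd y])
      also have "L * dist x y \<le> L * (dist x x' + dist x' y)" using L dist_triangle by (intro mult_left_mono) auto
      finally show "F x - L * dist x x' \<le> f y + L * dist x' y" by (simp add: algebra_simps)
    qed
    then show ?thesis by simp
  qed
  show ?thesis
  proof (rule that[of F])
    show "L-lipschitz_on UNIV F"
    proof (rule lipschitz_onI[OF _ L])
      fix x y
      show "dist (F x) (F y) \<le> L * dist x y"
        using le[of x y] le[of y x] by (simp add: dist_real_def abs_le_iff dist_commute)
    qed
    fix x assume x: "x \<in> S"
    show "F x = f x"
    proof (rule antisym)
      show "F x \<le> f x" using cINF_lower[OF bdd[of x] x] by (simp add: F_def)
      show "f x \<le> F x" unfolding F_def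
      proof (rule cINF_greatest[OF False])
        fix y assume "y \<in> S"
        then have "\<bar>f x - f y\<bar> \<le> L * dist x y" using lipschitz_onD[OF f x, of y] by (simp add: dist_real_def)
        then show "f x \<le> f y + L * dist x y" by linarith
      qed
    qed
  qed
qed

lemma tendsto_at_0_sequence:
  fixes f :: "real \<Rightarrow> 'a::topological_space"
  assumes "(f \<longlongrightarrow> l) (at 0)" "\<delta> \<longlonglongrightarrow> 0" "\<And>n :: nat. \<delta> n \<noteq> 0"
  shows "(\<lambda>n. f (\<delta> n)) \<longlonglongrightarrow> l"
  by (rule filterlim_compose[OF assms(1)]) (use assms in \<open>auto simp: filterlim_at\<close>)

lemma gderiv_difference_quotient:
  assumes "GDERIV F x :> D"
  shows "(\<lambda>n. (F (x + inverse (real (Suc n)) *\<^sub>R b) - F x) * real (Suc n)) \<longlonglongrightarrow> D \<bullet> b"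
proof -
  have "(F has_derivative (\<lambda>h. h \<bullet> D)) (at x)" using assms by (simp add: gderiv_def)
  then have F: "(F has_derivative (\<lambda>h. h \<bullet> D)) (at (x + 0 *\<^sub>R b))" by simp
  have l: "((\<lambda>s. x + s *\<^sub>R b) has_derivative (\<lambda>s. s *\<^sub>R b)) (at 0)"
    by (auto intro!: derivative_eq_intros)
  have "((\<lambda>s. F (x + s *\<^sub>R b)) has_derivative (\<lambda>s. (s *\<^sub>R b) \<bullet> D)) (at 0)"
    by (rule has_derivative_compose[OF l F])
  moreover have "(\<lambda>s. (s *\<^sub>R b) \<bullet> D) = (*) (D \<bullet> b)" by (auto simp: inner_commute)
  ultimately have "((\<lambda>s. F (x + s *\<^sub>R b)) has_real_derivative D \<bullet> b) (at 0)"
    unfolding has_field_derivative_def by simp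
  then have "((\<lambda>h. (F (x + h *\<^sub>R b) - F x) / h) \<longlongrightarrow> D \<bullet> b) (at 0)"
    by (simp add: DERIV_def)
  from tendsto_at_0_sequence[OF this LIMSEQ_inverse_real_of_nat]
  show ?thesis by (simp add: divide_inverse)
qed

text \<open>Difference quotients along the fixed steps \<open>1 / Suc n\<close> exhibit the gradient
  as the limit of a sequence of continuous functions.\<close>

lemma borel_measurable_gradient:
  fixes F :: "'a::euclidean_space \<Rightarrow> real"
  assumes F: "L-lipschitz_on UNIV F"
  obtains G where "G \<in> borel_measurable borel" "AE x in lborel. GDERIV F x :> G x" "\<And>x. norm (G x) \<le> L"
proof -
  have [measurable]: "F \<in> borel_measurable borel"
    by (rule borel_measurable_continuous_onI[OF lipschitz_on_continuous_on[OF F]])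
  define G where "G x = (\<Sum>b\<in>Basis. lim (\<lambda>n. (F (x + inverse (real (Suc n)) *\<^sub>R b) - F x) * real (Suc n)) *\<^sub>R b)" for x
  have [measurable]: "G \<in> borel_measurable borel" unfolding G_def[abs_def] by measurable
  \<comment> \<open>Where \<open>F\<close> is not differentiable the limits in \<open>G\<close> are
    arbitrary; the truncation makes the bound \<open>L\<close> hold everywhere, not just almost
    everywhere.\<close>
  show ?thesis
  proof (rule that[of "\<lambda>x. if norm (G x) \<le> L then G x else 0"])
    show "(\<lambda>x. if norm (G x) \<le> L then G x else 0) \<in> borel_measurable borel" by measurable
    show "norm (if norm (G x) \<le> L then G x else 0) \<le> L" for x using lipschitz_on_nonneg[OF F] by simp
    show "AE x in lborel. GDERIV F x :> (if norm (G x) \<le> L then G x else 0)"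
      using Rademacher[OF F]
    proof (rule eventually_mono)
      fix x assume "\<exists>D. GDERIV F x :> D"
      then obtain D where D: "GDERIV F x :> D" ..
      have "G x = (\<Sum>b\<in>Basis. (D \<bullet> b) *\<^sub>R b)"
        unfolding G_def by (intro sum.cong refl) (simp only: limI[OF gderiv_difference_quotient[OF D]])
      then show "GDERIV F x :> (if norm (G x) \<le> L then G x else 0)"
        using D norm_gderiv_lipschitz_le[OF F D] by (simp add: euclidean_representation)
    qed
  qed
qed

text \<open>The difference quotients of \<open>g\<close> are bounded by \<open>M\<close> and
  converge almost everywhere to \<open>g'\<close>. Their integrals over \<open>{a..b}\<close> equal
  the difference of two averages of \<open>g\<close> near the endpoints, which converge by
  continuity.\<close>

lemma lipschitz_FTC:
  fixes g g' :: "real \<Rightarrow> real"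
  assumes g: "M-lipschitz_on UNIV g" and ab: "a \<le> b" and [measurable]: "g' \<in> borel_measurable borel"
    and ae: "AE s in lborel. s \<in> {a..b} \<longrightarrow> (g has_real_derivative g' s) (at s)"
  shows "(\<integral>s. g' s * indicator {a..b} s \<partial>lborel) = g b - g a"
proof -
  have cont: "continuous_on UNIV g" by (rule lipschitz_on_continuous_on[OF g])
  have [measurable]: "g \<in> borel_measurable borel" by (rule borel_measurable_continuous_onI[OF cont])
  \<comment> \<open>The start \<open>a - 1\<close> makes \<open>a\<close> an interior point; the
    shifted arguments stay below \<open>b + 2\<close> because the steps are at most
    \<open>1\<close>.\<close>
  define \<Gamma> where "\<Gamma> x = integral {a - 1..x} g" for x
  have \<Gamma>: "(\<Gamma> has_real_derivative g x) (at x)" if "a - 1 < x" "x < b + 2" for x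
    using integral_has_real_derivative[OF continuous_on_subset[OF cont subset_UNIV], of x "a - 1" "b + 2"] that
    by (simp add: \<Gamma>_def[abs_def] at_within_Icc_at)
  define \<delta> where "\<delta> n = inverse (real (Suc n))" for n
  have \<delta>: "0 < \<delta> n" "\<delta> n \<le> 1" for n by (auto simp: \<delta>_def inverse_le_1_iff)
  have \<delta>0: "\<delta> \<longlonglongrightarrow> 0" unfolding \<delta>_def by (rule LIMSEQ_inverse_real_of_nat)
  define s where "s n x = (g (x + \<delta> n) - g x) / \<delta> n * indicator {a..b} x" for n x
  have int: "(\<integral>x. s n x \<partial>lborel) = (\<Gamma> (b + \<delta> n) - \<Gamma> b) / \<delta> n - (\<Gamma> (a + \<delta> n) - \<Gamma> a) / \<delta> n" for n
  proof -
    have "(\<integral>x. (g (x + \<delta> n) - g x) * indicator {a..b} x \<partial>lborel) =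
        (\<Gamma> (b + \<delta> n) - \<Gamma> b) - (\<Gamma> (a + \<delta> n) - \<Gamma> a)"
    proof (rule integral_FTC_Icc_real[OF ab])
      fix x assume x: "a \<le> x" "x \<le> b"
      have "((\<lambda>x. \<Gamma> (x + \<delta> n)) has_real_derivative g (x + \<delta> n)) (at x)"
        using \<Gamma>[of "x + \<delta> n"] x \<delta>[of n] by (simp add: DERIV_shift)
      then show "((\<lambda>x. \<Gamma> (x + \<delta> n) - \<Gamma> x) has_real_derivative g (x + \<delta> n) - g x) (at x)"
        using \<Gamma>[of x] x by (intro DERIV_diff) auto
      have "continuous_on UNIV (\<lambda>x. g (x + \<delta> n) - g x)"
        by (intro continuous_intros continuous_on_compose2[OF cont]) auto
      then show "isCont (\<lambda>x. g (x + \<delta> n) - g x) x" by (simp add: continuous_on_eq_continuous_at)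
    qed
    moreover have "s n x = (g (x + \<delta> n) - g x) * indicator {a..b} x * (1 / \<delta> n)" for x
      by (simp add: s_def)
    ultimately show ?thesis by (simp add: diff_divide_distrib)
  qed
  have lim: "(\<lambda>n. (\<Gamma> (x + \<delta> n) - \<Gamma> x) / \<delta> n) \<longlonglongrightarrow> g x" if "a \<le> x" "x \<le> b" for x
  proof -
    have "((\<lambda>h. (\<Gamma> (x + h) - \<Gamma> x) / h) \<longlongrightarrow> g x) (at 0)" using \<Gamma>[of x] that by (simp add: DERIV_def)
    then show ?thesis by (rule tendsto_at_0_sequence[OF _ \<delta>0]) (use \<delta> in \<open>simp add: less_imp_neq[symmetric]\<close>)
  qed
  have 1: "(\<lambda>n. \<integral>x. s n x \<partial>lborel) \<longlonglongrightarrow> g b - g a"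
    unfolding int using ab by (intro tendsto_diff lim) auto
  have 2: "(\<lambda>n. \<integral>x. s n x \<partial>lborel) \<longlonglongrightarrow> (\<integral>x. g' x * indicator {a..b} x \<partial>lborel)"
  proof (rule integral_dominated_convergence[where w="\<lambda>x. M * indicator {a..b} x"])
    show "AE x in lborel. (\<lambda>n. s n x) \<longlonglongrightarrow> g' x * indicator {a..b} x"
      using ae
    proof (rule eventually_mono)
      fix x assume x: "x \<in> {a..b} \<longrightarrow> (g has_real_derivative g' x) (at x)"
      show "(\<lambda>n. s n x) \<longlonglongrightarrow> g' x * indicator {a..b} x"
      proof (cases "x \<in> {a..b}")
        case True
        then have "((\<lambda>h. (g (x + h) - g x) / h) \<longlongrightarrow> g' x) (at 0)" using x by (simp add: DERIV_def)
        then have "(\<lambda>n. (g (x + \<delta> n) - g x) / \<delta> n) \<longlonglongrightarrow> g' x"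
          by (rule tendsto_at_0_sequence[OF _ \<delta>0]) (use \<delta> in \<open>simp add: less_imp_neq[symmetric]\<close>)
        then show ?thesis using True by (simp add: s_def)
      qed (simp add: s_def)
    qed
    show "AE x in lborel. norm (s n x) \<le> M * indicator {a..b} x" for n
    proof (rule AE_I2)
      fix x
      have "\<bar>g (x + \<delta> n) - g x\<bar> \<le> M * \<delta> n"
        using lipschitz_onD[OF g, of "x + \<delta> n" x] \<delta>(1)[of n] by (simp add: dist_real_def)
      then show "norm (s n x) \<le> M * indicator {a..b} x"
        using \<delta>(1)[of n] by (auto simp: s_def abs_mult divide_simps split: split_indicator)
    qed
    show "integrable lborel (\<lambda>x. M * indicator {a..b} x)"
      by (intro integrable_mult_right integrable_real_indicator) (auto simp: emeasure_lborel_Icc_eq)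
  qed (simp_all add: s_def)
  show ?thesis by (rule LIMSEQ_unique[OF 2 1])
qed

section \<open>The area of the flow\<close>

text \<open>In the notation of the introduction: \<open>q\<close>, \<open>u\<close>, \<open>K\<close>, \<open>K / (J + 1 + u)\<close> and \<open>\<nabla> W\<close>.\<close>

definition cone_radius :: "('b::euclidean_space \<times> real \<Rightarrow> real) \<Rightarrow> real \<Rightarrow> 'b \<times> real \<Rightarrow> real" where
  "cone_radius F t x = norm (fst x, t * F x)"

definition cone_slope :: "real \<Rightarrow> ('b::euclidean_space \<times> real \<Rightarrow> real) \<Rightarrow> ('b \<times> real \<Rightarrow> 'b \<times> real) \<Rightarrow> real \<Rightarrow> 'b \<times> real \<Rightarrow> real" where
  "cone_slope lam F G t x = lam * t\<^sup>2 * F x * snd (G x) / cone_radius F t x"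

definition cone_energy :: "real \<Rightarrow> ('b::euclidean_space \<times> real \<Rightarrow> real) \<Rightarrow> ('b \<times> real \<Rightarrow> 'b \<times> real) \<Rightarrow> real \<Rightarrow> 'b \<times> real \<Rightarrow> real" where
  "cone_energy lam F G t x = (snd (G x))\<^sup>2 +
     (norm (fst (G x) + (lam * snd (G x) * (1 / norm (fst x) - 1 / cone_radius F t x)) *\<^sub>R fst x))\<^sup>2"

definition cone_remainder :: "real \<Rightarrow> ('b::euclidean_space \<times> real \<Rightarrow> real) \<Rightarrow> ('b \<times> real \<Rightarrow> 'b \<times> real) \<Rightarrow> real \<Rightarrow> 'b \<times> real \<Rightarrow> real" where
  "cone_remainder lam F G t x = cone_energy lam F G t x /
     (sqrt ((1 + cone_slope lam F G t x)\<^sup>2 + t\<^sup>2 * cone_energy lam F G t x) + 1 + cone_slope lam F G t x)"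

definition flow_gradient :: "real \<Rightarrow> ('b::euclidean_space \<times> real \<Rightarrow> real) \<Rightarrow> ('b \<times> real \<Rightarrow> 'b \<times> real) \<Rightarrow> real \<Rightarrow> 'b \<times> real \<Rightarrow> 'b \<times> real" where
  "flow_gradient lam F G t x = (0, 1) + (lam / cone_radius F t x) *\<^sub>R ((fst x, 0) + (t\<^sup>2 * F x) *\<^sub>R G x)
     - (lam / norm (fst x)) *\<^sub>R (fst x, 0)"

section \<open>Gradient, Jacobian and uniform bounds of the parametrization\<close>

lemma norm_fst_le_cone_radius: "norm (fst x) \<le> cone_radius F t x"
  unfolding cone_radius_def by (rule norm_fst_le)

lemma abs_le_cone_radius: "\<bar>t * F x\<bar> \<le> cone_radius F t x"
  using norm_snd_le[of "t * F x" "fst x"] unfolding cone_radius_def by simp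

lemma cone_radius_sq: "(cone_radius F t x)\<^sup>2 = (norm (fst x))\<^sup>2 + t\<^sup>2 * (F x)\<^sup>2"
  by (simp add: cone_radius_def norm_Pair power_mult_distrib)

lemma cone_radius_nonneg [simp]: "0 \<le> cone_radius F t x"
  by (simp add: cone_radius_def)

lemma gderiv_cone_radius:
  assumes D: "GDERIV F x :> D" and x: "fst x \<noteq> 0"
  shows "(cone_radius F t has_derivative (\<lambda>h. (fst h \<bullet> fst x + t\<^sup>2 * F x * (h \<bullet> D)) / cone_radius F t x)) (at x)"
proof -
  have F: "(F has_derivative (\<lambda>h. h \<bullet> D)) (at x)" using D by (simp add: gderiv_def)
  have "((\<lambda>y. (fst y, t * F y)) has_derivative (\<lambda>h. (fst h, t * (h \<bullet> D)))) (at x)"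
    by (intro has_derivative_Pair has_derivative_fst has_derivative_ident has_derivative_mult_right F)
  moreover have "(norm has_derivative (\<lambda>h. h \<bullet> sgn (fst x, t * F x))) (at (fst x, t * F x))"
    using x by (intro has_derivative_norm) (simp add: zero_prod_def)
  ultimately have "((\<lambda>y. norm (fst y, t * F y)) has_derivative (\<lambda>h. (fst h, t * (h \<bullet> D)) \<bullet> sgn (fst x, t * F x))) (at x)"
    by (rule has_derivative_compose)
  moreover have "(fst h, t * (h \<bullet> D)) \<bullet> sgn (fst x, t * F x) = (fst h \<bullet> fst x + t\<^sup>2 * F x * (h \<bullet> D)) / cone_radius F t x" for h
    by (simp add: sgn_div_norm cone_radius_def divide_inverse power2_eq_square algebra_simps)
  ultimately show ?thesis by (simp add: cone_radius_def[abs_def])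
qed

lemma gderiv_flow_height:
  assumes D: "GDERIV F x :> G x" and x: "fst x \<noteq> 0"
  shows "GDERIV (\<lambda>y. snd y + lam * cone_radius F t y - lam * norm (fst y)) x :> flow_gradient lam F G t x"
proof -
  have "((\<lambda>y. norm (fst y)) has_derivative (\<lambda>h. fst h \<bullet> sgn (fst x))) (at x)"
    using has_derivative_compose[OF has_derivative_fst[OF has_derivative_ident] has_derivative_norm[OF x]] .
  then have "((\<lambda>y. snd y + lam * cone_radius F t y - lam * norm (fst y)) has_derivative
     (\<lambda>h. snd h + lam * ((fst h \<bullet> fst x + t\<^sup>2 * F x * (h \<bullet> G x)) / cone_radius F t x) - lam * (fst h \<bullet> sgn (fst x)))) (at x)"
    by (intro has_derivative_diff has_derivative_add has_derivative_mult_right has_derivative_snd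
        has_derivative_ident gderiv_cone_radius[OF D x])
  moreover have "snd h + lam * ((fst h \<bullet> fst x + t\<^sup>2 * F x * (h \<bullet> G x)) / cone_radius F t x) - lam * (fst h \<bullet> sgn (fst x))
     = h \<bullet> flow_gradient lam F G t x" for h
    by (cases h) (simp add: flow_gradient_def inner_diff_right inner_add_right sgn_div_norm divide_inverse algebra_simps)
  ultimately show ?thesis by (simp add: gderiv_def)
qed

lemma snd_flow_gradient: "snd (flow_gradient lam F G t x) = 1 + cone_slope lam F G t x"
  by (simp add: flow_gradient_def cone_slope_def)

text \<open>In the mixed minors the part of \<open>u\<close> multiplying \<open>fst (G x)\<close>
  cancels against the part of the flow gradient proportional to \<open>G x\<close>. What is left
  carries a factor \<open>t\<close>, and the minor formed by the last gradient alone also does, so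
  \<open>J\<^sup>2\<close> exceeds \<open>(1 + u)\<^sup>2\<close> by a multiple of
  \<open>t\<^sup>2\<close>.\<close>

lemma graph_jacobian_flow:
  "graph_jacobian (flow_gradient lam F G t x) (t *\<^sub>R G x) =
    sqrt ((1 + cone_slope lam F G t x)\<^sup>2 + t\<^sup>2 * cone_energy lam F G t x)"
proof -
  let ?u = "cone_slope lam F G t x" and ?r = "norm (fst x)" and ?q = "cone_radius F t x"
  let ?a = "fst (G x)" and ?b = "snd (G x)"
  have "snd (flow_gradient lam F G t x) *\<^sub>R fst (t *\<^sub>R G x) - snd (t *\<^sub>R G x) *\<^sub>R fst (flow_gradient lam F G t x)
     = ((1 + ?u) * t) *\<^sub>R ?a - (t * ?b) *\<^sub>R ((lam / ?q) *\<^sub>R (fst x + (t\<^sup>2 * F x) *\<^sub>R ?a) - (lam / ?r) *\<^sub>R fst x)"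
    unfolding snd_flow_gradient by (simp add: flow_gradient_def)
  also have "\<dots> = t *\<^sub>R (?a + (lam * ?b * (1 / ?r - 1 / ?q)) *\<^sub>R fst x)"
    by (simp add: cone_slope_def algebra_simps)
  finally have "(norm (snd (flow_gradient lam F G t x) *\<^sub>R fst (t *\<^sub>R G x) - snd (t *\<^sub>R G x) *\<^sub>R fst (flow_gradient lam F G t x)))\<^sup>2
     = t\<^sup>2 * (norm (?a + (lam * ?b * (1 / ?r - 1 / ?q)) *\<^sub>R fst x))\<^sup>2"
    by (simp add: power_mult_distrib)
  then show ?thesis
    unfolding graph_jacobian_def snd_flow_gradient cone_energy_def by (simp add: power_mult_distrib algebra_simps)
qed

text \<open>One factor \<open>t * F x\<close> is absorbed by the cone radius. The result is uniform
  up to the axis but only of first order in \<open>t\<close>.\<close>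

lemma abs_cone_slope_le:
  assumes "norm (G x) \<le> L" "0 \<le> lam" "0 \<le> t"
  shows "\<bar>cone_slope lam F G t x\<bar> \<le> lam * t * L"
proof (cases "cone_radius F t x = 0")
  case True
  then show ?thesis using assms order_trans[OF norm_ge_zero assms(1)] by (simp add: cone_slope_def)
next
  case False
  then have q: "0 < cone_radius F t x" using cone_radius_nonneg[of F t x] by linarith
  have "norm (snd (G x)) \<le> norm (G x)" using norm_snd_le[of "snd (G x)" "fst (G x)"] by simp
  then have s: "\<bar>snd (G x)\<bar> \<le> L" using assms by simp
  have "\<bar>cone_slope lam F G t x\<bar> = (lam * t) * (\<bar>t * F x\<bar> / cone_radius F t x) * \<bar>snd (G x)\<bar>"
    using assms q by (simp add: cone_slope_def abs_mult power2_eq_square)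
  also have "\<dots> \<le> (lam * t) * 1 * L"
    using assms s q abs_le_cone_radius[of t F x] by (intro mult_mono mult_left_mono) auto
  finally show ?thesis by simp
qed

lemma cone_energy_nonneg [simp]: "0 \<le> cone_energy lam F G t x"
  by (simp add: cone_energy_def)

text \<open>The singular factor \<open>1 / norm (fst x)\<close> multiplies \<open>fst x\<close>, and
  the cone radius is at least \<open>norm (fst x)\<close>, so the correction is at most
  \<open>lam * L\<close>, uniformly in \<open>t\<close>.\<close>

lemma cone_energy_le:
  assumes "norm (G x) \<le> L" "0 \<le> lam"
  shows "cone_energy lam F G t x \<le> L\<^sup>2 + (L + lam * L)\<^sup>2"
proof -
  have "norm (snd (G x)) \<le> norm (G x)" using norm_snd_le[of "snd (G x)" "fst (G x)"] by simp
  then have s: "\<bar>snd (G x)\<bar> \<le> L" using assms by simp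
  have "norm (fst (G x)) \<le> norm (G x)" using norm_fst_le[of "fst (G x)" "snd (G x)"] by simp
  then have f: "norm (fst (G x)) \<le> L" using assms by simp
  let ?r = "norm (fst x)" and ?q = "cone_radius F t x"
  have k: "\<bar>1 / ?r - 1 / ?q\<bar> * ?r \<le> 1"
  proof (cases "?r = 0")
    case False
    then have r: "0 < ?r" by simp
    have "0 \<le> 1 / ?q" "1 / ?q \<le> 1 / ?r"
      using r norm_fst_le_cone_radius[of x F t] by (simp_all add: frac_le)
    then have "\<bar>1 / ?r - 1 / ?q\<bar> * ?r \<le> (1 / ?r) * ?r" by (intro mult_right_mono) auto
    then show ?thesis using r by simp
  qed simp
  have "norm ((lam * snd (G x) * (1 / ?r - 1 / ?q)) *\<^sub>R fst x) = lam * \<bar>snd (G x)\<bar> * (\<bar>1 / ?r - 1 / ?q\<bar> * ?r)"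
    using assms by (simp add: abs_mult)
  also have "\<dots> \<le> lam * L * 1"
    using assms s k order_trans[OF norm_ge_zero assms(1)] by (intro mult_mono mult_left_mono) auto
  finally have "norm (fst (G x) + (lam * snd (G x) * (1 / ?r - 1 / ?q)) *\<^sub>R fst x) \<le> L + lam * L"
    using f norm_triangle_ineq[of "fst (G x)" "(lam * snd (G x) * (1 / ?r - 1 / ?q)) *\<^sub>R fst x"] by linarith
  moreover have "(snd (G x))\<^sup>2 \<le> L\<^sup>2" using s by (simp add: abs_le_square_iff[symmetric])
  ultimately show ?thesis unfolding cone_energy_def by (intro add_mono power_mono[of _ "L + lam * L"] norm_ge_zero)
qed

lemma lipschitz_cone_radius:
  assumes F: "L-lipschitz_on UNIV F" and t: "0 \<le> t"
  shows "(1 + t * L)-lipschitz_on UNIV (cone_radius F t)"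
proof (rule lipschitz_onI)
  fix x y :: "'a \<times> real"
  have "dist (cone_radius F t x) (cone_radius F t y) \<le> norm ((fst x, t * F x) - (fst y, t * F y))"
    unfolding cone_radius_def dist_real_def by (rule norm_triangle_ineq3)
  also have "\<dots> \<le> norm (fst x - fst y) + \<bar>t * F x - t * F y\<bar>"
    using norm_Pair_le[of "fst x - fst y" "t * F x - t * F y"] by simp
  also have "\<bar>t * F x - t * F y\<bar> = t * dist (F x) (F y)"
    using t by (simp add: dist_real_def abs_mult flip: right_diff_distrib)
  also have "norm (fst x - fst y) + t * dist (F x) (F y) \<le> dist x y + t * (L * dist x y)"
    using t dist_fst_le[of x y] by (intro add_mono mult_left_mono lipschitz_onD[OF F]) (auto simp: dist_norm)
  finally show "dist (cone_radius F t x) (cone_radius F t y) \<le> (1 + t * L) * dist x y" by (simp add: algebra_simps)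
qed (use t lipschitz_on_nonneg[OF F] in simp)

text \<open>On the axis \<open>norm (fst x)\<close> is not differentiable; the axis lies in a
  coordinate hyperplane.\<close>

lemma AE_fst_nonzero: "AE x in (lborel :: ('b::euclidean_space \<times> real) measure). fst x \<noteq> 0"
proof -
  obtain b :: 'b where b: "b \<in> Basis" using nonempty_Basis by blast
  have "negligible {x. (b, 0 :: real) \<bullet> x = 0}" using b by (intro negligible_hyperplane) (auto simp: zero_prod_def)
  then have "negligible {x :: 'b \<times> real. fst x = 0}" by (rule negligible_subset) (auto simp: inner_prod_def)
  then have "AE x in lebesgue. x \<notin> {x :: 'b \<times> real. fst x = 0}"
    unfolding negligible_iff_null_sets by (rule AE_not_in)
  then have "AE x in lborel. x \<notin> {x :: 'b \<times> real. fst x = 0}"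
    by (simp only: AE_completion_iff)
  then show ?thesis by simp
qed

lemma borel_measurable_components [measurable]:
  "fst \<in> borel_measurable (borel :: ('b::euclidean_space \<times> real) measure)"
  "snd \<in> borel_measurable (borel :: ('b::euclidean_space \<times> real) measure)"
  by (intro borel_measurable_continuous_onI continuous_intros)+

lemma borel_measurable_cone_radius [measurable (raw)]:
  fixes F :: "'b::euclidean_space \<times> real \<Rightarrow> real"
  assumes [measurable]: "F \<in> borel_measurable borel" "g \<in> borel_measurable M"
  shows "(\<lambda>x. cone_radius F t (g x)) \<in> borel_measurable M"
proof -
  have "cone_radius F t = (\<lambda>x. sqrt ((norm (fst x))\<^sup>2 + t\<^sup>2 * (F x)\<^sup>2))"
    by (simp add: fun_eq_iff cone_radius_def norm_Pair power_mult_distrib)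
  then have "cone_radius F t \<in> borel_measurable borel" by simp
  from measurable_compose[OF assms(2) this] show ?thesis .
qed

text \<open>\<open>F\<close> stands for the extension of \<open>f\<close>, \<open>G\<close> for a
  measurable version of its gradient and \<open>S\<close> for the support of \<open>f\<close>.
  \<open>F0\<close> is restricted to the closed cone because the extension may be nonzero
  elsewhere.\<close>

locale cone_flow =
  fixes lam L :: real and F :: "'b::euclidean_space \<times> real \<Rightarrow> real" and G :: "'b \<times> real \<Rightarrow> 'b \<times> real"
    and S :: "('b \<times> real) set"
  assumes lam: "0 < lam" and F: "L-lipschitz_on UNIV F"
    and G [measurable]: "G \<in> borel_measurable borel" and G_le: "\<And>x. norm (G x) \<le> L"
    and GF: "AE x in lborel. GDERIV F x :> G x"
    and S: "compact S" and F0: "\<And>x. lam * norm (fst x) \<le> snd x \<Longrightarrow> x \<notin> S \<Longrightarrow> F x = 0"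
begin

abbreviation "E \<equiv> {x. lam * norm (fst x) < snd x} \<inter> S"
abbreviation "u \<equiv> cone_slope lam F G"
abbreviation "K \<equiv> cone_energy lam F G"
abbreviation "R \<equiv> cone_remainder lam F G"

lemma F_measurable [measurable]: "F \<in> borel_measurable borel"
  by (rule borel_measurable_continuous_onI[OF lipschitz_on_continuous_on[OF F]])

lemma sets_E [measurable]: "E \<in> sets borel"
proof -
  have "open {x :: 'b \<times> real. lam * norm (fst x) < snd x}"
    by (intro open_Collect_less continuous_intros)
  then show ?thesis using S by (intro sets.Int borel_open borel_compact)
qed

lemma bounded_E: "bounded E"
  using compact_imp_bounded[OF S] by (rule bounded_subset) auto

lemma G_components_measurable [measurable]:
  "(\<lambda>x. fst (G x)) \<in> borel_measurable borel" "(\<lambda>x. snd (G x)) \<in> borel_measurable borel"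
  by (rule measurable_compose[OF G], simp)+

lemma u_measurable [measurable]: "u t \<in> borel_measurable borel"
  unfolding cone_slope_def[abs_def] by measurable

lemma K_measurable [measurable]: "K t \<in> borel_measurable borel"
  unfolding cone_energy_def[abs_def] by measurable

lemma R_measurable [measurable]: "R t \<in> borel_measurable borel"
  unfolding cone_remainder_def[abs_def] by measurable

lemma flow_gradient_measurable [measurable]: "flow_gradient lam F G t \<in> borel_measurable borel"
proof -
  have "flow_gradient lam F G t = (\<lambda>x. (fst (flow_gradient lam F G t x), snd (flow_gradient lam F G t x)))" by simp
  also have "\<dots> \<in> borel_measurable borel"
    unfolding flow_gradient_def by (intro borel_measurable_Pair) simp_all
  finally show ?thesis .
qed

lemma abs_u_le: "0 \<le> t \<Longrightarrow> \<bar>u t x\<bar> \<le> lam * t * L"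
  using abs_cone_slope_le[of G x L lam t F] G_le lam by simp

text \<open>The smallness of \<open>t\<close> makes the vertical derivative \<open>1 + u\<close> at
  least \<open>1 / 2\<close>, the nondegeneracy required by the area formula.\<close>

lemma area_flow:
  assumes t: "0 \<le> t" "lam * t * L \<le> 1 / 2"
  shows "hausdorff_measure DIM('b \<times> real)
      ((\<lambda>x. (fst x, snd x + lam * cone_radius F t x - lam * norm (fst x), t * F x)) ` E) =
    (\<integral>\<^sup>+x\<in>E. ennreal (sqrt ((1 + u t x)\<^sup>2 + t\<^sup>2 * K t x)) \<partial>lborel)"
proof -
  have L: "0 \<le> L" by (rule lipschitz_on_nonneg[OF F])
  define M where "M = 1 + lam * (1 + t * L) + lam + t * L"
  have h: "(t * L)-lipschitz_on UNIV (\<lambda>x. t * F x)"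
    using t lipschitz_on_cmult_real[OF F, of t] by simp
  then have hM: "M-lipschitz_on UNIV (\<lambda>x. t * F x)"
    by (rule lipschitz_on_mono) (use t lam L in \<open>auto simp: M_def\<close>)
  have "(1 + lam * (1 + t * L) + lam)-lipschitz_on UNIV (\<lambda>x. snd x + lam * cone_radius F t x - lam * norm (fst x))"
  proof (intro lipschitz_on_diff lipschitz_on_add)
    show "1-lipschitz_on UNIV (snd :: 'b \<times> real \<Rightarrow> real)" by (rule lipschitz_onI) (simp_all add: dist_snd_le)
    show "(lam * (1 + t * L))-lipschitz_on UNIV (\<lambda>x. lam * cone_radius F t x)"
      using lipschitz_on_cmult_real[OF lipschitz_cone_radius[OF F t(1)], of lam] lam by simp
    show "lam-lipschitz_on UNIV (\<lambda>x :: 'b \<times> real. lam * norm (fst x))"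
    proof (rule lipschitz_onI)
      fix x y :: "'b \<times> real"
      have "\<bar>norm (fst x) - norm (fst y)\<bar> \<le> dist x y"
        using norm_triangle_ineq3[of "fst x" "fst y"] dist_fst_le[of x y] by (simp add: dist_norm)
      then show "dist (lam * norm (fst x)) (lam * norm (fst y)) \<le> lam * dist x y"
        using lam by (simp add: dist_real_def abs_mult flip: right_diff_distrib)
    qed (use lam in simp)
  qed
  then have WM: "M-lipschitz_on UNIV (\<lambda>x. snd x + lam * cone_radius F t x - lam * norm (fst x))"
    by (rule lipschitz_on_mono) (use t L in \<open>auto simp: M_def\<close>)
  have "hausdorff_measure DIM('b \<times> real)
      ((\<lambda>x. (fst x, snd x + lam * cone_radius F t x - lam * norm (fst x), t * F x)) ` E) =
    (\<integral>\<^sup>+x\<in>E. ennreal (graph_jacobian (flow_gradient lam F G t x) (t *\<^sub>R G x)) \<partial>lborel)"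
  proof (rule area_formula_graph(1)[OF WM hM _ _ sets_E bounded_E])
    show "AE x in lborel. x \<in> E \<longrightarrow>
       GDERIV (\<lambda>x. snd x + lam * cone_radius F t x - lam * norm (fst x)) x :> flow_gradient lam F G t x \<and>
       GDERIV (\<lambda>x. t * F x) x :> t *\<^sub>R G x \<and> 1 / 2 \<le> snd (flow_gradient lam F G t x)"
      using GF AE_fst_nonzero
    proof eventually_elim
      fix x assume x: "GDERIV F x :> G x" "fst x \<noteq> 0"
      have "GDERIV (\<lambda>x. t * F x) x :> t *\<^sub>R G x"
        using x(1) has_derivative_mult_right[of F "\<lambda>h. h \<bullet> G x" "at x" t] by (simp add: gderiv_def)
      moreover have "1 / 2 \<le> snd (flow_gradient lam F G t x)"
        unfolding snd_flow_gradient using abs_u_le[OF t(1), of x] t by simp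
      ultimately show "x \<in> E \<longrightarrow>
       GDERIV (\<lambda>x. snd x + lam * cone_radius F t x - lam * norm (fst x)) x :> flow_gradient lam F G t x \<and>
       GDERIV (\<lambda>x. t * F x) x :> t *\<^sub>R G x \<and> 1 / 2 \<le> snd (flow_gradient lam F G t x)"
        using gderiv_flow_height[of F x G, OF x] by blast
    qed
    \<comment> \<open>The cone radius is determined by the first and last components of the image,
      so the middle component determines \<open>snd x\<close>.\<close>
    show "inj_on (\<lambda>x. (fst x, snd x + lam * cone_radius F t x - lam * norm (fst x), t * F x)) E"
    proof (rule inj_onI)
      fix x y
      assume "(fst x, snd x + lam * cone_radius F t x - lam * norm (fst x), t * F x) =
              (fst y, snd y + lam * cone_radius F t y - lam * norm (fst y), t * F y)"
      then show "x = y" by (auto simp: cone_radius_def prod_eq_iff)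
    qed
    show "flow_gradient lam F G t \<in> borel_measurable borel" by measurable
    show "(\<lambda>x. t *\<^sub>R G x) \<in> borel_measurable borel" by measurable
  qed
  then show ?thesis by (simp only: graph_jacobian_flow)
qed

lemma integrable_on_E:
  assumes [measurable]: "g \<in> borel_measurable borel" and "\<And>x. \<bar>g x\<bar> \<le> B"
  shows "integrable lborel (\<lambda>x. indicator E x * g x :: real)"
proof (rule Bochner_Integration.integrable_bound)
  show "integrable lborel (\<lambda>x. B * indicator E x)"
    using emeasure_bounded_finite[OF bounded_E] by (intro integrable_mult_right integrable_real_indicator) auto
  show "AE x in lborel. norm (indicator E x * g x) \<le> norm (B * indicator E x)"
    using assms(2) order_trans[OF abs_ge_zero assms(2)] by (auto split: split_indicator)
qed simp

text \<open>The identity is the difference of squares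
  \<open>J\<^sup>2 - (1 + u)\<^sup>2 = t\<^sup>2 * K\<close>. Both \<open>J\<close> and
  \<open>1 + u\<close> are at least \<open>1 / 2\<close>, so the denominator of \<open>R\<close> is
  at least \<open>1\<close> and \<open>R \<le> K\<close>.\<close>

lemma R_bounds:
  assumes t: "0 \<le> t" "lam * t * L \<le> 1 / 2"
  shows "0 \<le> R t x" "R t x \<le> L\<^sup>2 + (L + lam * L)\<^sup>2"
    "sqrt ((1 + u t x)\<^sup>2 + t\<^sup>2 * K t x) = 1 + u t x + t\<^sup>2 * R t x"
proof -
  have u: "1 / 2 \<le> 1 + u t x"
    using abs_u_le[OF t(1), of x] t by simp
  let ?J = "sqrt ((1 + u t x)\<^sup>2 + t\<^sup>2 * K t x)"
  have J: "1 + u t x \<le> ?J" using u by (intro real_le_rsqrt) simp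
  then have d: "1 \<le> ?J + 1 + u t x" using u by linarith
  show "0 \<le> R t x" unfolding cone_remainder_def using d by simp
  have "R t x \<le> K t x / 1" unfolding cone_remainder_def using d by (intro divide_left_mono) auto
  also have "\<dots> \<le> L\<^sup>2 + (L + lam * L)\<^sup>2" using cone_energy_le[of G x L lam F t] G_le lam by simp
  finally show "R t x \<le> L\<^sup>2 + (L + lam * L)\<^sup>2" .
  have "(a - b) * (a + b) = a\<^sup>2 - b\<^sup>2" for a b :: real by (simp add: power2_eq_square algebra_simps)
  from this[of ?J "1 + u t x"] have "(?J - (1 + u t x)) * (?J + 1 + u t x) = ?J\<^sup>2 - (1 + u t x)\<^sup>2"
    by (simp only: add.assoc)
  also have "?J\<^sup>2 = (1 + u t x)\<^sup>2 + t\<^sup>2 * K t x" by (intro real_sqrt_pow2 add_nonneg_nonneg) auto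
  finally have "?J - (1 + u t x) = t\<^sup>2 * K t x / (?J + 1 + u t x)" using d by (simp add: eq_divide_eq)
  then show "?J = 1 + u t x + t\<^sup>2 * R t x" by (simp add: cone_remainder_def)
qed

lemma area_flow_expansion:
  assumes t: "0 \<le> t" "lam * t * L \<le> 1 / 2"
  shows "(\<integral>\<^sup>+x\<in>E. ennreal (sqrt ((1 + u t x)\<^sup>2 + t\<^sup>2 * K t x)) \<partial>lborel) =
    ennreal (measure lborel E + (\<integral>x. indicator E x * u t x \<partial>lborel) + t\<^sup>2 * (\<integral>x. indicator E x * R t x \<partial>lborel))"
    (is "_ = ennreal ?I")
    and "0 \<le> measure lborel E + (\<integral>x. indicator E x * u t x \<partial>lborel) + t\<^sup>2 * (\<integral>x. indicator E x * R t x \<partial>lborel)"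
proof -
  have iu: "integrable lborel (\<lambda>x. indicator E x * u t x)"
    by (rule integrable_on_E[where B="lam * t * L"]) (use abs_u_le[OF t(1)] in auto)
  have iR: "integrable lborel (\<lambda>x. indicator E x * R t x)"
    by (rule integrable_on_E[where B="L\<^sup>2 + (L + lam * L)\<^sup>2"])
       (use R_bounds[OF t] in \<open>auto simp: abs_of_nonneg\<close>)
  have iE: "integrable lborel (indicator E :: _ \<Rightarrow> real)"
    using emeasure_bounded_finite[OF bounded_E] by (intro integrable_real_indicator) auto
  have eq: "indicator E x * sqrt ((1 + u t x)\<^sup>2 + t\<^sup>2 * K t x) =
      indicator E x + indicator E x * u t x + t\<^sup>2 * (indicator E x * R t x)" for x
    unfolding R_bounds(3)[OF t] by (simp add: algebra_simps)
  have i: "integrable lborel (\<lambda>x. indicator E x * sqrt ((1 + u t x)\<^sup>2 + t\<^sup>2 * K t x))"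
    unfolding eq using iu iR iE by (intro Bochner_Integration.integrable_add integrable_mult_right)
  have int: "(\<integral>x. indicator E x * sqrt ((1 + u t x)\<^sup>2 + t\<^sup>2 * K t x) \<partial>lborel) = ?I"
    unfolding eq using iu iR iE by (simp add: integrable_mult_right)
  have "(\<integral>\<^sup>+x\<in>E. ennreal (sqrt ((1 + u t x)\<^sup>2 + t\<^sup>2 * K t x)) \<partial>lborel) =
     (\<integral>\<^sup>+x. ennreal (indicator E x * sqrt ((1 + u t x)\<^sup>2 + t\<^sup>2 * K t x)) \<partial>lborel)"
    by (intro nn_integral_cong) (auto split: split_indicator)
  also have "\<dots> = ennreal (\<integral>x. indicator E x * sqrt ((1 + u t x)\<^sup>2 + t\<^sup>2 * K t x) \<partial>lborel)"
    by (intro nn_integral_eq_integral i AE_I2) simp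
  finally show "(\<integral>\<^sup>+x\<in>E. ennreal (sqrt ((1 + u t x)\<^sup>2 + t\<^sup>2 * K t x)) \<partial>lborel) = ennreal ?I"
    unfolding int .
  have "0 \<le> (\<integral>x. indicator E x * sqrt ((1 + u t x)\<^sup>2 + t\<^sup>2 * K t x) \<partial>lborel)"
    by (intro integral_nonneg_AE AE_I2) simp
  then show "0 \<le> ?I" unfolding int .
qed

lemma S_bound: obtains r0 where "\<And>x. x \<in> S \<Longrightarrow> norm x \<le> r0"
  using compact_imp_bounded[OF S] unfolding bounded_iff by auto

lemma gderiv_cone_radius_line:
  assumes D: "GDERIV F (x', s) :> G (x', s)" and x': "x' \<noteq> 0"
  shows "((\<lambda>s. lam * cone_radius F t (x', s)) has_real_derivative u t (x', s)) (at s)"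
proof -
  have l: "((\<lambda>s. (x', s)) has_derivative (\<lambda>h. (0, h))) (at s)"
    by (intro has_derivative_Pair has_derivative_const has_derivative_ident)
  have "fst (x', s) \<noteq> 0" using x' by simp
  from has_derivative_mult_right[OF has_derivative_compose[OF l gderiv_cone_radius[where F=F and t=t, OF D this]], of lam]
  have "((\<lambda>s. lam * cone_radius F t (x', s)) has_derivative
     (\<lambda>h. lam * ((fst (0 :: 'b, h) \<bullet> fst (x', s) + t\<^sup>2 * F (x', s) * ((0, h) \<bullet> G (x', s))) / cone_radius F t (x', s)))) (at s)" .
  moreover have "(\<lambda>h. lam * ((fst (0 :: 'b, h) \<bullet> fst (x', s) + t\<^sup>2 * F (x', s) * ((0, h) \<bullet> G (x', s))) / cone_radius F t (x', s)))
    = (*) (u t (x', s))"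
    by (simp add: fun_eq_iff cone_slope_def inner_prod_def)
  ultimately show ?thesis by (simp only: has_field_derivative_def)
qed

lemma integral_u_line:
  assumes t: "0 \<le> t" and x': "x' \<noteq> 0" and ae: "AE s in lborel. GDERIV F (x', s) :> G (x', s)"
  shows "(\<integral>s. indicator E (x', s) * u t (x', s) \<partial>lborel) = - lam * (cone_radius F t (x', lam * norm x') - norm x')"
proof -
  obtain r0 where r0: "\<And>x. x \<in> S \<Longrightarrow> norm x \<le> r0" by (rule S_bound) (rule that)
  have notS: "(x', s) \<notin> S" if "r0 < s" for s
    using r0[of "(x', s)"] norm_snd_le[of s x'] that by auto
  define a where "a = lam * norm x'"
  \<comment> \<open>Above both the cone and the support, so that \<open>F (x', b) = 0\<close> and
    the cone radius there is \<open>norm x'\<close>.\<close>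
  define b where "b = max a r0 + 1"
  define g where "g s = lam * cone_radius F t (x', s)" for s
  have "(lam * (1 + t * L))-lipschitz_on UNIV g"
  proof (rule lipschitz_onI)
    fix s s' :: real
    have "dist (cone_radius F t (x', s)) (cone_radius F t (x', s')) \<le> (1 + t * L) * dist (x', s) (x', s')"
      by (rule lipschitz_onD[OF lipschitz_cone_radius[OF F t]]) auto
    also have "dist (x', s) (x', s') = dist s s'" by (simp add: dist_Pair_Pair)
    finally show "dist (g s) (g s') \<le> lam * (1 + t * L) * dist s s'"
      using lam by (simp add: g_def dist_real_def abs_mult mult.assoc flip: right_diff_distrib)
  qed (use lam t lipschitz_on_nonneg[OF F] in simp)
  moreover have "a \<le> b" by (simp add: b_def)
  moreover have m: "(\<lambda>s. u t (x', s)) \<in> borel_measurable borel"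
    by (rule measurable_compose[OF _ u_measurable]) (intro borel_measurable_continuous_onI continuous_intros)
  ultimately have "(\<integral>s. u t (x', s) * indicator {a..b} s \<partial>lborel) = g b - g a"
  proof (rule lipschitz_FTC)
    show "AE s in lborel. s \<in> {a..b} \<longrightarrow> (g has_real_derivative u t (x', s)) (at s)"
      using ae by (rule eventually_mono) (use gderiv_cone_radius_line[OF _ x'] in \<open>auto simp: g_def[abs_def]\<close>)
  qed
  moreover have "(\<integral>s. indicator E (x', s) * u t (x', s) \<partial>lborel) = (\<integral>s. u t (x', s) * indicator {a..b} s \<partial>lborel)"
  proof (rule integral_cong_AE)
    show "(\<lambda>s. u t (x', s) * indicator {a..b} s) \<in> borel_measurable lborel" using m by simp
    have "(\<lambda>s. indicator E (x', s) :: real) \<in> borel_measurable borel"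
      by (rule measurable_compose[OF _ borel_measurable_indicator[OF sets_E]]) (intro borel_measurable_continuous_onI continuous_intros)
    then show "(\<lambda>s. indicator E (x', s) * u t (x', s)) \<in> borel_measurable lborel" using m by simp
    show "AE s in lborel. indicator E (x', s) * u t (x', s) = u t (x', s) * indicator {a..b} s"
      using AE_lborel_singleton[of a]
    proof (rule eventually_mono)
      fix s assume s: "s \<noteq> a"
      \<comment> \<open>Inside the cone but off the support \<open>F\<close> vanishes and with it
        \<open>u\<close>, so restricting to \<open>E\<close> amounts to restricting to
        \<open>{a..b}\<close>. The endpoint \<open>a\<close> is excluded because \<open>E\<close>
        uses the strict inequality.\<close>
      consider "s < a" | "a < s" "s \<le> b" "(x', s) \<in> S" | "a < s" "(x', s) \<notin> S" | "b < s" "(x', s) \<in> S"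
        using s by linarith
      then show "indicator E (x', s) * u t (x', s) = u t (x', s) * indicator {a..b} s"
      proof cases
        case 3
        then have "F (x', s) = 0" by (intro F0) (auto simp: a_def)
        then show ?thesis by (simp add: cone_slope_def)
      next
        case 4
        then show ?thesis using notS[of s] by (simp add: b_def)
      qed (auto simp: a_def)
    qed
  qed
  moreover have "g b = lam * norm x'"
  proof -
    have "F (x', b) = 0" using notS[of b] by (intro F0) (auto simp: b_def a_def)
    then show ?thesis by (simp add: g_def cone_radius_def)
  qed
  ultimately show ?thesis by (simp add: g_def a_def algebra_simps)
qed

text \<open>The vertical derivative of \<open>\<lambda>q\<close> integrates to its boundary value on the cone; there the
  factor \<open>1 / |x'|\<close>, which need not be integrable, never appears.\<close>

lemma integral_u:
  assumes t: "0 \<le> t"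
  shows "(\<integral>x. indicator E x * u t x \<partial>lborel) =
     - lam * (\<integral>x'. cone_radius F t (x', lam * norm x') - norm x' \<partial>lborel)"
proof -
  let ?v = "\<lambda>x. indicator E x * u t x :: real"
  have i: "integrable (lborel \<Otimes>\<^sub>M lborel) ?v"
    unfolding lborel_prod by (rule integrable_on_E[where B="lam * t * L"]) (use abs_u_le[OF t] in auto)
  have m: "(\<lambda>x'. cone_radius F t (x', lam * norm x')) \<in> borel_measurable borel"
    by (intro borel_measurable_cone_radius F_measurable borel_measurable_continuous_onI continuous_intros)
  have "AE x in lborel \<Otimes>\<^sub>M lborel. GDERIV F x :> G x" unfolding lborel_prod by (rule GF)
  then have ae: "AE x' in lborel. AE s in lborel. GDERIV F (x', s) :> G (x', s)"
    by (rule lborel_pair.AE_pair)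
  have "(\<integral>x. ?v x \<partial>lborel) = (\<integral>x'. (\<integral>s. ?v (x', s) \<partial>lborel) \<partial>lborel)"
    using lborel_pair.integral_fst'[OF i] unfolding lborel_prod by simp
  also have "\<dots> = (\<integral>x'. - lam * (cone_radius F t (x', lam * norm x') - norm x') \<partial>lborel)"
  proof (rule integral_cong_AE)
    show "(\<lambda>x'. \<integral>s. ?v (x', s) \<partial>lborel) \<in> borel_measurable lborel"
      using lborel_pair.integrable_fst'[OF i] by (rule borel_measurable_integrable)
    show "(\<lambda>x'. - lam * (cone_radius F t (x', lam * norm x') - norm x')) \<in> borel_measurable lborel"
      using m by simp
    show "AE x' in lborel. (\<integral>s. ?v (x', s) \<partial>lborel) = - lam * (cone_radius F t (x', lam * norm x') - norm x')"
      using ae AE_lborel_singleton[of "0 :: 'b"]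
      by eventually_elim (rule integral_u_line[OF t])
  qed
  finally show ?thesis by simp
qed

section \<open>The boundary term and the exact difference quotient\<close>

definition trace_energy :: "real \<Rightarrow> 'b \<Rightarrow> real" where
  "trace_energy t x' = (F (x', lam * norm x'))\<^sup>2 / (cone_radius F t (x', lam * norm x') + norm x')"

lemma trace_energy_nonneg [simp]: "0 \<le> trace_energy t x'"
  by (simp add: trace_energy_def)

lemma cone_radius_diff_eq: "cone_radius F t (x', lam * norm x') - norm x' = t\<^sup>2 * trace_energy t x'"
proof (cases "cone_radius F t (x', lam * norm x') + norm x' = 0")
  \<comment> \<open>With a zero denominator both sides vanish, the right one by division by
    zero.\<close>
  case True
  then have "cone_radius F t (x', lam * norm x') = 0" "norm x' = 0"
    using cone_radius_nonneg[of F t "(x', lam * norm x')"] norm_ge_zero[of x'] by linarith+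
  with True show ?thesis by (simp add: trace_energy_def)
next
  case False
  have "(cone_radius F t (x', lam * norm x') - norm x') * (cone_radius F t (x', lam * norm x') + norm x')
     = (cone_radius F t (x', lam * norm x'))\<^sup>2 - (norm x')\<^sup>2"
    by (simp add: power2_eq_square algebra_simps)
  also have "\<dots> = t\<^sup>2 * (F (x', lam * norm x'))\<^sup>2" by (simp add: cone_radius_sq)
  finally show ?thesis using False by (simp add: trace_energy_def eq_divide_eq)
qed

lemma trace_energy_measurable [measurable]: "trace_energy t \<in> borel_measurable borel"
proof -
  have "(\<lambda>x'. F (x', lam * norm x')) \<in> borel_measurable borel"
    by (intro borel_measurable_continuous_onI continuous_on_compose2[OF lipschitz_on_continuous_on[OF F]] continuous_intros) auto
  moreover have "(\<lambda>x'. cone_radius F t (x', lam * norm x')) \<in> borel_measurable borel"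
    by (intro borel_measurable_cone_radius F_measurable borel_measurable_continuous_onI continuous_intros)
  ultimately show ?thesis unfolding trace_energy_def[abs_def] by simp
qed

text \<open>For fixed \<open>t > 0\<close> the product \<open>t\<^sup>2 * trace_energy t x'\<close>
  is \<open>q - norm x'\<close>, at most \<open>t\<close> times the boundary value of
  \<open>F\<close> in absolute value, and vanishes outside a ball. The bound degenerates as
  \<open>t\<close> tends to \<open>0\<close>.\<close>

lemma integrable_trace_energy:
  assumes t: "0 < t"
  shows "integrable lborel (trace_energy t)"
proof -
  obtain r0 where r0: "\<And>x. x \<in> S \<Longrightarrow> norm x \<le> r0" by (rule S_bound) (rule that)
  \<comment> \<open>A bound for \<open>F\<close> on the cone boundary over
    \<open>cball 0 r0\<close>, whose points have norm at most \<open>(1 + lam) * r0\<close>.\<close>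
  define B where "B = \<bar>F 0\<bar> + L * ((1 + lam) * r0)"
  have bd: "norm (t\<^sup>2 * trace_energy t x') \<le> norm (t * B * indicator (cball 0 r0) x')" for x'
  proof (cases "norm x' \<le> r0")
    case True
    let ?p = "(x', lam * norm x')"
    have "lam * norm x' \<le> lam * r0" using True lam by (intro mult_left_mono) auto
    moreover have "norm ?p \<le> norm x' + lam * norm x'"
      using norm_Pair_le[of x' "lam * norm x'"] lam by simp
    ultimately have "norm ?p \<le> (1 + lam) * r0" using True by (simp add: distrib_right)
    then have "L * norm ?p \<le> L * ((1 + lam) * r0)"
      by (intro mult_left_mono lipschitz_on_nonneg[OF F])
    moreover have "\<bar>F ?p - F 0\<bar> \<le> L * norm ?p"
      using lipschitz_onD[OF F, of ?p 0] by (simp add: dist_real_def)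
    ultimately have "\<bar>F ?p\<bar> \<le> B" by (simp add: B_def)
    moreover have "cone_radius F t ?p \<le> norm x' + t * \<bar>F ?p\<bar>"
      using norm_Pair_le[of x' "t * F ?p"] t by (simp add: cone_radius_def abs_mult)
    ultimately have "cone_radius F t ?p - norm x' \<le> t * B"
      using mult_left_mono[of "\<bar>F ?p\<bar>" B t] t by linarith
    then have "t\<^sup>2 * trace_energy t x' \<le> t * B" by (simp only: cone_radius_diff_eq)
    then show ?thesis using True t by simp
  next
    case False
    then have "(x', lam * norm x') \<notin> S" using r0[of "(x', lam * norm x')"] norm_fst_le[of x' "lam * norm x'"] by auto
    then have "F (x', lam * norm x') = 0" by (intro F0) auto
    then show ?thesis by (simp add: trace_energy_def)
  qed
  have "integrable lborel (\<lambda>x'. t\<^sup>2 * trace_energy t x')"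
  proof (rule Bochner_Integration.integrable_bound)
    show "integrable lborel (\<lambda>x' :: 'b. t * B * indicator (cball 0 r0) x')"
      using emeasure_lborel_cball_finite[of "0 :: 'b" r0]
      by (intro integrable_mult_right integrable_real_indicator) auto
    show "AE x' in lborel. norm (t\<^sup>2 * trace_energy t x') \<le> norm (t * B * indicator (cball 0 r0) x')"
      by (intro AE_I2 bd)
  qed simp
  then show ?thesis using t by simp
qed

definition flow_area :: "real \<Rightarrow> ennreal" where
  "flow_area t = hausdorff_measure DIM('b \<times> real)
      ((\<lambda>x. (fst x, snd x + lam * cone_radius F t x - lam * norm (fst x), t * F x)) ` E)"

text \<open>An exact identity for every small \<open>t\<close>: the volume of \<open>E\<close>
  cancels, and after integration the first-order term carries a full factor
  \<open>t\<^sup>2\<close>.\<close>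

lemma flow_area_quotient:
  assumes t: "0 < t" "lam * t * L \<le> 1 / 2"
  shows "(enn2ereal (flow_area t) - enn2ereal (flow_area 0)) / ereal (t\<^sup>2) =
    ereal (\<integral>x. indicator E x * R t x \<partial>lborel) - ereal lam * enn2ereal (\<integral>\<^sup>+x'. ennreal (trace_energy t x') \<partial>lborel)"
proof -
  have A: "enn2ereal (flow_area t) = ereal (measure lborel E + (\<integral>x. indicator E x * u t x \<partial>lborel) + t\<^sup>2 * (\<integral>x. indicator E x * R t x \<partial>lborel))"
    if "0 \<le> t" "lam * t * L \<le> 1 / 2" for t
    unfolding flow_area_def area_flow[OF that] area_flow_expansion(1)[OF that]
    by (rule enn2ereal_ennreal[OF area_flow_expansion(2)[OF that]])
  have A0: "enn2ereal (flow_area 0) = ereal (measure lborel E)"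
    using A[of 0] by (simp add: cone_slope_def)
  have "(\<integral>x. indicator E x * u t x \<partial>lborel) = - lam * (t\<^sup>2 * (\<integral>x'. trace_energy t x' \<partial>lborel))"
    using integral_u[of t] t by (simp add: cone_radius_diff_eq)
  then have "(enn2ereal (flow_area t) - enn2ereal (flow_area 0)) / ereal (t\<^sup>2) =
     ereal ((- lam * (t\<^sup>2 * (\<integral>x'. trace_energy t x' \<partial>lborel)) + t\<^sup>2 * (\<integral>x. indicator E x * R t x \<partial>lborel)) / t\<^sup>2)"
    unfolding A0 using A[of t] t by simp
  also have "\<dots> = ereal ((\<integral>x. indicator E x * R t x \<partial>lborel) - lam * (\<integral>x'. trace_energy t x' \<partial>lborel))"
    using t by (simp add: field_simps)
  also have "enn2ereal (\<integral>\<^sup>+x'. ennreal (trace_energy t x') \<partial>lborel) = ereal (\<integral>x'. trace_energy t x' \<partial>lborel)"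
    using integrable_trace_energy[OF t(1)]
    by (subst nn_integral_eq_integral) (auto intro!: enn2ereal_ennreal integral_nonneg_AE)
  then have "ereal ((\<integral>x. indicator E x * R t x \<partial>lborel) - lam * (\<integral>x'. trace_energy t x' \<partial>lborel)) =
    ereal (\<integral>x. indicator E x * R t x \<partial>lborel) - ereal lam * enn2ereal (\<integral>\<^sup>+x'. ennreal (trace_energy t x') \<partial>lborel)"
    by simp
  finally show ?thesis .
qed

section \<open>Passage to the limit\<close>

lemma tendsto_integral_R:
  assumes t: "\<And>n :: nat. 0 < t n" "\<And>n. lam * t n * L \<le> 1 / 2" "t \<longlonglongrightarrow> 0"
  shows "(\<lambda>n. \<integral>x. indicator E x * R (t n) x \<partial>lborel) \<longlonglongrightarrow> (\<integral>x. indicator E x * ((norm (G x))\<^sup>2 / 2) \<partial>lborel)"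
proof (rule integral_dominated_convergence[where w="\<lambda>x. indicator E x * (L\<^sup>2 + (L + lam * L)\<^sup>2)"])
  show "integrable lborel (\<lambda>x. indicator E x * (L\<^sup>2 + (L + lam * L)\<^sup>2))"
    by (rule integrable_on_E[where B="L\<^sup>2 + (L + lam * L)\<^sup>2"]) auto
  show "AE x in lborel. norm (indicator E x * R (t n) x) \<le> indicator E x * (L\<^sup>2 + (L + lam * L)\<^sup>2)" for n
    using R_bounds[of "t n"] t(1)[of n] t(2)[of n] by (intro AE_I2) (auto split: split_indicator)
  show "AE x in lborel. (\<lambda>n. indicator E x * R (t n) x) \<longlonglongrightarrow> indicator E x * ((norm (G x))\<^sup>2 / 2)"
    using AE_fst_nonzero
  proof (rule eventually_mono)
    fix x :: "'b \<times> real" assume x: "fst x \<noteq> 0"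
    have q: "(\<lambda>n. cone_radius F (t n) x) \<longlonglongrightarrow> norm (fst x)"
    proof -
      have "(\<lambda>n. norm (fst x, t n * F x)) \<longlonglongrightarrow> norm (fst x, 0 * F x)"
        by (intro tendsto_intros t)
      then show ?thesis by (simp add: cone_radius_def)
    qed
    have "(\<lambda>n. u (t n) x) \<longlonglongrightarrow> lam * 0\<^sup>2 * F x * snd (G x) / norm (fst x)"
      unfolding cone_slope_def using x by (intro tendsto_intros t q) simp
    then have u: "(\<lambda>n. u (t n) x) \<longlonglongrightarrow> 0" by simp
    \<comment> \<open>As the cone radius tends to \<open>norm (fst x)\<close> the correction along
      \<open>fst x\<close> disappears and the squared gradient remains; the denominator of
      \<open>R\<close> tends to \<open>2\<close>.\<close>
    have "(\<lambda>n. K (t n) x) \<longlonglongrightarrow> (snd (G x))\<^sup>2 +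
        (norm (fst (G x) + (lam * snd (G x) * (1 / norm (fst x) - 1 / norm (fst x))) *\<^sub>R fst x))\<^sup>2"
      unfolding cone_energy_def using x by (intro tendsto_intros q) simp
    moreover have "(snd (G x))\<^sup>2 + (norm (fst (G x)))\<^sup>2 = (norm (G x))\<^sup>2"
      by (cases "G x") (simp add: norm_Pair)
    ultimately have K: "(\<lambda>n. K (t n) x) \<longlonglongrightarrow> (norm (G x))\<^sup>2" by simp
    have "(\<lambda>n. R (t n) x) \<longlonglongrightarrow> (norm (G x))\<^sup>2 / (sqrt ((1 + 0)\<^sup>2 + 0\<^sup>2 * (norm (G x))\<^sup>2) + 1 + 0)"
      unfolding cone_remainder_def by (intro tendsto_intros u K t) simp
    then have "(\<lambda>n. R (t n) x) \<longlonglongrightarrow> (norm (G x))\<^sup>2 / 2" by simp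
    then show "(\<lambda>n. indicator E x * R (t n) x) \<longlonglongrightarrow> indicator E x * ((norm (G x))\<^sup>2 / 2)"
      by (intro tendsto_intros)
  qed
qed measurable

text \<open>The limit may be infinite, so the argument is monotone convergence in the extended
  reals, and \<open>t\<close> is taken decreasing.\<close>

lemma tendsto_nn_integral_trace_energy:
  assumes t: "\<And>n :: nat. 0 < t n" "decseq t" "t \<longlonglongrightarrow> 0"
  shows "(\<lambda>n. \<integral>\<^sup>+x'. ennreal (trace_energy (t n) x') \<partial>lborel) \<longlonglongrightarrow>
    (\<integral>\<^sup>+x'. ennreal ((F (x', lam * norm x'))\<^sup>2 / (2 * norm x')) \<partial>lborel)"
proof -
  let ?p = "\<lambda>x'. (x', lam * norm x')"
  \<comment> \<open>The limit integrand is \<open>0\<close> at the origin, by division by zero, although \<open>trace_energy\<close> may blow up there.\<close>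
  define f where "f n x' = ennreal (trace_energy (t n) x') * indicator (- {0}) x'" for n x'
  have ae: "(\<integral>\<^sup>+x'. ennreal (trace_energy (t n) x') \<partial>lborel) = (\<integral>\<^sup>+x'. f n x' \<partial>lborel)" for n
    by (rule nn_integral_cong_AE) (use AE_lborel_singleton[of "0 :: 'b"] in \<open>auto elim!: eventually_mono simp: f_def\<close>)
  have "(\<lambda>n. \<integral>\<^sup>+x'. f n x' \<partial>lborel) \<longlonglongrightarrow> (\<integral>\<^sup>+x'. ennreal ((F (?p x'))\<^sup>2 / (2 * norm x')) \<partial>lborel)"
  proof (rule nn_integral_LIMSEQ)
    show "f n \<in> borel_measurable lborel" for n unfolding f_def[abs_def] by simp
    show "incseq f"
    proof (intro incseq_SucI le_funI)
      fix n x'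
      have tt: "t (Suc n) \<le> t n" "0 < t (Suc n)" using t by (auto simp: decseq_Suc_iff)
      show "f n x' \<le> f (Suc n) x'"
      proof (cases "x' = 0")
        case False
        have "(t (Suc n))\<^sup>2 * (F (?p x'))\<^sup>2 \<le> (t n)\<^sup>2 * (F (?p x'))\<^sup>2"
          using tt by (intro mult_right_mono power_mono) auto
        then have "(cone_radius F (t (Suc n)) (?p x'))\<^sup>2 \<le> (cone_radius F (t n) (?p x'))\<^sup>2"
          by (simp add: cone_radius_sq)
        then have "cone_radius F (t (Suc n)) (?p x') \<le> cone_radius F (t n) (?p x')"
          by (rule power2_le_imp_le) simp
        moreover have "0 < norm x'" using False by simp
        ultimately have "trace_energy (t n) x' \<le> trace_energy (t (Suc n)) x'"
          unfolding trace_energy_def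
          by (intro divide_left_mono add_right_mono mult_pos_pos add_nonneg_pos) auto
        then show ?thesis by (simp add: f_def False ennreal_leI)
      qed (simp add: f_def)
    qed
    show "(\<lambda>n. f n x') \<longlonglongrightarrow> ennreal ((F (?p x'))\<^sup>2 / (2 * norm x'))" for x'
    proof (cases "x' = 0")
      case False
      have "(\<lambda>n. norm (x', t n * F (?p x'))) \<longlonglongrightarrow> norm (x', 0 * F (?p x'))"
        by (intro tendsto_intros t)
      then have "(\<lambda>n. cone_radius F (t n) (?p x')) \<longlonglongrightarrow> norm x'" by (simp add: cone_radius_def)
      then have "(\<lambda>n. trace_energy (t n) x') \<longlonglongrightarrow> (F (?p x'))\<^sup>2 / (norm x' + norm x')"
        unfolding trace_energy_def using False by (intro tendsto_intros) auto
      then have "(\<lambda>n. ennreal (trace_energy (t n) x')) \<longlonglongrightarrow> ennreal ((F (?p x'))\<^sup>2 / (norm x' + norm x'))"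
        by (rule tendsto_ennrealI)
      then show ?thesis using False by (simp add: f_def)
    qed (simp add: f_def)
  qed
  then show ?thesis unfolding ae .
qed

theorem flow_area_derivative:
  "((\<lambda>s. (enn2ereal (flow_area (sqrt s)) - enn2ereal (flow_area 0)) / ereal s) \<longlongrightarrow>
    ereal (1 / 2) * (enn2ereal (\<integral>\<^sup>+x\<in>E. ennreal ((norm (G x))\<^sup>2) \<partial>lborel)
      - ereal lam * enn2ereal (\<integral>\<^sup>+x'. ennreal ((F (x', lam * norm x'))\<^sup>2 / norm x') \<partial>lborel))) (at_right 0)"
proof -
  define P where "P = (\<integral>x. indicator E x * (norm (G x))\<^sup>2 \<partial>lborel)"
  define Q where "Q = (\<integral>\<^sup>+x'. ennreal ((F (x', lam * norm x'))\<^sup>2 / norm x') \<partial>lborel)"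
  have L: "0 \<le> L" by (rule lipschitz_on_nonneg[OF F])
  have P: "(\<integral>\<^sup>+x\<in>E. ennreal ((norm (G x))\<^sup>2) \<partial>lborel) = ennreal P" "0 \<le> P"
  proof -
    have i: "integrable lborel (\<lambda>x. indicator E x * (norm (G x))\<^sup>2)"
      by (rule integrable_on_E[where B="L\<^sup>2"]) (use G_le in \<open>auto intro: power_mono\<close>)
    have "(\<integral>\<^sup>+x\<in>E. ennreal ((norm (G x))\<^sup>2) \<partial>lborel) = (\<integral>\<^sup>+x. ennreal (indicator E x * (norm (G x))\<^sup>2) \<partial>lborel)"
      by (intro nn_integral_cong) (auto split: split_indicator)
    also have "\<dots> = ennreal P" unfolding P_def by (intro nn_integral_eq_integral i AE_I2) simp
    finally show "(\<integral>\<^sup>+x\<in>E. ennreal ((norm (G x))\<^sup>2) \<partial>lborel) = ennreal P" .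
    show "0 \<le> P" unfolding P_def by (intro integral_nonneg_AE AE_I2) simp
  qed
  have halfQ: "(\<integral>\<^sup>+x'. ennreal ((F (x', lam * norm x'))\<^sup>2 / (2 * norm x')) \<partial>lborel) = ennreal (1 / 2) * Q"
  proof -
    have m: "(\<lambda>x'. F (x', lam * norm x')) \<in> borel_measurable borel"
      by (intro borel_measurable_continuous_onI continuous_on_compose2[OF lipschitz_on_continuous_on[OF F]] continuous_intros) auto
    have "(\<integral>\<^sup>+x'. ennreal ((F (x', lam * norm x'))\<^sup>2 / (2 * norm x')) \<partial>lborel) =
       (\<integral>\<^sup>+x'. ennreal (1 / 2) * ennreal ((F (x', lam * norm x'))\<^sup>2 / norm x') \<partial>lborel)"
      by (intro nn_integral_cong, subst ennreal_mult[symmetric]) auto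
    also have "\<dots> = ennreal (1 / 2) * Q" unfolding Q_def using m by (intro nn_integral_cmult) simp
    finally show ?thesis .
  qed
  \<comment> \<open>For \<open>s < s0\<close> this gives
    \<open>(lam * L + 1) * sqrt s \<le> 1 / 2\<close>; the summand \<open>1\<close> covers
    \<open>L = 0\<close>.\<close>
  define s0 where "s0 = (1 / (2 * (lam * L + 1)))\<^sup>2"
  have pos: "0 < lam * L + 1" using lam L by (simp add: add_nonneg_pos)
  have s0: "0 < s0" unfolding s0_def using pos by simp
  have small: "lam * sqrt s * L \<le> 1 / 2" if "0 < s" "s < s0" for s
  proof -
    have "sqrt s \<le> 1 / (2 * (lam * L + 1))"
      using real_sqrt_le_mono[of s s0] that pos by (simp add: s0_def)
    then have "(lam * L + 1) * sqrt s \<le> 1 / 2" using pos by (simp add: field_simps)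
    then show ?thesis using that by (simp add: algebra_simps) (smt (verit) real_sqrt_gt_zero)
  qed
  have "((\<lambda>s. (enn2ereal (flow_area (sqrt s)) - enn2ereal (flow_area 0)) / ereal s) \<longlongrightarrow>
     ereal (P / 2) - ereal lam * enn2ereal (ennreal (1 / 2) * Q)) (at_right 0)"
  proof (rule tendsto_at_right_sequentially[OF s0])
    \<comment> \<open>A right limit may be tested on decreasing sequences, the form needed for
      monotone convergence.\<close>
    fix s :: "nat \<Rightarrow> real"
    assume s: "\<And>n. 0 < s n" "\<And>n. s n < s0" "decseq s" "s \<longlonglongrightarrow> 0"
    define t where "t n = sqrt (s n)" for n
    have t: "\<And>n. 0 < t n" "\<And>n. lam * t n * L \<le> 1 / 2" "t \<longlonglongrightarrow> 0" "decseq t"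
      using s small tendsto_real_sqrt[OF s(4)] by (auto simp: t_def[abs_def] decseq_def)
    have "(\<integral>x. indicator E x * ((norm (G x))\<^sup>2 / 2) \<partial>lborel) = P / 2" by (simp add: P_def)
    with tendsto_integral_R[OF t(1-3)]
    have 1: "(\<lambda>n. ereal (\<integral>x. indicator E x * R (t n) x \<partial>lborel)) \<longlonglongrightarrow> ereal (P / 2)" by simp
    have 2: "(\<lambda>n. ereal lam * enn2ereal (\<integral>\<^sup>+x'. ennreal (trace_energy (t n) x') \<partial>lborel)) \<longlonglongrightarrow>
       ereal lam * enn2ereal (ennreal (1 / 2) * Q)"
      using tendsto_nn_integral_trace_energy[OF t(1,4,3)] unfolding halfQ
      by (intro tendsto_cmult_ereal) auto
    \<comment> \<open>The first limit is a real number, so no indeterminate difference of infinities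
      can occur.\<close>
    have "(\<lambda>n. (enn2ereal (flow_area (t n)) - enn2ereal (flow_area 0)) / ereal ((t n)\<^sup>2)) \<longlonglongrightarrow>
       ereal (P / 2) - ereal lam * enn2ereal (ennreal (1 / 2) * Q)"
      unfolding flow_area_quotient[OF t(1,2)] by (rule tendsto_diff_ereal_general[OF 1 2]) simp
    moreover have "(t n)\<^sup>2 = s n" for n using s(1)[of n] by (simp add: t_def)
    ultimately show "(\<lambda>n. (enn2ereal (flow_area (sqrt (s n))) - enn2ereal (flow_area 0)) / ereal (s n)) \<longlonglongrightarrow>
       ereal (P / 2) - ereal lam * enn2ereal (ennreal (1 / 2) * Q)"
      by (simp add: t_def)
  qed
  also have "ereal (P / 2) - ereal lam * enn2ereal (ennreal (1 / 2) * Q) =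
     ereal (1 / 2) * (enn2ereal (ennreal P) - ereal lam * enn2ereal Q)"
  proof (cases Q)
    case (real q)
    then have "enn2ereal (ennreal (1 / 2) * Q) = ereal (q / 2)"
      by (subst real(2), subst ennreal_mult[symmetric]) (auto simp: enn2ereal_ennreal)
    moreover have "enn2ereal Q = ereal q" using real by (simp add: enn2ereal_ennreal)
    moreover have "enn2ereal (ennreal P) = ereal P" using P(2) by (simp add: enn2ereal_ennreal)
    ultimately show ?thesis by (simp add: right_diff_distrib)
  next
    \<comment> \<open>Both sides are \<open>-\<infinity>\<close>, since \<open>P\<close> is finite
      and \<open>lam\<close> positive.\<close>
    case top
    then show ?thesis using P(2) lam by (simp add: enn2ereal_ennreal ennreal_mult_top)
  qed
  finally show ?thesis by (simp only: P(1) Q_def)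
qed

end

section \<open>Transfer to the given function\<close>

theorem theorem3p3:
  fixes lam :: real and f :: "(real ^ 'm) \<times> real \<Rightarrow> real"
  assumes "lam > 0" and "f \<in> lipschitz_compact_spt lam"
  shows "lower_right_deriv_0 (\<lambda>s. enn2ereal (area_sqrt lam f s)) =
    ereal (1 / 2) *
      (enn2ereal (\<integral>\<^sup>+ x \<in> slice lam. ennreal ((norm (grad f x))\<^sup>2) \<partial>lborel)
       - ereal lam * enn2ereal (\<integral>\<^sup>+ x'. ennreal ((f (x', lam * norm x'))\<^sup>2 / norm x') \<partial>lborel))"
proof -
  obtain L where fL: "L-lipschitz_on (closure (slice lam)) f" and S: "compact (spt lam f)"
    using assms(2) unfolding lipschitz_compact_spt_def by blast
  obtain F where F: "L-lipschitz_on UNIV F" and Ff: "\<And>x. x \<in> closure (slice lam) \<Longrightarrow> F x = f x"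
    by (rule lipschitz_extension[OF fL]) (rule that)
  obtain G where grads: "G \<in> borel_measurable borel" "AE x in lborel. GDERIV F x :> G x" "\<And>x. norm (G x) \<le> L"
    by (rule borel_measurable_gradient[OF F]) (rule that)
  have cl: "closure (slice lam) = {x :: (real ^ 'm) \<times> real. lam * norm (fst x) \<le> snd x}"
    unfolding closure_slice by (simp add: case_prod_unfold)
  have f0: "f x = 0" if "x \<in> closure (slice lam)" "x \<notin> spt lam f" for x
    using that closure_subset[of "{x \<in> closure (slice lam). f x \<noteq> 0}"] by (auto simp: spt_def)
  interpret cone_flow lam L F G "spt lam f"
  proof
    show "F x = 0" if "lam * norm (fst x) \<le> snd x" "x \<notin> spt lam f" for x
      using that f0[of x] Ff[of x] unfolding cl by simp
  qed (use assms F grads S in auto)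
  have E: "slice lam \<inter> spt lam f = {x. lam * norm (fst x) < snd x} \<inter> spt lam f"
    unfolding slice_eq by auto
  have A: "area lam f t = flow_area t" for t
  proof -
    have "flow lam f x t = (fst x, snd x + lam * cone_radius F t x - lam * norm (fst x), t * F x)"
      if "x \<in> slice lam" for x
      using that Ff[of x] closure_subset[of "slice lam"]
      by (auto simp: flow_def cone_radius_def norm_Pair power_mult_distrib)
    then have "(\<lambda>x. flow lam f x t) ` (slice lam \<inter> spt lam f) =
        (\<lambda>x. (fst x, snd x + lam * cone_radius F t x - lam * norm (fst x), t * F x)) ` (slice lam \<inter> spt lam f)"
      by (intro image_cong) auto
    then show ?thesis unfolding area_def flow_area_def E by simp
  qed
  \<comment> \<open>On the open slice \<open>f\<close> and \<open>F\<close> agree, so their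
    gradients do. Off the closed support \<open>f\<close> vanishes on a neighbourhood, so
    \<open>grad f\<close> is \<open>0\<close> there and the integral reduces to the support.\<close>
  have grad: "(\<integral>\<^sup>+ x \<in> slice lam. ennreal ((norm (grad f x))\<^sup>2) \<partial>lborel) =
      (\<integral>\<^sup>+x\<in>{x. lam * norm (fst x) < snd x} \<inter> spt lam f. ennreal ((norm (G x))\<^sup>2) \<partial>lborel)"
  proof (rule nn_integral_cong_AE)
    show "AE x in lborel. ennreal ((norm (grad f x))\<^sup>2) * indicator (slice lam) x =
       ennreal ((norm (G x))\<^sup>2) * indicator ({x. lam * norm (fst x) < snd x} \<inter> spt lam f) x"
      using grads(2)
    proof (rule eventually_mono)
      fix x assume x: "GDERIV F x :> G x"
      show "ennreal ((norm (grad f x))\<^sup>2) * indicator (slice lam) x =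
       ennreal ((norm (G x))\<^sup>2) * indicator ({x. lam * norm (fst x) < snd x} \<inter> spt lam f) x"
      proof (cases "x \<in> slice lam")
        case True
        have local: "GDERIV f x :> D" if D: "GDERIV g x :> D" and U: "open U" "x \<in> U" "\<And>y. y \<in> U \<Longrightarrow> g y = f y" for g U D
          using D unfolding gderiv_def
          by (rule has_derivative_transform_within_open[OF _ U])
        show ?thesis
        proof (cases "x \<in> spt lam f")
          case in_spt: True
          have "GDERIV f x :> G x"
            by (rule local[OF x open_slice True]) (use Ff closure_subset in blast)
          then have "grad f x = G x" by (rule grad_eqI)
          then show ?thesis using True in_spt by (auto simp: slice_eq)
        next
          case False
          have "closed (spt lam f)" by (simp add: spt_def)
          have "GDERIV f x :> 0"
          proof (rule local)
            show "GDERIV (\<lambda>_. 0 :: real) x :> 0" by (simp add: gderiv_def)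
            show "open (slice lam - spt lam f)" by (intro open_Diff open_slice \<open>closed (spt lam f)\<close>)
            show "x \<in> slice lam - spt lam f" using True False by simp
            show "0 = f y" if "y \<in> slice lam - spt lam f" for y
              using f0[of y] that closure_subset[of "slice lam"] by auto
          qed
          then have "grad f x = 0" by (rule grad_eqI)
          then show ?thesis using False by simp
        qed
      qed (auto simp: slice_eq)
    qed
  qed
  have trace: "F (x', lam * norm x') = f (x', lam * norm x')" for x' by (rule Ff) (simp add: cl)
  have "((\<lambda>s. (enn2ereal (area_sqrt lam f s) - enn2ereal (area_sqrt lam f 0)) / ereal s) \<longlongrightarrow>
     ereal (1 / 2) *
      (enn2ereal (\<integral>\<^sup>+ x \<in> slice lam. ennreal ((norm (grad f x))\<^sup>2) \<partial>lborel)
       - ereal lam * enn2ereal (\<integral>\<^sup>+ x'. ennreal ((f (x', lam * norm x'))\<^sup>2 / norm x') \<partial>lborel))) (at_right 0)"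
    using flow_area_derivative unfolding grad area_sqrt_def A trace by simp
  \<comment> \<open>The full right limit exists, so the lower limit equals it.\<close>
  then show ?thesis
    unfolding lower_right_deriv_0_def by (intro lim_imp_Liminf) simp_all
qed

end
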